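(* Let the domains, coefficients, data, spaces $\mathbf W_\beta,\mathcal M_\beta$, forms $a_\beta,b_\beta$ and linear forms $\mathbf g,f$ be as described in the context. Then the problem $$(\mathcal P_\beta)\qquad \text{Find } \mathbf u\in\mathbf W_\beta \text{ and } p\in\mathcal M_\beta \text{ such that } \begin{cases} a_\beta(\mathbf u,\mathbf v)-b_\beta(\mathbf v,p)=\mathbf g(\mathbf v) & \forall\,\mathbf v\in\mathbf W_\beta,\\ b_\beta(\mathbf u,r)=f(r) & \forall\, r\in\mathcal M_\beta,\end{cases}$$ admits a unique solution $(\mathbf u_\beta,p_\beta)\in\mathbf W_\beta\times\mathcal M_\beta$.
   Context: **Geometry.** $\Omega\subset\mathbb R^d$ is a bounded domain with boundary $\Gamma$; $\gamma\subset\Omega$ is a $(d-1)$-dimensional surface contained in a hyperplane which separates $\Omega$ into two subdomains: $\Omega=\Omega_1\cup\gamma\cup\Omega_2$ (disjoint union), $\gamma=(\overline\Omega_1\cap\overline\Omega_2)\cap\Omega$, and $\Gamma_i=\Gamma\cap\partial\Omega_i$, $i=1,2$. The domains $\Omega_1,\Omega_2\subset\mathbb R^d$ and $\gamma$ (viewed as a domain in $\mathbb R^{d-1}$) are Lipschitz. $\mathbf n$ is the unit normal on $\gamma$ directed outward from $\Omega_1$; $\mathbf n_i$ and $\mathbf n_\gamma$ are the exterior unit normals on $\partial\Omega_i$ and $\partial\gamma$. On $\gamma$, $\mathrm{div}$ and $\nabla$ denote the tangential divergence and gradient. The subdomain index $i$ is taken modulo 2 (if $i=2$ then $i+1=1$).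 $\|\cdot\|_{0,p,D}$ is the norm of $L^p(D)$ (or of its vector-valued version). **Coefficients.** $\alpha_i:\Omega_i\to\mathbb R^{d,d}$ ($i=1,2$) and $\alpha_\gamma:\gamma\to\mathbb R^{d-1,d-1}$ are measurable and symmetric; $\beta_i:\Omega_i\to\mathbb R$, $\beta_\gamma:\gamma\to\mathbb R$, $\kappa:\gamma\to\mathbb R$ are measurable. There are positive finite constants with $\underline\alpha_i|\mathbf x|^2\le \mathbf x\cdot\alpha_i(\mathbf y)\mathbf x\le\overline\alpha_i|\mathbf x|^2$ ($\mathbf y\in\Omega_i,\mathbf x\in\mathbb R^d$), $\underline\alpha_\gamma|\mathbf x|^2\le \mathbf x\cdot\alpha_\gamma(\mathbf y)\mathbf x\le\overline\alpha_\gamma|\mathbf x|^2$ ($\mathbf y\in\gamma,\mathbf x\in\mathbb R^{d-1}$), $\underline\beta_i\le\beta_i\le\overline\beta_i$ on $\Omega_i$, $\underline\beta_\gamma\le\beta_\gamma\le\overline\beta_\gamma$ on $\gamma$, $\underline\kappa\le\kappa\le\overline\kappa$ on $\gamma$. The constant $\xi$ satisfies $\xi>1/2$, and $\bar\xi=1-\xi$. **Data.** $q=(q_1,q_2,q_\gamma)\in L^3(\Omega_1)\times L^3(\Omega_2)\times L^3(\gamma)$ and $p_d=(p_{d,1},p_{d,2},p_{d,\gamma})$ with $p_{d,i}\in W^{1/3,3/2}(\Gamma_i)\cap H^{1/2}(\Gamma_i)$, $p_{d,\gamma}\in H^{1/2}(\partial\gamma)$. **Spaces.** $\mathcal M_\beta=L^{3/2}(\Omega_1)\times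 L^{3/2}(\Omega_2)\times L^{3/2}(\gamma)$ with norm the sum of the norms of the components; its dual is $\mathcal M_\beta'=L^3(\Omega_1)\times L^3(\Omega_2)\times L^3(\gamma)$ (normed by the sum of the component norms). $\mathbf V_\beta=(L^3(\Omega_1))^d\times(L^3(\Omega_2))^d\times(L^3(\gamma))^{d-1}$ with norm the sum of the component norms. For $\mathbf u=(\mathbf u_1,\mathbf u_2,\mathbf u_\gamma)$ put $$\mathrm{Div}\,\mathbf u=(\mathrm{div}\,\mathbf u_1,\ \mathrm{div}\,\mathbf u_2,\ \mathrm{div}\,\mathbf u_\gamma-[\mathbf u_1\cdot\mathbf n-\mathbf u_2\cdot\mathbf n]),$$ and $$\mathbf W_\beta=\{\mathbf u\in\mathbf V_\beta:\ \mathrm{Div}\,\mathbf u\in\mathcal M_\beta',\ \mathbf u_i\cdot\mathbf n\in L^2(\gamma),\ i=1,2\},\qquad \|\mathbf u\|_{\mathbf W_\beta}=\|\mathbf u\|_{\mathbf V_\beta}+\|\mathrm{Div}\,\mathbf u\|_{\mathcal M_\beta'}+\sum_{i=1}^2\|\mathbf u_i\cdot\mathbf n\|_{0,2,\gamma}.$$ The subscript $\beta$ on the spaces is only a label. **Forms.** For $\mathbf u,\mathbf v\in\mathbf W_\beta$, $r\in\mathcal M_\beta$, $$a_\beta(\mathbf u,\mathbf v)=\sum_{i=1}^2\int_{\Omega_i}(\alpha_i+\beta_i|\mathbf u_i|)\mathbf u_i\cdot\mathbf v_i\,dx+\int_\gamma(\alpha_\gamma+\beta_\gamma|\mathbf u_\gamma|)\mathbf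 u_\gamma\cdot\mathbf v_\gamma\,ds+\sum_{i=1}^2\int_\gamma\kappa(\xi\mathbf u_i\cdot\mathbf n+\bar\xi\mathbf u_{i+1}\cdot\mathbf n)\,\mathbf v_i\cdot\mathbf n\,ds,$$ $$b_\beta(\mathbf u,r)=\sum_{i=1}^2\int_{\Omega_i}\mathrm{div}\,\mathbf u_i\,r_i\,dx+\int_\gamma(\mathrm{div}\,\mathbf u_\gamma-[\mathbf u_1\cdot\mathbf n-\mathbf u_2\cdot\mathbf n])\,r_\gamma\,ds.$$ The continuous linear forms $\mathbf g\in\mathbf W_\beta'$, $f\in\mathcal M_\beta'$ are $$\mathbf g(\mathbf v)=-\sum_{i=1}^2\langle p_{d,i},\mathbf v_i\cdot\mathbf n_i\rangle_{H^{1/2}(\Gamma_i),H^{-1/2}(\Gamma_i)}-\langle p_{d,\gamma},\mathbf v_\gamma\cdot\mathbf n_\gamma\rangle_{H^{1/2}(\partial\gamma),H^{-1/2}(\partial\gamma)},\qquad f(r)=\sum_{i=1}^2\int_{\Omega_i}q_ir_i\,dx+\int_\gamma q_\gamma r_\gamma\,ds,$$ where the pairings coincide with the boundary integrals of the products when $\mathbf v$ is smooth up to the boundary on $\Omega_1$, $\Omega_2$ and $\gamma$. *)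

theory Defs
  imports "HOL-Analysis.Analysis"
begin

text \<open>
  Elements of the function spaces are represented by functions; two functions represent the same
  element iff they agree almost everywhere.
\<close>

section \<open>Lebesgue spaces, smooth functions, weak derivatives\<close>

definition Lp :: "real \<Rightarrow> 'a measure \<Rightarrow> ('a \<Rightarrow> 'b::euclidean_space) set" where
  "Lp p M = {f. f \<in> borel_measurable M \<and> integrable M (\<lambda>x. norm (f x) powr p)}"

definition Lp_tendsto ::
    "real \<Rightarrow> 'a measure \<Rightarrow> (nat \<Rightarrow> 'a \<Rightarrow> 'b::euclidean_space) \<Rightarrow> ('a \<Rightarrow> 'b) \<Rightarrow> bool" where
  "Lp_tendsto p M F f \<longleftrightarrow>
     (\<lambda>k. \<integral>\<^sup>+x. ennreal (norm (F k x - f x) powr p) \<partial>M) \<longlonglongrightarrow> 0"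

primrec Ck :: "nat \<Rightarrow> ('a::euclidean_space \<Rightarrow> real) \<Rightarrow> bool" where
  "Ck 0 f \<longleftrightarrow> continuous_on UNIV f"
| "Ck (Suc k) f \<longleftrightarrow> (\<forall>x. f differentiable (at x)) \<and>
     (\<forall>e\<in>Basis. Ck k (\<lambda>x. frechet_derivative f (at x) e))"

definition smooth :: "('a::euclidean_space \<Rightarrow> real) \<Rightarrow> bool" where
  "smooth f \<longleftrightarrow> (\<forall>k. Ck k f)"

definition grad :: "('a::euclidean_space \<Rightarrow> real) \<Rightarrow> 'a \<Rightarrow> 'a" where
  "grad f x = (\<Sum>e\<in>Basis. frechet_derivative f (at x) e *\<^sub>R e)"

definition test_functions :: "'a::euclidean_space set \<Rightarrow> ('a \<Rightarrow> real) set" where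
  "test_functions D =
     {\<phi>. smooth \<phi> \<and> compact (closure {x. \<phi> x \<noteq> 0}) \<and> closure {x. \<phi> x \<noteq> 0} \<subseteq> D}"

definition locally_integrable ::
    "'a::euclidean_space set \<Rightarrow> ('a \<Rightarrow> 'b::euclidean_space) \<Rightarrow> bool" where
  "locally_integrable D f \<longleftrightarrow> (\<forall>K. compact K \<and> K \<subseteq> D \<longrightarrow> integrable (lebesgue_on K) f)"

definition has_weak_grad ::
    "'a::euclidean_space set \<Rightarrow> ('a \<Rightarrow> real) \<Rightarrow> ('a \<Rightarrow> 'a) \<Rightarrow> bool" where
  "has_weak_grad D P g \<longleftrightarrow> locally_integrable D P \<and> locally_integrable D g \<and>
     (\<forall>\<phi>\<in>test_functions D.
        (\<integral>x. P x *\<^sub>R grad \<phi> x \<partial>lebesgue_on D) = - (\<integral>x. \<phi> x *\<^sub>R g x \<partial>lebesgue_on D))"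

definition weak_grad :: "'a::euclidean_space set \<Rightarrow> ('a \<Rightarrow> real) \<Rightarrow> 'a \<Rightarrow> 'a" where
  "weak_grad D P = (SOME g. has_weak_grad D P g)"

definition has_weak_div ::
    "'a::euclidean_space set \<Rightarrow> ('a \<Rightarrow> 'a) \<Rightarrow> ('a \<Rightarrow> real) \<Rightarrow> bool" where
  "has_weak_div D u g \<longleftrightarrow> locally_integrable D u \<and> locally_integrable D g \<and>
     (\<forall>\<phi>\<in>test_functions D.
        (\<integral>x. u x \<bullet> grad \<phi> x \<partial>lebesgue_on D) = - (\<integral>x. g x * \<phi> x \<partial>lebesgue_on D))"

definition weak_div :: "'a::euclidean_space set \<Rightarrow> ('a \<Rightarrow> 'a) \<Rightarrow> 'a \<Rightarrow> real" where
  "weak_div D u = (SOME g. has_weak_div D u g)"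

definition W1 :: "real \<Rightarrow> 'a::euclidean_space set \<Rightarrow> ('a \<Rightarrow> real) set" where
  "W1 p D = {P. P \<in> Lp p (lebesgue_on D) \<and> (\<exists>g. has_weak_grad D P g) \<and>
                weak_grad D P \<in> Lp p (lebesgue_on D)}"


section \<open>Lipschitz domains, surface measure, traces\<close>

text \<open>The value \<open>\<psi> (y - (y \<bullet> e) *\<^sub>R e)\<close> only depends on the coordinates of \<open>y\<close> orthogonal to the
  local vertical direction \<open>e\<close>.\<close>

definition lipschitz_domain :: "'a::euclidean_space set \<Rightarrow> bool" where
  "lipschitz_domain D \<longleftrightarrow> open D \<and> connected D \<and> bounded D \<and> D \<noteq> {} \<and>
     (\<forall>x\<in>frontier D. \<exists>e r L \<psi>. norm e = 1 \<and> r > 0 \<and> L-lipschitz_on UNIV \<psi> \<and>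
        D \<inter> ball x r = {y \<in> ball x r. y \<bullet> e < \<psi> (y - (y \<bullet> e) *\<^sub>R e)})"

text \<open>The \<open>k\<close>-dimensional Hausdorff measure, normalised to agree with \<open>k\<close>-dimensional area;
  for \<open>k = 0\<close> it is the counting measure (note \<open>0 ^ 0 = 1\<close>, hence the separate case of the empty set).\<close>

definition hausdorff_outer :: "nat \<Rightarrow> 'a::euclidean_space set \<Rightarrow> ennreal" where
  "hausdorff_outer k A =
     (SUP \<delta>\<in>{0::real<..}.
        INF C\<in>{C :: nat \<Rightarrow> 'a set. A \<subseteq> (\<Union>j. C j) \<and> (\<forall>j. bounded (C j) \<and> diameter (C j) \<le> \<delta>)}.
          \<Sum>j. if C j = {} then 0
              else ennreal (unit_ball_vol (real k) * (diameter (C j) / 2) ^ k))"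

definition hausdorff :: "nat \<Rightarrow> 'a::euclidean_space measure" where
  "hausdorff k = measure_of UNIV (sets borel) (hausdorff_outer k)"

definition surface_on :: "'a::euclidean_space set \<Rightarrow> 'a measure" where
  "surface_on S = restrict_space (hausdorff (DIM('a) - 1)) S"

definition has_trace ::
    "real \<Rightarrow> 'a::euclidean_space set \<Rightarrow> ('a \<Rightarrow> real) \<Rightarrow> ('a \<Rightarrow> real) \<Rightarrow> bool" where
  "has_trace p D P t \<longleftrightarrow> t \<in> Lp p (surface_on (frontier D)) \<and>
     (\<exists>\<Phi>. (\<forall>k. smooth (\<Phi> k)) \<and>
          Lp_tendsto p (lebesgue_on D) \<Phi> P \<and>
          Lp_tendsto p (lebesgue_on D) (\<lambda>k. grad (\<Phi> k)) (weak_grad D P) \<and>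
          Lp_tendsto p (surface_on (frontier D)) \<Phi> t)"

definition is_lifting :: "real \<Rightarrow> 'a::euclidean_space set \<Rightarrow> 'a set \<Rightarrow> ('a \<Rightarrow> real) \<Rightarrow>
    ('a \<Rightarrow> real) \<times> ('a \<Rightarrow> real) \<Rightarrow> bool" where
  "is_lifting p D S \<pi> = (\<lambda>(P, t). P \<in> W1 p D \<and> has_trace p D P t \<and> (AE x in surface_on S. \<pi> x = t x))"

text \<open>The fractional order space \<open>W\<^sup>s\<^sup>,\<^sup>p(S)\<close>, \<open>s = 1 - 1/p\<close>, on a part \<open>S\<close> of the boundary of \<open>D\<close>, as
  the space of traces: \<open>p = 2\<close> gives \<open>H\<^sup>1\<^sup>/\<^sup>2(S)\<close>, and \<open>p = 3/2\<close> gives \<open>s = 1/3\<close>.\<close>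

definition trace_space :: "real \<Rightarrow> 'a::euclidean_space set \<Rightarrow> 'a set \<Rightarrow> ('a \<Rightarrow> real) set" where
  "trace_space p D S = {\<pi>. \<exists>Pt. is_lifting p D S \<pi> Pt}"

definition lifting :: "'a::euclidean_space set \<Rightarrow> 'a set \<Rightarrow> ('a \<Rightarrow> real) \<Rightarrow>
    ('a \<Rightarrow> real) \<times> ('a \<Rightarrow> real)" where
  "lifting D S \<pi> = (SOME Pt. is_lifting 2 D S \<pi> Pt)"


section \<open>The fractured domain\<close>

text \<open>
  \<open>bulk\<close> is \<open>\<Omega>\<close>, \<open>part i\<close> is \<open>\<Omega>\<^sub>i\<close>. The index type \<open>2\<close> is arithmetic modulo 2, so that
  \<open>part 1\<close>, \<open>part 2\<close> are the two subdomains and \<open>i + 1\<close> is the index of the other one.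
  The fracture \<open>\<gamma>\<close> is \<open>chart ` cut\<close> for an isometric parametrisation \<open>chart\<close> of its hyperplane and
  \<open>cut \<subseteq> \<real>\<^sup>d\<^sup>-\<^sup>1\<close>. Functions on \<open>\<gamma>\<close> are functions on \<open>cut\<close>, and tangential
  operators and integrals over \<open>\<gamma>\<close> are those of \<open>\<real>\<^sup>d\<^sup>-\<^sup>1\<close>.
\<close>

record ('n::finite, 'm::finite) geometry =
  bulk :: "(real^'n) set"
  part :: "2 \<Rightarrow> (real^'n) set"
  chart :: "real^'m \<Rightarrow> real^'n"
  cut :: "(real^'m) set"

definition fracture :: "('n::finite, 'm::finite) geometry \<Rightarrow> (real^'n) set" where
  "fracture G = chart G ` cut G"

definition outer_boundary :: "('n::finite, 'm::finite) geometry \<Rightarrow> 2 \<Rightarrow> (real^'n) set" where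
  "outer_boundary G i = frontier (bulk G) \<inter> frontier (part G i)"

definition hyperplane_chart :: "(real^'m::finite \<Rightarrow> real^'n::finite) \<Rightarrow> bool" where
  "hyperplane_chart h \<longleftrightarrow> CARD('n) = CARD('m) + 1 \<and>
     (\<exists>x0 T. linear T \<and> (\<forall>y. norm (T y) = norm y) \<and> h = (\<lambda>y. x0 + T y))"

definition fractured_domain :: "('n::finite, 'm::finite) geometry \<Rightarrow> bool" where
  "fractured_domain G \<longleftrightarrow>
     open (bulk G) \<and> connected (bulk G) \<and> bounded (bulk G) \<and>
     hyperplane_chart (chart G) \<and>
     lipschitz_domain (part G 1) \<and> lipschitz_domain (part G 2) \<and> lipschitz_domain (cut G) \<and>
     bulk G = part G 1 \<union> fracture G \<union> part G 2 \<and>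
     part G 1 \<inter> part G 2 = {} \<and> part G 1 \<inter> fracture G = {} \<and> part G 2 \<inter> fracture G = {} \<and>
     fracture G = closure (part G 1) \<inter> closure (part G 2) \<inter> bulk G"

abbreviation bulk_measure :: "('n::finite, 'm::finite) geometry \<Rightarrow> 2 \<Rightarrow> (real^'n) measure" where
  "bulk_measure G i \<equiv> lebesgue_on (part G i)"

abbreviation cut_measure :: "('n::finite, 'm::finite) geometry \<Rightarrow> (real^'m) measure" where
  "cut_measure G \<equiv> lebesgue_on (cut G)"

text \<open>\<open>w\<close> is the normal trace \<open>u \<bullet> n\<^sub>i\<close> on \<open>\<gamma>\<close> of a field \<open>u\<close> on \<open>\<Omega>\<^sub>i\<close>, where \<open>n\<^sub>i\<close> is the normal exterior
  to \<open>\<Omega>\<^sub>i\<close>: Green's formula against test functions vanishing near \<open>\<Gamma>\<close>.\<close>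

definition has_normal_trace ::
    "('n::finite, 'm::finite) geometry \<Rightarrow> 2 \<Rightarrow> (real^'n \<Rightarrow> real^'n) \<Rightarrow> (real^'m \<Rightarrow> real) \<Rightarrow> bool" where
  "has_normal_trace G i u w \<longleftrightarrow> locally_integrable (cut G) w \<and>
     (\<forall>\<phi>\<in>test_functions (bulk G).
        (\<integral>x. u x \<bullet> grad \<phi> x + weak_div (part G i) u x * \<phi> x \<partial>bulk_measure G i) =
        (\<integral>y. w y * \<phi> (chart G y) \<partial>cut_measure G))"

definition normal_trace ::
    "('n::finite, 'm::finite) geometry \<Rightarrow> 2 \<Rightarrow> (real^'n \<Rightarrow> real^'n) \<Rightarrow> real^'m \<Rightarrow> real" where
  "normal_trace G i u = (SOME w. has_normal_trace G i u w)"


section \<open>The spaces\<close>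

type_synonym ('n, 'm) velocity = "(2 \<Rightarrow> real^'n \<Rightarrow> real^'n) \<times> (real^'m \<Rightarrow> real^'m)"
type_synonym ('n, 'm) pressure = "(2 \<Rightarrow> real^'n \<Rightarrow> real) \<times> (real^'m \<Rightarrow> real)"

text \<open>\<open>u\<^sub>i \<bullet> n\<close> on \<open>\<gamma>\<close>, where \<open>n = n\<^sub>1 = - n\<^sub>2\<close> points out of \<open>\<Omega>\<^sub>1\<close>.\<close>

definition normal_flux ::
    "('n::finite, 'm::finite) geometry \<Rightarrow> ('n, 'm) velocity \<Rightarrow> 2 \<Rightarrow> real^'m \<Rightarrow> real" where
  "normal_flux G u i y = (if i = 1 then 1 else - 1) * normal_trace G i (fst u i) y"

definition Div :: "('n::finite, 'm::finite) geometry \<Rightarrow> ('n, 'm) velocity \<Rightarrow> ('n, 'm) pressure" where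
  "Div G u = ((\<lambda>i. weak_div (part G i) (fst u i)),
              (\<lambda>y. weak_div (cut G) (snd u) y - (normal_flux G u 1 y - normal_flux G u 2 y)))"

definition V_space :: "('n::finite, 'm::finite) geometry \<Rightarrow> ('n, 'm) velocity set" where
  "V_space G = {u. (\<forall>i. fst u i \<in> Lp 3 (bulk_measure G i)) \<and> snd u \<in> Lp 3 (cut_measure G)}"

definition M_space :: "('n::finite, 'm::finite) geometry \<Rightarrow> ('n, 'm) pressure set" where
  "M_space G = {r. (\<forall>i. fst r i \<in> Lp (3/2) (bulk_measure G i)) \<and> snd r \<in> Lp (3/2) (cut_measure G)}"

definition M_dual :: "('n::finite, 'm::finite) geometry \<Rightarrow> ('n, 'm) pressure set" where
  "M_dual G = {r. (\<forall>i. fst r i \<in> Lp 3 (bulk_measure G i)) \<and> snd r \<in> Lp 3 (cut_measure G)}"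

definition W_space :: "('n::finite, 'm::finite) geometry \<Rightarrow> ('n, 'm) velocity set" where
  "W_space G = {u. u \<in> V_space G \<and>
     (\<forall>i. \<exists>g. has_weak_div (part G i) (fst u i) g) \<and>
     (\<forall>i. \<exists>w. has_normal_trace G i (fst u i) w) \<and>
     (\<exists>g. has_weak_div (cut G) (snd u) g) \<and>
     Div G u \<in> M_dual G \<and>
     (\<forall>i. normal_flux G u i \<in> Lp 2 (cut_measure G))}"


section \<open>Coefficients and forms\<close>

record ('n::finite, 'm::finite) coefficients =
  alpha :: "2 \<Rightarrow> real^'n \<Rightarrow> real^'n^'n"
  alpha_cut :: "real^'m \<Rightarrow> real^'m^'m"
  beta :: "2 \<Rightarrow> real^'n \<Rightarrow> real"
  beta_cut :: "real^'m \<Rightarrow> real"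
  kappa :: "real^'m \<Rightarrow> real"
  xi :: real

definition elliptic_on :: "(real^'k::finite) set \<Rightarrow> (real^'k \<Rightarrow> real^'k^'k) \<Rightarrow> bool" where
  "elliptic_on D A \<longleftrightarrow> A \<in> borel_measurable (lebesgue_on D) \<and>
     (\<forall>y\<in>D. transpose (A y) = A y) \<and>
     (\<exists>lo hi. 0 < lo \<and> 0 < hi \<and>
        (\<forall>y\<in>D. \<forall>x. lo * (norm x)\<^sup>2 \<le> x \<bullet> (A y *v x) \<and> x \<bullet> (A y *v x) \<le> hi * (norm x)\<^sup>2))"

definition positive_bounded_on :: "'a::euclidean_space set \<Rightarrow> ('a \<Rightarrow> real) \<Rightarrow> bool" where
  "positive_bounded_on D c \<longleftrightarrow> c \<in> borel_measurable (lebesgue_on D) \<and>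
     (\<exists>lo hi. 0 < lo \<and> 0 < hi \<and> (\<forall>y\<in>D. lo \<le> c y \<and> c y \<le> hi))"

definition admissible_coefficients ::
    "('n::finite, 'm::finite) geometry \<Rightarrow> ('n, 'm) coefficients \<Rightarrow> bool" where
  "admissible_coefficients G C \<longleftrightarrow>
     (\<forall>i. elliptic_on (part G i) (alpha C i)) \<and> elliptic_on (cut G) (alpha_cut C) \<and>
     (\<forall>i. positive_bounded_on (part G i) (beta C i)) \<and> positive_bounded_on (cut G) (beta_cut C) \<and>
     positive_bounded_on (cut G) (kappa C) \<and> xi C > 1/2"

definition a_form :: "('n::finite, 'm::finite) geometry \<Rightarrow> ('n, 'm) coefficients \<Rightarrow>
    ('n, 'm) velocity \<Rightarrow> ('n, 'm) velocity \<Rightarrow> real" where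
  "a_form G C u v =
     (\<Sum>i\<in>UNIV. \<integral>x. (alpha C i x *v fst u i x + (beta C i x * norm (fst u i x)) *\<^sub>R fst u i x)
                      \<bullet> fst v i x \<partial>bulk_measure G i)
     + (\<integral>y. (alpha_cut C y *v snd u y + (beta_cut C y * norm (snd u y)) *\<^sub>R snd u y)
             \<bullet> snd v y \<partial>cut_measure G)
     + (\<Sum>i\<in>UNIV. \<integral>y. kappa C y * (xi C * normal_flux G u i y + (1 - xi C) * normal_flux G u (i + 1) y)
                      * normal_flux G v i y \<partial>cut_measure G)"

text \<open>The duality of \<open>\<M>'\<close> and \<open>\<M>\<close>.\<close>

definition pairing :: "('n::finite, 'm::finite) geometry \<Rightarrow> ('n, 'm) pressure \<Rightarrow> ('n, 'm) pressure \<Rightarrow> real" where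
  "pairing G s r = (\<Sum>i\<in>UNIV. \<integral>x. fst s i x * fst r i x \<partial>bulk_measure G i)
                   + (\<integral>y. snd s y * snd r y \<partial>cut_measure G)"

definition b_form :: "('n::finite, 'm::finite) geometry \<Rightarrow> ('n, 'm) velocity \<Rightarrow> ('n, 'm) pressure \<Rightarrow> real" where
  "b_form G u r = pairing G (Div G u) r"

text \<open>
  The pairings of a boundary datum \<open>\<pi>\<close> of class \<open>H\<^sup>1\<^sup>/\<^sup>2\<close> with the normal trace of \<open>v\<close> are given by
  Green's formula for an \<open>H\<^sup>1\<close> lifting of \<open>\<pi>\<close>. On \<open>\<Gamma>\<^sub>i\<close> the contribution of the rest \<open>\<gamma>\<close>
  of the boundary of \<open>\<Omega>\<^sub>i\<close>, where \<open>v\<^sub>i \<bullet> n\<^sub>i\<close> is square integrable, is subtracted. The value does not depend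
  on the lifting, and it is the boundary integral of \<open>\<pi> (v \<bullet> n\<^sub>i)\<close> if \<open>v\<close> is smooth up to the boundary.
\<close>

definition boundary_pairing :: "('n::finite, 'm::finite) geometry \<Rightarrow> 2 \<Rightarrow>
    (real^'n \<Rightarrow> real) \<Rightarrow> (real^'n \<Rightarrow> real^'n) \<Rightarrow> real" where
  "boundary_pairing G i \<pi> v =
     (let (P, t) = lifting (part G i) (outer_boundary G i) \<pi> in
      (\<integral>x. v x \<bullet> weak_grad (part G i) P x + weak_div (part G i) v x * P x \<partial>bulk_measure G i)
      - (\<integral>y. normal_trace G i v y * t (chart G y) \<partial>cut_measure G))"

definition cut_boundary_pairing :: "('n::finite, 'm::finite) geometry \<Rightarrow>
    (real^'m \<Rightarrow> real) \<Rightarrow> (real^'m \<Rightarrow> real^'m) \<Rightarrow> real" where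
  "cut_boundary_pairing G \<pi> v =
     (let (P, t) = lifting (cut G) (frontier (cut G)) \<pi> in
      \<integral>y. v y \<bullet> weak_grad (cut G) P y + weak_div (cut G) v y * P y \<partial>cut_measure G)"

definition g_form :: "('n::finite, 'm::finite) geometry \<Rightarrow> ('n, 'm) pressure \<Rightarrow> ('n, 'm) velocity \<Rightarrow> real" where
  "g_form G pd v = - (\<Sum>i\<in>UNIV. boundary_pairing G i (fst pd i) (fst v i))
                   - cut_boundary_pairing G (snd pd) (snd v)"

definition f_form :: "('n::finite, 'm::finite) geometry \<Rightarrow> ('n, 'm) pressure \<Rightarrow> ('n, 'm) pressure \<Rightarrow> real" where
  "f_form G q r = pairing G q r"

definition admissible_boundary_data ::
    "('n::finite, 'm::finite) geometry \<Rightarrow> ('n, 'm) pressure \<Rightarrow> bool" where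
  "admissible_boundary_data G pd \<longleftrightarrow>
     (\<forall>i. fst pd i \<in> trace_space (3/2) (part G i) (outer_boundary G i)
                   \<inter> trace_space 2 (part G i) (outer_boundary G i)) \<and>
     snd pd \<in> trace_space 2 (cut G) (frontier (cut G))"

definition solves :: "('n::finite, 'm::finite) geometry \<Rightarrow> ('n, 'm) coefficients \<Rightarrow>
    ('n, 'm) pressure \<Rightarrow> ('n, 'm) pressure \<Rightarrow> ('n, 'm) velocity \<Rightarrow> ('n, 'm) pressure \<Rightarrow> bool" where
  "solves G C q pd u p \<longleftrightarrow> u \<in> W_space G \<and> p \<in> M_space G \<and>
     (\<forall>v\<in>W_space G. a_form G C u v - b_form G v p = g_form G pd v) \<and>
     (\<forall>r\<in>M_space G. b_form G u r = f_form G q r)"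

definition same_element :: "('n::finite, 'm::finite) geometry \<Rightarrow>
    (2 \<Rightarrow> real^'n \<Rightarrow> 'b) \<times> (real^'m \<Rightarrow> 'c) \<Rightarrow> (2 \<Rightarrow> real^'n \<Rightarrow> 'b) \<times> (real^'m \<Rightarrow> 'c) \<Rightarrow> bool" where
  "same_element G u v \<longleftrightarrow> (\<forall>i. AE x in bulk_measure G i. fst u i x = fst v i x) \<and>
                          (AE y in cut_measure G. snd u y = snd v y)"

end

theory Submission
  imports Defs "HOL-Library.Function_Algebras"
begin

text \<open>
  The form \<open>a\<close> is the derivative of a uniformly convex energy: the coupling on the fracture is symmetric, with
  eigenvalues \<open>1\<close> and \<open>2 \<xi> - 1 > 0\<close>. Hence the velocity is the minimiser of energy minus boundary work among the
  fields with divergence \<open>q\<close>. The divergence has a bounded right inverse which consists of antiderivatives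
  along a direction tangential to the fracture; such fields have no flux through the fracture.
  The Euler-Lagrange functional of the minimiser vanishes on divergence free fields, so it factors through the divergence
  as a bounded functional on \<open>L\<^sup>3\<close>, and the pressure is its Riesz representation in \<open>L\<^sup>3\<^sup>/\<^sup>2\<close>. That
  representation is again the critical point of a uniformly convex functional. Uniqueness follows from strong monotonicity and from
  the surjectivity of the divergence.
\<close>

section \<open>Uniformly convex minimisation\<close>

text \<open>The size of a field adds cubes of \<open>L^3\<close> norms of velocities to squares of
  \<open>L^2\<close> norms of fluxes, so it is not a power of one norm. Boundedness of a linear
  functional is therefore always stated additively,
  \<open>\<bar>l z\<bar> \<le> B * N z + C\<close>; Young's inequality delivers this form, and
  rescaling \<open>z\<close> recovers continuity. Weak compactness is replaced by strong
  convergence: uniform convexity makes minimising sequences Cauchy, and the spaces are complete. Two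
  obstacles come from the formulation. Divergences and normal traces are chosen representatives, so
  they must first be shown unique almost everywhere, also on \<gamma>, where only restrictions of
  test functions of \<Omega> are available. And \<open>g_form\<close> contains an integral over
  \<gamma> of the trace of a lifting. That trace is square integrable for the Hausdorff measure on
  the boundary of a subdomain, while fluxes live on \<gamma> as a flat domain of dimension d - 1;
  comparing the two requires that the Hausdorff measure is a measure on Borel sets.\<close>

instantiation "fun" :: (type, real_vector) real_vector
begin

text \<open>Fields, divergences and fluxes are tuples of functions. With pointwise operations these
  tuples form a \<open>real_vector\<close> type, so that the abstract minimisation applies to
  representatives directly, without quotients.\<close>

definition scaleR_fun :: "real \<Rightarrow> ('a \<Rightarrow> 'b) \<Rightarrow> 'a \<Rightarrow> 'b" where
  "scaleR_fun c f = (\<lambda>x. c *\<^sub>R f x)"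

instance
  by standard (auto simp: scaleR_fun_def fun_eq_iff scaleR_add_right scaleR_add_left)

end

lemma scaleR_fun_apply [simp]: "(c *\<^sub>R f) x = c *\<^sub>R f x"
  by (simp add: scaleR_fun_def)

text \<open>
  \<open>N\<close> plays the role of the power of a norm that a uniformly convex functional controls. Linear
  functionals \<open>l\<close> with \<open>\<bar>l z\<bar> \<le> N z + C\<close> are the bounded ones, since \<open>N\<close> grows superlinearly.
\<close>

lemma bounded_functional_tendsto_0:
  fixes l :: "'a::real_vector \<Rightarrow> real" and X :: "nat \<Rightarrow> 'a"
  assumes bound: "\<And>z. z \<in> Z \<Longrightarrow> \<bar>l z\<bar> \<le> N z + C"
    and hom: "\<And>z c. z \<in> Z \<Longrightarrow> l (c *\<^sub>R z) = c * l z"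
    and sub: "\<And>z c. z \<in> Z \<Longrightarrow> c *\<^sub>R z \<in> Z"
    and scale: "\<And>z c. z \<in> Z \<Longrightarrow> 1 \<le> c \<Longrightarrow> N (c *\<^sub>R z) \<le> c ^ 3 * N z"
    and X: "\<And>k. X k \<in> Z" and lim: "(\<lambda>k. N (X k)) \<longlonglongrightarrow> 0"
  shows "(\<lambda>k. l (X k)) \<longlonglongrightarrow> 0"
proof (rule LIMSEQ_I)
  fix e :: real assume e: "e > 0"
  \<comment> \<open>The bound is evaluated at \<open>c *\<^sub>R X k\<close>: the left side gains
    the factor \<open>c\<close>, which beats the constant \<open>C\<close>, while the growth
    \<open>c ^ 3\<close> of \<open>N\<close> is absorbed by
    \<open>N (X k) < 1 / c ^ 3\<close>.\<close>
  define c where "c = max 1 (2 * (\<bar>C\<bar> + 1) / e)"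
  have c: "c \<ge> 1" "c * e \<ge> 2 * (\<bar>C\<bar> + 1)"
    using e by (auto simp: c_def max_def field_simps)
  have "1 / c ^ 3 > 0" using c by simp
  from LIMSEQ_D[OF lim this] obtain n where n: "\<And>k. k \<ge> n \<Longrightarrow> \<bar>N (X k)\<bar> < 1 / c ^ 3" by auto
  have "\<bar>l (X k)\<bar> < e" if "k \<ge> n" for k
  proof -
    have "c * \<bar>l (X k)\<bar> = \<bar>l (c *\<^sub>R X k)\<bar>" using hom[OF X] c by (simp add: abs_mult)
    also have "\<dots> \<le> c ^ 3 * N (X k) + C"
      using bound[OF sub[OF X]] scale[OF X c(1)] by (smt (verit))
    also have "\<dots> < 1 + C"
      using n[OF that] c by (simp add: field_simps abs_less_iff)
    also have "\<dots> < c * e" using c(2) by (smt (verit))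
    finally show ?thesis using c by simp
  qed
  then show "\<exists>n. \<forall>k\<ge>n. norm (l (X k) - 0) < e" by auto
qed

text \<open>Evaluating the bound at a small multiple \<open>c *\<^sub>R z\<close> gives the factor
  \<open>c\<close> on the left and \<open>c\<^sup>2\<close> on the right. After division by
  \<open>c\<close> the factor in front of \<open>N\<close> is
  \<open>\<bar>B\<bar> * c \<le> 1\<close>, at the price of a larger constant.\<close>

lemma bounded_functional_rescale:
  fixes l :: "'a::real_vector \<Rightarrow> real"
  assumes bound: "\<And>z. z \<in> Z \<Longrightarrow> \<bar>l z\<bar> \<le> B * N z + C"
    and hom: "\<And>z c. z \<in> Z \<Longrightarrow> l (c *\<^sub>R z) = c * l z"
    and sub: "\<And>z c. z \<in> Z \<Longrightarrow> c *\<^sub>R z \<in> Z"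
    and scale: "\<And>z c. z \<in> Z \<Longrightarrow> 0 \<le> c \<Longrightarrow> c \<le> 1 \<Longrightarrow> N (c *\<^sub>R z) \<le> c\<^sup>2 * N z"
    and nonneg: "\<And>z. z \<in> Z \<Longrightarrow> 0 \<le> N z"
  shows "\<exists>C'. \<forall>z\<in>Z. \<bar>l z\<bar> \<le> N z + C'"
proof -
  define c where "c = 1 / (\<bar>B\<bar> + 1)"
  have c: "0 < c" "c \<le> 1" "\<bar>B\<bar> * c \<le> 1" by (auto simp: c_def field_simps)
  have "\<bar>l z\<bar> \<le> N z + C / c" if z: "z \<in> Z" for z
  proof -
    have "c * \<bar>l z\<bar> = \<bar>l (c *\<^sub>R z)\<bar>" using hom[OF z] c by (simp add: abs_mult)
    also have "\<dots> \<le> B * N (c *\<^sub>R z) + C" by (rule bound[OF sub[OF z]])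
    also have "B * N (c *\<^sub>R z) \<le> \<bar>B\<bar> * N (c *\<^sub>R z)"
      using nonneg[OF sub[OF z]] by (intro mult_right_mono) auto
    also have "\<dots> \<le> \<bar>B\<bar> * (c\<^sup>2 * N z)"
      using scale[OF z, of c] c by (intro mult_left_mono) auto
    also have "\<dots> = (\<bar>B\<bar> * c) * (c * N z)" by (simp add: power2_eq_square)
    also have "\<dots> \<le> 1 * (c * N z)" using c nonneg[OF z] by (intro mult_right_mono) auto
    finally show ?thesis using c(1) by (simp add: field_simps)
  qed
  then show ?thesis by blast
qed

lemma inf_minimizing_sequence:
  fixes E :: "'a \<Rightarrow> real"
  assumes "K \<noteq> {}" and "\<And>u. u \<in> K \<Longrightarrow> b \<le> E u"
  obtains m X where "\<And>u. u \<in> K \<Longrightarrow> m \<le> E u" "\<And>k. X k \<in> K" "(\<lambda>k::nat. E (X k)) \<longlonglongrightarrow> m"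
proof -
  define m where "m = Inf (E ` K)"
  have bdd: "bdd_below (E ` K)" using assms(2) by (auto intro!: bdd_belowI)
  have m: "m \<le> E u" if "u \<in> K" for u
    using bdd that by (simp add: m_def cINF_lower)
  have "\<exists>u\<in>K. E u < m + 1 / Suc k" for k
    using cInf_lessD[of "E ` K" "m + 1 / Suc k"] assms(1) by (auto simp: m_def)
  then obtain X where X: "\<And>k. X k \<in> K" "\<And>k. E (X k) < m + 1 / Suc k" by metis
  have "(\<lambda>k. E (X k)) \<longlonglongrightarrow> m"
  proof (rule tendsto_sandwich[OF _ _ tendsto_const])
    show "\<forall>\<^sub>F k in sequentially. m \<le> E (X k)" using m X by auto
    show "\<forall>\<^sub>F k in sequentially. E (X k) \<le> m + 1 / Suc k" using X(2) by (auto simp: less_imp_le)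
    show "(\<lambda>k. m + 1 / real (Suc k)) \<longlonglongrightarrow> m"
      using tendsto_add[OF tendsto_const[of m] LIMSEQ_Suc[OF lim_1_over_n]] by simp
  qed
  with m X(1) show ?thesis using that by blast
qed

text \<open>\<open>K\<close> is an affine set with direction space \<open>Z\<close>, and
  \<open>A u\<close> is the directional derivative of \<open>E\<close> at \<open>u\<close>. The
  hypothesis \<open>lower\<close> is uniform convexity with modulus \<open>N\<close>, and
  \<open>upper\<close> bounds the second-order remainder along a line. Completeness is expressed
  through \<open>N\<close> itself, which need not be a norm or a power of one.\<close>

proposition uniformly_convex_critical_point:
  fixes K Z :: "'a::real_vector set" and E N :: "'a \<Rightarrow> real" and A :: "'a \<Rightarrow> 'a \<Rightarrow> real"
  assumes "K \<noteq> {}"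
    and KZ: "\<And>u z. u \<in> K \<Longrightarrow> z \<in> Z \<Longrightarrow> u + z \<in> K"
    and KK: "\<And>u v. u \<in> K \<Longrightarrow> v \<in> K \<Longrightarrow> u - v \<in> Z"
    and Zs: "\<And>z c. z \<in> Z \<Longrightarrow> c *\<^sub>R z \<in> Z"
    and hom: "\<And>u z c. u \<in> K \<Longrightarrow> z \<in> Z \<Longrightarrow> A u (c *\<^sub>R z) = c * A u z"
    and lower: "\<And>u z. u \<in> K \<Longrightarrow> z \<in> Z \<Longrightarrow> E u + A u z + N z \<le> E (u + z)"
    and upper: "\<And>u z. u \<in> K \<Longrightarrow> z \<in> Z \<Longrightarrow> \<exists>C. \<forall>t. \<bar>t\<bar> \<le> 1 \<longrightarrow> E (u + t *\<^sub>R z) \<le> E u + t * A u z + C * t\<^sup>2"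
    and bound: "\<And>u. u \<in> K \<Longrightarrow> \<exists>B C. \<forall>z\<in>Z. \<bar>A u z\<bar> \<le> B * N z + C"
    and scale_le: "\<And>z c. z \<in> Z \<Longrightarrow> 0 \<le> c \<Longrightarrow> c \<le> 1 \<Longrightarrow> N (c *\<^sub>R z) \<le> c\<^sup>2 * N z"
    and scale: "\<And>z c. z \<in> Z \<Longrightarrow> 1 \<le> c \<Longrightarrow> N (c *\<^sub>R z) \<le> c ^ 3 * N z"
    and nonneg: "\<And>z. z \<in> Z \<Longrightarrow> 0 \<le> N z"
    and complete: "\<And>X. (\<And>k. X k \<in> K) \<Longrightarrow>
           (\<And>e. e > 0 \<Longrightarrow> \<exists>n. \<forall>k\<ge>n. \<forall>l\<ge>n. N (X k - X l) < e) \<Longrightarrow>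
           \<exists>u\<in>K. (\<lambda>k::nat. N (X k - u)) \<longlonglongrightarrow> 0"
  obtains u where "u \<in> K" "\<And>z. z \<in> Z \<Longrightarrow> A u z = 0"
proof -
  have bound: "\<exists>C. \<forall>z\<in>Z. \<bar>A u z\<bar> \<le> N z + C" if u: "u \<in> K" for u
  proof -
    from bound[OF u] obtain B C where "\<And>z. z \<in> Z \<Longrightarrow> \<bar>A u z\<bar> \<le> B * N z + C" by blast
    from bounded_functional_rescale[of Z "A u" B N C, OF this hom[OF u] Zs scale_le nonneg] show ?thesis by blast
  qed
  obtain u0 where u0: "u0 \<in> K" using \<open>K \<noteq> {}\<close> by blast
  obtain C where C: "\<And>z. z \<in> Z \<Longrightarrow> \<bar>A u0 z\<bar> \<le> N z + C" using bound[OF u0] by blast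
  have low: "E u0 - C \<le> E v" if v: "v \<in> K" for v
    using lower[OF u0 KK[OF v u0]] C[OF KK[OF v u0]] by simp
  obtain m X where m: "\<And>u. u \<in> K \<Longrightarrow> m \<le> E u" and X: "\<And>k. X k \<in> K"
    and lim: "(\<lambda>k::nat. E (X k)) \<longlonglongrightarrow> m"
    using inf_minimizing_sequence[where K = K and E = E, OF \<open>K \<noteq> {}\<close> low] by blast
  \<comment> \<open>With \<open>z\<close> half the difference, \<open>lower\<close> is applied at
    the midpoint \<open>v + z\<close> in the directions \<open>z\<close> and \<open>- z\<close>; the
    two derivative terms cancel. The factor 8 is the cubic growth of \<open>N\<close> from
    \<open>z\<close> to \<open>u - v = 2 *\<^sub>R z\<close>.\<close>
  have mid: "N (u - v) \<le> 8 * (E u + E v - 2 * m)" if u: "u \<in> K" and v: "v \<in> K" for u v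
  proof -
    define z where "z = (1/2) *\<^sub>R (u - v)"
    have z: "z \<in> Z" "(-1) *\<^sub>R z \<in> Z" unfolding z_def using KK[OF u v] Zs by blast+
    have uz: "u = v + 2 *\<^sub>R z" and vz: "v + z \<in> K" using KZ[OF v z(1)] by (auto simp: z_def algebra_simps)
    have vv: "(v + z) + (-1) *\<^sub>R z = v" "(v + z) + z = u" using uz by (auto simp: scaleR_2)
    have "E (v + z) + A (v + z) z + N z \<le> E u" using lower[OF vz z(1)] vv by simp
    moreover have "E (v + z) - A (v + z) z + N ((-1) *\<^sub>R z) \<le> E v"
      using lower[OF vz z(2)] hom[OF vz z(1), of "-1"] vv(1) by simp
    ultimately have "2 * E (v + z) + N z \<le> E u + E v" using nonneg[OF z(2)] by linarith
    then have "N z \<le> E u + E v - 2 * m" using m[OF vz] by simp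
    moreover have "N (u - v) \<le> 8 * N z" using scale[OF z(1), of 2] uz by simp
    ultimately show ?thesis by simp
  qed
  have "\<exists>n. \<forall>k\<ge>n. \<forall>l\<ge>n. N (X k - X l) < e" if "e > 0" for e
  proof -
    from LIMSEQ_D[OF lim, of "e / 16"] that obtain n where n: "\<And>k. k \<ge> n \<Longrightarrow> \<bar>E (X k) - m\<bar> < e / 16" by auto
    have "N (X k - X l) < e" if "k \<ge> n" "l \<ge> n" for k l
      using mid[OF X[of k] X[of l]] n[OF that(1), unfolded abs_less_iff] n[OF that(2), unfolded abs_less_iff]
      by (simp add: field_simps)
    then show ?thesis by blast
  qed
  from complete[OF X this] obtain u where u: "u \<in> K" and Xu: "(\<lambda>k. N (X k - u)) \<longlonglongrightarrow> 0" by blast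
  obtain C' where C': "\<And>z. z \<in> Z \<Longrightarrow> \<bar>A u z\<bar> \<le> N z + C'" using bound[OF u] by blast
  \<comment> \<open>This replaces lower semicontinuity of \<open>E\<close>: the affine minorant of
    \<open>E\<close> at the limit \<open>u\<close> tends to \<open>E u\<close> along the sequence,
    and it stays below \<open>E (X k)\<close>, which tends to \<open>m\<close>.\<close>
  have "(\<lambda>k. A u (X k - u)) \<longlonglongrightarrow> 0"
    by (rule bounded_functional_tendsto_0[where Z = Z and l = "A u", OF C' hom[OF u] Zs scale KK[OF X u] Xu])
  then have "(\<lambda>k. E u + A u (X k - u)) \<longlonglongrightarrow> E u + 0" by (intro tendsto_intros)
  moreover have "E u + A u (X k - u) \<le> E (X k)" for k
    using lower[OF u KK[OF X[of k] u]] nonneg[OF KK[OF X[of k] u]] by simp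
  ultimately have "E u \<le> m" using lim by (auto intro: LIMSEQ_le)
  then have min: "E u \<le> E v" if "v \<in> K" for v using m[OF that] by simp
  have "A u z = 0" if z: "z \<in> Z" for z
  proof (rule ccontr)
    assume nz: "A u z \<noteq> 0"
    obtain C where C: "\<And>t. \<bar>t\<bar> \<le> 1 \<Longrightarrow> E (u + t *\<^sub>R z) \<le> E u + t * A u z + C * t\<^sup>2"
      using upper[OF u z] by blast
    \<comment> \<open>A step against the sign of the derivative, so short that the quadratic error
      is at most half of the linear gain; the \<open>+ 1\<close> keeps the denominator positive when
      \<open>C = 0\<close>.\<close>
    define t where "t = - sgn (A u z) * min 1 (\<bar>A u z\<bar> / (2 * (\<bar>C\<bar> + 1)))"
    define s where "s = \<bar>t\<bar>"
    have s: "0 < s" "s \<le> 1" "s \<le> \<bar>A u z\<bar> / (2 * (\<bar>C\<bar> + 1))" "t * A u z = - s * \<bar>A u z\<bar>" "t\<^sup>2 = s * s"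
      using nz by (auto simp: s_def t_def abs_mult abs_sgn_eq sgn_if power2_eq_square)
    have "0 \<le> t * A u z + C * t\<^sup>2" using C[of t] min[OF KZ[OF u Zs[OF z, of t]]] s(2) by (simp add: s_def)
    then have "s * \<bar>A u z\<bar> \<le> C * (s * s)" using s by simp
    then have "s * \<bar>A u z\<bar> \<le> s * (C * s)" by (simp add: ac_simps)
    then have "\<bar>A u z\<bar> \<le> C * s" using s(1) by simp
    also have "\<dots> \<le> \<bar>C\<bar> * s" using s(1) by (intro mult_right_mono) auto
    also have "\<dots> \<le> (\<bar>C\<bar> + 1) * (\<bar>A u z\<bar> / (2 * (\<bar>C\<bar> + 1)))" using s by (intro mult_mono) auto
    also have "\<dots> = \<bar>A u z\<bar> / 2" by (simp add: field_simps add_nonneg_eq_0_iff)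
    finally show False using nz by simp
  qed
  with u show ?thesis using that by blast
qed

section \<open>Lebesgue spaces\<close>

lemma LpD:
  assumes "f \<in> Lp p M"
  shows "f \<in> borel_measurable M" and "integrable M (\<lambda>x. norm (f x) powr p)"
  using assms by (auto simp: Lp_def)

lemma norm_add_powr_le:
  fixes a b :: "'a::real_normed_vector"
  assumes "0 < p"
  shows "norm (a + b) powr p \<le> 2 powr p * (norm a powr p + norm b powr p)"
proof -
  have "norm (a + b) powr p \<le> (2 * max (norm a) (norm b)) powr p"
    using assms norm_triangle_ineq[of a b] by (intro powr_mono2) (auto simp: max_def)
  also have "\<dots> = 2 powr p * max (norm a) (norm b) powr p"
    by (simp add: powr_mult)
  also have "\<dots> \<le> 2 powr p * (norm a powr p + norm b powr p)"
    by (intro mult_left_mono) (auto simp: max_def)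
  finally show ?thesis .
qed

lemma Lp_bound:
  assumes "g \<in> borel_measurable M" "integrable M h" "AE x in M. norm (g x) powr p \<le> h x"
  shows "g \<in> Lp p M"
proof -
  have "AE x in M. norm (norm (g x) powr p) \<le> norm (h x)"
    using assms(3) by eventually_elim auto
  then have "integrable M (\<lambda>x. norm (g x) powr p)"
    using assms(1) by (intro Bochner_Integration.integrable_bound[OF assms(2)]) auto
  with assms(1) show ?thesis by (simp add: Lp_def)
qed

lemma Lp_add:
  assumes "0 < p" "f \<in> Lp p M" "g \<in> Lp p M"
  shows "(\<lambda>x. f x + g x) \<in> Lp p M"
proof (rule Lp_bound)
  show "integrable M (\<lambda>x. 2 powr p * (norm (f x) powr p + norm (g x) powr p))"
    using LpD[OF assms(2)] LpD[OF assms(3)] by auto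
qed (use LpD[OF assms(2)] LpD[OF assms(3)] norm_add_powr_le[OF assms(1)] in auto)

lemma Lp_scaleR:
  assumes "f \<in> Lp p M"
  shows "(\<lambda>x. c *\<^sub>R f x) \<in> Lp p M"
  using LpD[OF assms] by (auto simp: Lp_def powr_mult)

lemma Lp_minus: "f \<in> Lp p M \<Longrightarrow> (\<lambda>x. - f x) \<in> Lp p M"
  using Lp_scaleR[of f p M "-1"] by simp

lemma Lp_diff:
  assumes "0 < p" "f \<in> Lp p M" "g \<in> Lp p M"
  shows "(\<lambda>x. f x - g x) \<in> Lp p M"
  using Lp_add[OF assms(1,2) Lp_minus[OF assms(3)]] by simp

lemma Lp_0: "(\<lambda>x. 0) \<in> Lp p M"
  by (simp add: Lp_def)

lemma Lp_cong_AE: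
  assumes "f \<in> Lp p M" "g \<in> borel_measurable M" "AE x in M. f x = g x"
  shows "g \<in> Lp p M"
  using assms by (intro Lp_bound[of g M "\<lambda>x. norm (f x) powr p"]) (auto simp: Lp_def)

lemma Lp_mono_exponent:
  assumes "finite_measure M" "0 < p" "p \<le> q" "f \<in> Lp q M"
  shows "f \<in> Lp p M"
proof (rule Lp_bound)
  interpret finite_measure M by fact
  show "integrable M (\<lambda>x. 1 + norm (f x) powr q)" using LpD[OF assms(4)] by auto
  have "t powr p \<le> 1 + t powr q" if "t \<ge> 0" for t :: real
  proof (cases "t \<le> 1")
    case True
    then have "t powr p \<le> 1" using that assms by (simp add: powr_le1)
    then show ?thesis by (simp add: add_increasing2)
  next
    case False
    then have "t powr p \<le> t powr q" using assms by (intro powr_mono) auto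
    then show ?thesis by simp
  qed
  then show "AE x in M. norm (f x) powr p \<le> 1 + norm (f x) powr q" by auto
qed (use LpD[OF assms(4)] in auto)

text \<open>Young's inequality is used instead of Hoelder's: its additive right-hand side is exactly
  the form of bound required of functionals in the minimisation. The factors \<open>1 / p\<close>
  and \<open>1 / q\<close> are simply estimated by 1.\<close>

lemma Lp_pairing:
  assumes pq: "1 < p" "1 < q" "1 / p + 1 / q = 1" and f: "f \<in> Lp p M" and g: "g \<in> Lp q M"
  shows "integrable M (\<lambda>x. f x \<bullet> g x)"
    and "\<bar>\<integral>x. f x \<bullet> g x \<partial>M\<bar> \<le> (\<integral>x. norm (f x) powr p \<partial>M) + (\<integral>x. norm (g x) powr q \<partial>M)"
proof -
  have young: "\<bar>f x \<bullet> g x\<bar> \<le> norm (f x) powr p + norm (g x) powr q" for x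
  proof -
    have "\<bar>f x \<bullet> g x\<bar> \<le> norm (f x) * norm (g x)" by (rule Cauchy_Schwarz_ineq2)
    also have "\<dots> \<le> norm (f x) powr p / p + norm (g x) powr q / q"
      using pq by (intro Youngs_inequality) auto
    also have "\<dots> \<le> norm (f x) powr p / 1 + norm (g x) powr q / 1"
      using pq by (intro add_mono divide_left_mono) auto
    finally show ?thesis by simp
  qed
  have sum: "integrable M (\<lambda>x. norm (f x) powr p + norm (g x) powr q)"
    using LpD[OF f] LpD[OF g] by auto
  then show int: "integrable M (\<lambda>x. f x \<bullet> g x)"
    by (rule Bochner_Integration.integrable_bound) (use LpD[OF f] LpD[OF g] young in auto)
  have "\<bar>\<integral>x. f x \<bullet> g x \<partial>M\<bar> \<le> (\<integral>x. \<bar>f x \<bullet> g x\<bar> \<partial>M)" by (rule integral_abs_bound)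
  also have "\<dots> \<le> (\<integral>x. norm (f x) powr p + norm (g x) powr q \<partial>M)"
    using int sum young by (intro integral_mono) auto
  finally show "\<bar>\<integral>x. f x \<bullet> g x \<partial>M\<bar> \<le> (\<integral>x. norm (f x) powr p \<partial>M) + (\<integral>x. norm (g x) powr q \<partial>M)"
    using LpD[OF f] LpD[OF g] by simp
qed

lemmas Lp_pairing_3 = Lp_pairing[where p = 3 and q = "3/2", simplified]
lemmas Lp_pairing_2 = Lp_pairing[where p = 2 and q = 2, simplified]

proposition Lp_complete:
  fixes F :: "nat \<Rightarrow> 'a \<Rightarrow> 'b::euclidean_space"
  assumes p: "0 < p" and F: "\<And>k. F k \<in> Lp p M"
    and cauchy: "\<And>e. e > 0 \<Longrightarrow> \<exists>n. \<forall>k\<ge>n. \<forall>l\<ge>n. (\<integral>x. norm (F k x - F l x) powr p \<partial>M) < e"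
  obtains f where "f \<in> Lp p M" "(\<lambda>k. \<integral>x. norm (F k x - f x) powr p \<partial>M) \<longlonglongrightarrow> 0"
proof -
  have [measurable]: "F k \<in> borel_measurable M" for k using LpD[OF F] by auto
  have "\<exists>n. \<forall>k\<ge>n. \<forall>l\<ge>n. (\<integral>x. norm (F k x - F l x) powr p \<partial>M) < (1/4)^j" for j :: nat
    by (rule cauchy) simp
  then obtain n where n: "\<And>j k l. k \<ge> n j \<Longrightarrow> l \<ge> n j \<Longrightarrow> (\<integral>x. norm (F k x - F l x) powr p \<partial>M) < (1/4)^(j::nat)"
    by metis
  \<comment> \<open>The partial sums of \<open>n\<close> make \<open>r\<close> monotone and at least
    \<open>n j\<close>; the summand \<open>j\<close> forces it to infinity.\<close>
  define r where "r j = j + (\<Sum>i\<le>j. n i)" for j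
  have r: "r j \<ge> n j" "r (Suc j) \<ge> r j" "r j \<ge> j" for j
    using member_le_sum[of j "{..j}" n] by (auto simp: r_def)
  define D where "D j x = norm (F (r (Suc j)) x - F (r j) x) powr p" for j x
  have [measurable]: "D j \<in> borel_measurable M" for j unfolding D_def by measurable
  have intD: "integrable M (D j)" for j
    unfolding D_def using LpD(2)[OF Lp_diff[OF p F F]] .
  \<comment> \<open>The weight \<open>2^j\<close> leaves the integrals summable, and finiteness of
    the weighted sum at a point bounds \<open>D j x\<close> by a multiple of \<open>(1/2)^j\<close>.
    Its \<open>p\<close>-th root still decays geometrically, so that the increments are summable for
    every positive \<open>p\<close>.\<close>
  have D_le: "(\<integral>\<^sup>+x. ennreal (2^j * D j x) \<partial>M) \<le> ennreal ((1/2)^j)" for j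
  proof -
    have "(\<integral>\<^sup>+x. ennreal (2^j * D j x) \<partial>M) = ennreal (\<integral>x. 2^j * D j x \<partial>M)"
      by (intro nn_integral_eq_integral) (auto simp: intD, simp add: D_def)
    also have "(\<integral>x. 2^j * D j x \<partial>M) \<le> 2^j * (1/4)^j"
      using n[of j "r (Suc j)" "r j"] r(1,2)[of j] by (simp add: D_def)
    also have "(2::real)^j * (1/4)^j = (1/2)^j" by (simp flip: power_mult_distrib)
    finally show ?thesis by (simp add: ennreal_leI)
  qed
  have "(\<integral>\<^sup>+x. (\<Sum>j. ennreal (2^j * D j x)) \<partial>M) = (\<Sum>j. \<integral>\<^sup>+x. ennreal (2^j * D j x) \<partial>M)"
    by (rule nn_integral_suminf) measurable
  also have "\<dots> \<le> (\<Sum>j. ennreal ((1/2)^j))" by (intro suminf_le D_le summableI)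
  also have "\<dots> < \<infinity>"
    by (subst suminf_ennreal2) (auto simp: summable_geometric)
  finally have "AE x in M. (\<Sum>j. ennreal (2^j * D j x)) \<noteq> \<infinity>"
    by (intro nn_integral_PInf_AE) auto
  then have conv: "AE x in M. convergent (\<lambda>j. F (r j) x)"
  proof eventually_elim
    case (elim x)
    define C where "C = enn2real (\<Sum>j. ennreal (2^j * D j x))"
    have C: "(\<Sum>j. ennreal (2^j * D j x)) = ennreal C" "C \<ge> 0"
      using elim by (auto simp: C_def less_top)
    have "2^j * D j x \<le> C" for j
    proof -
      have "ennreal (2^j * D j x) = (\<Sum>i\<in>{j}. ennreal (2^i * D i x))" by simp
      also have "\<dots> \<le> (\<Sum>j. ennreal (2^j * D j x))" by (rule sum_le_suminf) auto
      finally show ?thesis using C by simp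
    qed
    then have *: "D j x \<le> C * (1/2)^j" for j by (simp add: field_simps power_divide)
    define c where "c = (1/2::real) powr (1/p)"
    have c: "0 \<le> c" "c < 1" using p powr_less_mono2[of "1/p" "1/2" 1] by (auto simp: c_def)
    have pw: "((1/2)^j) powr (1/p) = c^j" for j :: nat
    proof -
      have "((1/2::real)^j) powr (1/p) = ((1/2) powr real j) powr (1/p)"
        by (simp only: powr_realpow[of "1/2::real"])
      also have "\<dots> = c powr real j" unfolding c_def powr_powr by (simp only: mult.commute)
      also have "\<dots> = c ^ j" by (rule powr_realpow) (simp add: c_def)
      finally show ?thesis .
    qed
    have le: "norm (F (r (Suc j)) x - F (r j) x) \<le> C powr (1/p) * c^j" for j
    proof -
      have "norm (F (r (Suc j)) x - F (r j) x) = D j x powr (1/p)"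
        using p by (simp add: D_def powr_powr)
      also have "\<dots> \<le> (C * (1/2)^j) powr (1/p)"
        using p * by (intro powr_mono2) (auto simp: D_def)
      also have "\<dots> = C powr (1/p) * c^j"
        using C by (simp add: powr_mult pw)
      finally show ?thesis .
    qed
    have "summable (\<lambda>j. C powr (1/p) * c^j)"
      using c by (intro summable_mult summable_geometric) auto
    then have "summable (\<lambda>j. F (r (Suc j)) x - F (r j) x)"
      by (rule summable_comparison_test') (rule le)
    then have "convergent (\<lambda>m. \<Sum>j<m. F (r (Suc j)) x - F (r j) x)"
      by (simp add: summable_iff_convergent)
    then have "convergent (\<lambda>m. F (r m) x - F (r 0) x)"
      using sum_lessThan_telescope[of "\<lambda>m. F (r m) x"] by simp
    then show ?case by (simp add: convergent_diff_const_right_iff)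
  qed
  define f where "f x = lim (\<lambda>j. F (r j) x)" for x
  have [measurable]: "f \<in> borel_measurable M" unfolding f_def by measurable
  have conv: "AE x in M. (\<lambda>j. F (r j) x) \<longlonglongrightarrow> f x"
    using conv by eventually_elim (simp add: f_def convergent_LIMSEQ_iff)
  \<comment> \<open>Fatou's lemma along the subsequence \<open>r\<close> transfers the Cauchy
    estimate to the limit for every large index \<open>k\<close>, not only for those of the
    subsequence.\<close>
  have fatou: "(\<integral>\<^sup>+x. ennreal (norm (F k x - f x) powr p) \<partial>M) \<le> ennreal e"
    if k: "k \<ge> m" and m: "\<And>k l. k \<ge> m \<Longrightarrow> l \<ge> m \<Longrightarrow> (\<integral>x. norm (F k x - F l x) powr p \<partial>M) < e"
    for k m e
  proof -
    have mr: "\<forall>\<^sub>F j in sequentially. r j \<ge> m"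
      using eventually_ge_at_top[of m] by eventually_elim (metis r(3) order_trans)
    have "(\<integral>\<^sup>+x. ennreal (norm (F k x - f x) powr p) \<partial>M) =
        (\<integral>\<^sup>+x. liminf (\<lambda>j. ennreal (norm (F k x - F (r j) x) powr p)) \<partial>M)"
    proof (rule nn_integral_cong_AE)
      show "AE x in M. ennreal (norm (F k x - f x) powr p) = liminf (\<lambda>j. ennreal (norm (F k x - F (r j) x) powr p))"
        using conv
      proof eventually_elim
        case (elim x)
        have "(\<lambda>j. ennreal (norm (F k x - F (r j) x) powr p)) \<longlonglongrightarrow> ennreal (norm (F k x - f x) powr p)"
          using p by (intro tendsto_ennrealI tendsto_powr' tendsto_intros elim) auto
        from lim_imp_Liminf[OF _ this] show ?case by simp
      qed
    qed
    also have "\<dots> \<le> liminf (\<lambda>j. \<integral>\<^sup>+x. ennreal (norm (F k x - F (r j) x) powr p) \<partial>M)"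
      by (rule nn_integral_liminf) measurable
    also have "\<dots> \<le> ennreal e"
    proof (rule Liminf_le)
      show "\<forall>\<^sub>F j in sequentially. (\<integral>\<^sup>+x. ennreal (norm (F k x - F (r j) x) powr p) \<partial>M) \<le> ennreal e"
        using mr
      proof eventually_elim
        case (elim j)
        have "(\<integral>\<^sup>+x. ennreal (norm (F k x - F (r j) x) powr p) \<partial>M) = ennreal (\<integral>x. norm (F k x - F (r j) x) powr p \<partial>M)"
          by (intro nn_integral_eq_integral LpD(2)[OF Lp_diff[OF p F F]]) auto
        then show ?case using m[OF k elim] by (simp add: ennreal_leI less_imp_le)
      qed
    qed simp
    finally show ?thesis .
  qed
  have fin: "integrable M (\<lambda>x. norm (F k x - f x) powr p) \<and> (\<integral>x. norm (F k x - f x) powr p \<partial>M) \<le> e"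
    if k: "k \<ge> m" and m: "\<And>k l. k \<ge> m \<Longrightarrow> l \<ge> m \<Longrightarrow> (\<integral>x. norm (F k x - F l x) powr p \<partial>M) < e"
    for k m e
  proof -
    note f = fatou[OF k m]
    have e: "e \<ge> 0" using m[OF k k] by simp
    have int: "integrable M (\<lambda>x. norm (F k x - f x) powr p)"
      using f by (intro integrableI_bounded) (auto simp: less_top[symmetric] top_unique)
    moreover have "ennreal (\<integral>x. norm (F k x - f x) powr p \<partial>M) \<le> ennreal e"
      using f nn_integral_eq_integral[OF int] by simp
    ultimately show ?thesis using e by simp
  qed
  obtain m0 where "\<forall>k\<ge>m0. \<forall>l\<ge>m0. (\<integral>x. norm (F k x - F l x) powr p \<partial>M) < 1"
    using cauchy[of 1] by auto
  then have "(\<lambda>x. F m0 x - f x) \<in> Lp p M" using fin[of m0 m0 1] by (simp add: Lp_def)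
  then have "f \<in> Lp p M" using Lp_diff[OF p F[of m0]] by fastforce
  moreover have "(\<lambda>k. \<integral>x. norm (F k x - f x) powr p \<partial>M) \<longlonglongrightarrow> 0"
  proof (rule LIMSEQ_I)
    fix e :: real assume "e > 0"
    then obtain m where "\<forall>k\<ge>m. \<forall>l\<ge>m. (\<integral>x. norm (F k x - F l x) powr p \<partial>M) < e / 2"
      using cauchy[of "e / 2"] by auto
    then have "(\<integral>x. norm (F k x - f x) powr p \<partial>M) \<le> e / 2" if "k \<ge> m" for k
      using fin[OF that, of "e / 2"] by blast
    with \<open>e > 0\<close> show "\<exists>m. \<forall>k\<ge>m. norm ((\<integral>x. norm (F k x - f x) powr p \<partial>M) - 0) < e"
      by (intro exI[of _ m]) fastforce
  qed
  ultimately show ?thesis using that by blast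
qed

text \<open>Eliminating \<open>a \<bullet> h\<close> by polarisation turns the first-order Taylor
  expansion of \<open>norm a ^ 3 / 3\<close>, whose gradient is the Forchheimer term
  \<open>norm a *\<^sub>R a\<close>, into an identity with an explicit remainder, a sum of two
  nonnegative terms.\<close>

lemma norm_cube_expansion:
  fixes a h :: "'a::real_inner"
  shows "norm (a + h) ^ 3 / 3 = norm a ^ 3 / 3 + norm a * (a \<bullet> h)
    + (norm (a + h) - norm a)\<^sup>2 * (2 * norm (a + h) + norm a) / 6 + norm a * (norm h)\<^sup>2 / 2"
proof -
  define x y where "x = norm a" and "y = norm (a + h)"
  have "y\<^sup>2 = x\<^sup>2 + 2 * (a \<bullet> h) + (norm h)\<^sup>2"
    by (simp add: x_def y_def power2_norm_eq_inner inner_add inner_commute)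
  then have ah: "a \<bullet> h = (y\<^sup>2 - x\<^sup>2 - (norm h)\<^sup>2) / 2" by simp
  show ?thesis unfolding x_def[symmetric] y_def[symmetric] ah
    by (simp add: field_simps power2_eq_square power3_eq_cube)
qed

text \<open>The two remainders complement each other. For \<open>k \<le> 4 * x\<close> the term
  \<open>x * k\<^sup>2 / 2\<close> dominates \<open>k ^ 3\<close>. Otherwise
  \<open>y \<ge> k - x\<close> forces \<open>y - x \<ge> k / 2\<close>, and the other remainder is
  at least \<open>(k / 2)\<^sup>2 * (3 / 2 * k) / 6\<close>, which is where 1/16 comes from.\<close>

lemma norm_cube_lower:
  fixes a h :: "'a::real_inner"
  shows "norm a ^ 3 / 3 + norm a * (a \<bullet> h) + norm h ^ 3 / 16 \<le> norm (a + h) ^ 3 / 3"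
proof -
  define x y k where "x = norm a" and "y = norm (a + h)" and "k = norm h"
  have nn: "x \<ge> 0" "y \<ge> 0" "k \<ge> 0" by (auto simp: x_def y_def k_def)
  have k: "k \<le> x + y" using norm_triangle_ineq4[of "a + h" a] by (simp add: x_def y_def k_def)
  have "k ^ 3 / 16 \<le> (y - x)\<^sup>2 * (2 * y + x) / 6 + x * k\<^sup>2 / 2"
  proof (cases "k \<le> 4 * x")
    case True
    then have "k * k\<^sup>2 \<le> (4 * x) * k\<^sup>2" by (intro mult_right_mono) auto
    then have "k ^ 3 \<le> 4 * (x * k\<^sup>2)" by (simp add: power3_eq_cube power2_eq_square ac_simps)
    moreover have "0 \<le> (y - x)\<^sup>2 * (2 * y + x)" "0 \<le> x * k\<^sup>2" using nn by auto
    ultimately show ?thesis by linarith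
  next
    case False
    then have "(k / 2)\<^sup>2 \<le> (y - x)\<^sup>2" "3 / 2 * k \<le> 2 * y + x"
      using k nn by (auto intro!: power_mono)
    then have "(k / 2)\<^sup>2 * (3 / 2 * k) \<le> (y - x)\<^sup>2 * (2 * y + x)"
      using nn by (intro mult_mono) auto
    moreover have "(k / 2)\<^sup>2 * (3 / 2 * k) = 3 / 8 * k ^ 3" by (simp add: power3_eq_cube power2_eq_square)
    moreover have "0 \<le> x * k\<^sup>2" "0 \<le> k ^ 3" using nn by auto
    ultimately show ?thesis by linarith
  qed
  then show ?thesis
    unfolding norm_cube_expansion[of a h] by (simp add: x_def y_def k_def)
qed

lemma norm_cube_upper:
  fixes a h :: "'a::real_inner"
  shows "norm (a + h) ^ 3 / 3 \<le> norm a ^ 3 / 3 + norm a * (a \<bullet> h) + norm a * (norm h)\<^sup>2 + norm h ^ 3 / 3"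
proof -
  define x y k where "x = norm a" and "y = norm (a + h)" and "k = norm h"
  have nn: "x \<ge> 0" "y \<ge> 0" "k \<ge> 0" by (auto simp: x_def y_def k_def)
  have k: "y \<le> x + k" "\<bar>y - x\<bar> \<le> k"
    using norm_triangle_ineq[of a h] norm_triangle_ineq3[of "a + h" a] by (auto simp: x_def y_def k_def)
  have "(y - x)\<^sup>2 * (2 * y + x) \<le> k\<^sup>2 * (3 * x + 2 * k)"
    using k nn by (intro mult_mono) (auto simp: abs_le_square_iff[symmetric])
  then have "(y - x)\<^sup>2 * (2 * y + x) / 6 + x * k\<^sup>2 / 2 \<le> x * k\<^sup>2 + k ^ 3 / 3"
    by (simp add: field_simps power3_eq_cube power2_eq_square)
  then show ?thesis
    unfolding norm_cube_expansion[of a h] by (simp add: x_def y_def k_def)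
qed

lemma Lp_plus: "0 < p \<Longrightarrow> f \<in> Lp p M \<Longrightarrow> g \<in> Lp p M \<Longrightarrow> f + g \<in> Lp p M"
  using Lp_add by (simp add: plus_fun_def)

lemma Lp_sub: "0 < p \<Longrightarrow> f \<in> Lp p M \<Longrightarrow> g \<in> Lp p M \<Longrightarrow> f - g \<in> Lp p M"
  using Lp_diff by (simp add: fun_diff_def)

lemma Lp_scale: "f \<in> Lp p M \<Longrightarrow> c *\<^sub>R f \<in> Lp p M"
  using Lp_scaleR by (simp add: scaleR_fun_def)

lemma Lp_3_cube: "f \<in> Lp 3 M \<longleftrightarrow> f \<in> borel_measurable M \<and> integrable M (\<lambda>x. norm (f x) ^ 3)"
  by (simp add: Lp_def powr_numeral)

lemma Lp_2_square: "f \<in> Lp 2 M \<longleftrightarrow> f \<in> borel_measurable M \<and> integrable M (\<lambda>x. (norm (f x))\<^sup>2)"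
  by (simp add: Lp_def powr_numeral)

definition cube_int :: "'x measure \<Rightarrow> ('x \<Rightarrow> 'b::euclidean_space) \<Rightarrow> real" where
  "cube_int M f = (\<integral>x. norm (f x) ^ 3 \<partial>M)"

lemma cube_int_nonneg: "0 \<le> cube_int M f"
  unfolding cube_int_def by (rule integral_nonneg_AE) auto

lemma cube_int_scale: "cube_int M (c *\<^sub>R f) = \<bar>c\<bar> ^ 3 * cube_int M f"
  by (simp add: cube_int_def power_mult_distrib)

lemma cube_int_0_iff:
  assumes "f \<in> Lp 3 M"
  shows "cube_int M f = 0 \<longleftrightarrow> (AE x in M. f x = 0)"
  using assms unfolding cube_int_def Lp_3_cube by (subst integral_nonneg_eq_0_iff_AE) auto

section \<open>The nonlinear flow law on a single domain and its convex energy\<close>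

locale darcy_forchheimer = finite_measure M for M :: "'x measure" +
  fixes \<alpha> :: "'x \<Rightarrow> 'b::euclidean_space \<Rightarrow> 'b" and \<beta> :: "'x \<Rightarrow> real" and ah bl bh :: real
  assumes lin: "x \<in> space M \<Longrightarrow> linear (\<alpha> x)"
    and sym: "x \<in> space M \<Longrightarrow> \<alpha> x u \<bullet> v = \<alpha> x v \<bullet> u"
    and psd: "x \<in> space M \<Longrightarrow> 0 \<le> \<alpha> x u \<bullet> u"
    and upper: "x \<in> space M \<Longrightarrow> \<alpha> x u \<bullet> u \<le> ah * (norm u)\<^sup>2"
    and alpha_measurable: "f \<in> borel_measurable M \<Longrightarrow> (\<lambda>x. \<alpha> x (f x)) \<in> borel_measurable M"
    and beta_measurable [measurable]: "\<beta> \<in> borel_measurable M"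
    and beta: "x \<in> space M \<Longrightarrow> bl \<le> \<beta> x" "x \<in> space M \<Longrightarrow> \<beta> x \<le> bh"
    and bl: "0 < bl"
begin

definition law :: "('x \<Rightarrow> 'b) \<Rightarrow> 'x \<Rightarrow> 'b" where
  "law u x = \<alpha> x (u x) + (\<beta> x * norm (u x)) *\<^sub>R u x"

definition form :: "('x \<Rightarrow> 'b) \<Rightarrow> ('x \<Rightarrow> 'b) \<Rightarrow> real" where
  "form u v = (\<integral>x. law u x \<bullet> v x \<partial>M)"

text \<open>The potential of the law: by symmetry of \<open>\<alpha>\<close> its derivative at
  \<open>u\<close> in direction \<open>v\<close> is \<open>form u v\<close>.\<close>

definition energy :: "('x \<Rightarrow> 'b) \<Rightarrow> real" where
  "energy u = (\<integral>x. \<alpha> x (u x) \<bullet> u x / 2 + \<beta> x * norm (u x) ^ 3 / 3 \<partial>M)"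

lemma alpha_add: "x \<in> space M \<Longrightarrow> \<alpha> x (u + v) = \<alpha> x u + \<alpha> x v"
  and alpha_scale: "x \<in> space M \<Longrightarrow> \<alpha> x (c *\<^sub>R u) = c *\<^sub>R \<alpha> x u"
  using lin linear_add linear_cmul by blast+

text \<open>For a symmetric positive semidefinite map a bound on the quadratic form is a bound on
  the operator norm. The form is nonnegative at \<open>u - v\<close> for \<open>v\<close> the
  multiple of \<open>\<alpha> x u\<close> with the length of \<open>u\<close>, which bounds
  \<open>\<alpha> x u \<bullet> v = norm u * norm (\<alpha> x u)\<close>.\<close>

lemma alpha_norm_le:
  assumes x: "x \<in> space M"
  shows "norm (\<alpha> x u) \<le> ah * norm u"
proof (cases "u = 0 \<or> \<alpha> x u = 0")
  case True
  then show ?thesis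
  proof
    assume "u = 0"
    then show ?thesis using linear_0[OF lin[OF x]] by simp
  next
    assume 0: "\<alpha> x u = 0"
    have "0 \<le> ah * norm u"
    proof (cases "u = 0")
      case False
      have "0 \<le> ah * (norm u)\<^sup>2" using upper[OF x, of u] psd[OF x, of u] by linarith
      then show ?thesis using False by (simp add: zero_le_mult_iff)
    qed simp
    then show ?thesis using 0 by simp
  qed
next
  case False
  define v where "v = (norm u / norm (\<alpha> x u)) *\<^sub>R \<alpha> x u"
  have nv: "norm v = norm u" using False by (simp add: v_def)
  have uv: "\<alpha> x u \<bullet> v = norm u * norm (\<alpha> x u)"
    using False by (simp add: v_def dot_square_norm power2_eq_square)
  have "0 \<le> \<alpha> x (u + (-1) *\<^sub>R v) \<bullet> (u + (-1) *\<^sub>R v)" by (rule psd[OF x])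
  also have "\<dots> = \<alpha> x u \<bullet> u + \<alpha> x v \<bullet> v - 2 * (\<alpha> x u \<bullet> v)"
    unfolding alpha_add[OF x] alpha_scale[OF x] using sym[OF x, of v u]
    by (simp add: inner_diff_left inner_diff_right)
  also have "\<dots> \<le> 2 * (ah * (norm u)\<^sup>2) - 2 * (norm u * norm (\<alpha> x u))"
    using upper[OF x, of u] upper[OF x, of v] nv uv by simp
  finally have "norm u * norm (\<alpha> x u) \<le> norm u * (ah * norm u)"
    by (simp add: power2_eq_square ac_simps)
  then show ?thesis using False by simp
qed

text \<open>The power 3/2 of \<open>(norm (u x))\<^sup>2\<close> is \<open>norm (u x) ^ 3\<close>.
  Hence the quadratic term maps \<open>L^3\<close> into its dual, which makes 3 the natural exponent
  for the velocity.\<close>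

lemma square_mult_Lp:
  assumes "u \<in> Lp 3 M"
  shows "(\<lambda>x. (\<beta> x * norm (u x)) *\<^sub>R u x) \<in> Lp (3/2) M"
proof (rule Lp_bound)
  have [measurable]: "u \<in> borel_measurable M" using LpD[OF assms] by auto
  show "(\<lambda>x. (\<beta> x * norm (u x)) *\<^sub>R u x) \<in> borel_measurable M" by measurable
  show "integrable M (\<lambda>x. bh powr (3/2) * norm (u x) ^ 3)" using assms by (auto simp: Lp_3_cube)
  show "AE x in M. norm ((\<beta> x * norm (u x)) *\<^sub>R u x) powr (3/2) \<le> bh powr (3/2) * norm (u x) ^ 3"
  proof (rule AE_I2)
    fix x assume x: "x \<in> space M"
    have "norm ((\<beta> x * norm (u x)) *\<^sub>R u x) = \<beta> x * (norm (u x))\<^sup>2"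
      using beta(1)[OF x] bl by (simp add: power2_eq_square abs_mult)
    also have "\<dots> powr (3/2) = \<beta> x powr (3/2) * norm (u x) ^ 3"
      using beta(1)[OF x] bl by (simp add: powr_mult powr_powr powr_numeral flip: powr_numeral)
    also have "\<dots> \<le> bh powr (3/2) * norm (u x) ^ 3"
      using beta[OF x] bl by (intro mult_right_mono powr_mono2) auto
    finally show "norm ((\<beta> x * norm (u x)) *\<^sub>R u x) powr (3/2) \<le> bh powr (3/2) * norm (u x) ^ 3" .
  qed
qed

lemma alpha_Lp:
  assumes "u \<in> Lp 3 M"
  shows "(\<lambda>x. \<alpha> x (u x)) \<in> Lp 3 M"
proof (rule Lp_bound)
  show "(\<lambda>x. \<alpha> x (u x)) \<in> borel_measurable M" using assms by (intro alpha_measurable LpD)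
  show "integrable M (\<lambda>x. \<bar>ah\<bar> ^ 3 * norm (u x) ^ 3)" using assms by (auto simp: Lp_3_cube)
  have "norm (\<alpha> x (u x)) ^ 3 \<le> \<bar>ah\<bar> ^ 3 * norm (u x) ^ 3" if "x \<in> space M" for x
  proof -
    have "norm (\<alpha> x (u x)) \<le> \<bar>ah\<bar> * norm (u x)"
      using alpha_norm_le[OF that, of "u x"] by (smt (verit) mult_right_mono norm_ge_zero)
    then show ?thesis by (simp flip: power_mult_distrib add: power_mono)
  qed
  then show "AE x in M. norm (\<alpha> x (u x)) powr 3 \<le> \<bar>ah\<bar> ^ 3 * norm (u x) ^ 3"
    by (auto simp: powr_numeral)
qed

lemma law_Lp:
  assumes "u \<in> Lp 3 M"
  shows "law u \<in> Lp (3/2) M"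
  unfolding law_def[abs_def]
  by (intro Lp_add square_mult_Lp[OF assms] Lp_mono_exponent[OF _ _ _ alpha_Lp[OF assms]])
     (auto intro: finite_measure_axioms)

lemma form_integrable:
  assumes "u \<in> Lp 3 M" "v \<in> Lp 3 M"
  shows "integrable M (\<lambda>x. law u x \<bullet> v x)"
  using Lp_pairing_3(1)[OF assms(2) law_Lp[OF assms(1)]] by (simp add: inner_commute)

lemma form_scale: "form u (c *\<^sub>R v) = c * form u v"
  by (simp add: form_def)

lemma form_bound:
  assumes u: "u \<in> Lp 3 M"
  obtains C where "\<And>v. v \<in> Lp 3 M \<Longrightarrow> \<bar>form u v\<bar> \<le> cube_int M v + C"
proof (rule that)
  fix v :: "'x \<Rightarrow> 'b" assume "v \<in> Lp 3 M"
  from Lp_pairing_3(2)[OF this law_Lp[OF u]]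
  show "\<bar>form u v\<bar> \<le> cube_int M v + (\<integral>x. norm (law u x) powr (3/2) \<partial>M)"
    by (simp add: form_def cube_int_def inner_commute powr_numeral)
qed

lemma energy_integrable:
  assumes "u \<in> Lp 3 M"
  shows "integrable M (\<lambda>x. \<alpha> x (u x) \<bullet> u x / 2 + \<beta> x * norm (u x) ^ 3 / 3)"
proof -
  have "(\<lambda>x. \<alpha> x (u x)) \<in> Lp (3/2) M"
    by (rule Lp_mono_exponent[OF _ _ _ alpha_Lp[OF assms]]) (auto intro: finite_measure_axioms)
  from Lp_pairing_3(1)[OF assms this] have 1: "integrable M (\<lambda>x. \<alpha> x (u x) \<bullet> u x)"
    by (simp add: inner_commute)
  from Lp_pairing_3(1)[OF assms square_mult_Lp[OF assms]]
  have 2: "integrable M (\<lambda>x. \<beta> x * norm (u x) ^ 3)"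
    by (simp add: dot_square_norm power2_eq_square power3_eq_cube ac_simps)
  show ?thesis using 1 2 by simp
qed

text \<open>The convexity comes from the Forchheimer term alone, through
  \<open>norm_cube_lower\<close> and the lower bound \<open>bl\<close> of \<open>\<beta>\<close>.
  The Darcy term contributes the remainder \<open>\<alpha> x (v x) \<bullet> v x / 2\<close>, which
  is nonnegative.\<close>

lemma energy_lower:
  assumes u: "u \<in> Lp 3 M" and v: "v \<in> Lp 3 M"
  shows "energy u + form u v + bl / 16 * cube_int M v \<le> energy (u + v)"
proof -
  have uv: "u + v \<in> Lp 3 M" using u v by (simp add: Lp_plus)
  have c: "integrable M (\<lambda>x. norm (v x) ^ 3)" using v by (simp add: Lp_3_cube)
  have "energy u + form u v + bl / 16 * cube_int M v =
      (\<integral>x. (\<alpha> x (u x) \<bullet> u x / 2 + \<beta> x * norm (u x) ^ 3 / 3) + law u x \<bullet> v x + bl / 16 * norm (v x) ^ 3 \<partial>M)"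
    unfolding energy_def form_def cube_int_def using energy_integrable[OF u] form_integrable[OF u v] c by simp
  also have "\<dots> \<le> energy (u + v)" unfolding energy_def
  proof (rule integral_mono)
    show "integrable M (\<lambda>x. (\<alpha> x (u x) \<bullet> u x / 2 + \<beta> x * norm (u x) ^ 3 / 3) + law u x \<bullet> v x + bl / 16 * norm (v x) ^ 3)"
      using energy_integrable[OF u] form_integrable[OF u v] c by simp
    show "integrable M (\<lambda>x. \<alpha> x ((u + v) x) \<bullet> (u + v) x / 2 + \<beta> x * norm ((u + v) x) ^ 3 / 3)"
      by (rule energy_integrable[OF uv])
    fix x assume x: "x \<in> space M"
    have "\<beta> x * (norm (u x) ^ 3 / 3 + norm (u x) * (u x \<bullet> v x) + norm (v x) ^ 3 / 16) \<le> \<beta> x * (norm (u x + v x) ^ 3 / 3)"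
      using beta(1)[OF x] bl by (intro mult_left_mono norm_cube_lower) auto
    moreover have "bl / 16 * norm (v x) ^ 3 \<le> \<beta> x / 16 * norm (v x) ^ 3"
      using beta(1)[OF x] by (intro mult_right_mono) auto
    moreover have "\<beta> x * (norm (u x) ^ 3 / 3 + norm (u x) * (u x \<bullet> v x) + norm (v x) ^ 3 / 16) =
        \<beta> x * norm (u x) ^ 3 / 3 + \<beta> x * norm (u x) * (u x \<bullet> v x) + \<beta> x / 16 * norm (v x) ^ 3"
      by (simp add: algebra_simps)
    moreover have "\<alpha> x ((u + v) x) \<bullet> (u + v) x = \<alpha> x (u x) \<bullet> u x + 2 * (\<alpha> x (u x) \<bullet> v x) + \<alpha> x (v x) \<bullet> v x"
      using sym[OF x, of "v x" "u x"] by (simp add: alpha_add[OF x] inner_add_left inner_add_right)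
    moreover have "law u x \<bullet> v x = \<alpha> x (u x) \<bullet> v x + \<beta> x * norm (u x) * (u x \<bullet> v x)"
      by (simp add: law_def inner_add_left)
    moreover have "\<beta> x * norm ((u + v) x) ^ 3 / 3 = \<beta> x * (norm (u x + v x) ^ 3 / 3)" by simp
    ultimately show "(\<alpha> x (u x) \<bullet> u x / 2 + \<beta> x * norm (u x) ^ 3 / 3) + law u x \<bullet> v x + bl / 16 * norm (v x) ^ 3
        \<le> \<alpha> x ((u + v) x) \<bullet> (u + v) x / 2 + \<beta> x * norm ((u + v) x) ^ 3 / 3"
      using psd[OF x, of "v x"] by linarith
  qed
  finally show ?thesis .
qed

lemma energy_upper:
  assumes u: "u \<in> Lp 3 M" and v: "v \<in> Lp 3 M"
  obtains C where "\<And>t. \<bar>t\<bar> \<le> 1 \<Longrightarrow> energy (u + t *\<^sub>R v) \<le> energy u + t * form u v + C * t\<^sup>2"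
proof -
  \<comment> \<open>\<open>R\<close> majorises the remainder divided by \<open>t\<^sup>2\<close>.
    The mixed term \<open>norm (u x) * (norm (v x))\<^sup>2\<close> is at most the sum of the two
    cubes, and \<open>\<bar>t\<bar> ^ 3 \<le> t\<^sup>2\<close> for
    \<open>\<bar>t\<bar> \<le> 1\<close> turns the cubic remainder into a quadratic one.\<close>
  define R where "R x = \<alpha> x (v x) \<bullet> v x / 2 + bh * (norm (u x) ^ 3 + 2 * norm (v x) ^ 3)" for x
  have iv: "integrable M (\<lambda>x. \<alpha> x (v x) \<bullet> v x)"
  proof -
    have "(\<lambda>x. \<alpha> x (v x)) \<in> Lp (3/2) M"
      by (rule Lp_mono_exponent[OF _ _ _ alpha_Lp[OF v]]) (auto intro: finite_measure_axioms)
    from Lp_pairing_3(1)[OF v this] show ?thesis by (simp add: inner_commute)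
  qed
  have R: "integrable M R" unfolding R_def[abs_def] using iv u v by (simp add: Lp_3_cube)
  have "energy (u + t *\<^sub>R v) \<le> energy u + t * form u v + (\<integral>x. R x \<partial>M) * t\<^sup>2" if t: "\<bar>t\<bar> \<le> 1" for t
  proof -
    have uv: "u + t *\<^sub>R v \<in> Lp 3 M" using u v by (simp add: Lp_plus Lp_scale)
    have "energy (u + t *\<^sub>R v) \<le> (\<integral>x. (\<alpha> x (u x) \<bullet> u x / 2 + \<beta> x * norm (u x) ^ 3 / 3) + t * (law u x \<bullet> v x) + t\<^sup>2 * R x \<partial>M)"
      unfolding energy_def
    proof (rule integral_mono)
      show "integrable M (\<lambda>x. (\<alpha> x (u x) \<bullet> u x / 2 + \<beta> x * norm (u x) ^ 3 / 3) + t * (law u x \<bullet> v x) + t\<^sup>2 * R x)"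
        using energy_integrable[OF u] form_integrable[OF u v] R by simp
      show "integrable M (\<lambda>x. \<alpha> x ((u + t *\<^sub>R v) x) \<bullet> (u + t *\<^sub>R v) x / 2 + \<beta> x * norm ((u + t *\<^sub>R v) x) ^ 3 / 3)"
        by (rule energy_integrable[OF uv])
      fix x assume x: "x \<in> space M"
      define p k where "p = norm (u x)" and "k = norm (v x)"
      have pk: "0 \<le> p" "0 \<le> k" by (auto simp: p_def k_def)
      have pk2: "p * k\<^sup>2 \<le> p ^ 3 + k ^ 3"
      proof (cases "p \<le> k")
        case True
        then have "p * k\<^sup>2 \<le> k * k\<^sup>2" by (intro mult_right_mono) auto
        then show ?thesis using pk by (simp add: power3_eq_cube power2_eq_square add_increasing)
      next
        case False
        then have "p * k\<^sup>2 \<le> p * p\<^sup>2" using pk by (intro mult_left_mono power_mono) auto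
        then show ?thesis using pk by (simp add: power3_eq_cube power2_eq_square add_increasing2)
      qed
      have "\<bar>t\<bar> ^ 3 = \<bar>t\<bar> * t\<^sup>2" by (simp add: power3_eq_cube power2_eq_square)
      also have "\<dots> \<le> 1 * t\<^sup>2" using t by (intro mult_right_mono) auto
      finally have t3: "\<bar>t\<bar> ^ 3 \<le> t\<^sup>2" by simp
      have "p * (norm (t *\<^sub>R v x))\<^sup>2 + norm (t *\<^sub>R v x) ^ 3 / 3 = t\<^sup>2 * (p * k\<^sup>2) + \<bar>t\<bar> ^ 3 * k ^ 3 / 3"
        by (simp add: k_def power_mult_distrib)
      also have "\<dots> \<le> t\<^sup>2 * (p ^ 3 + k ^ 3) + t\<^sup>2 * k ^ 3"
      proof (rule add_mono)
        have "\<bar>t\<bar> ^ 3 * k ^ 3 / 3 \<le> \<bar>t\<bar> ^ 3 * k ^ 3" using pk by simp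
        also have "\<dots> \<le> t\<^sup>2 * k ^ 3" using pk t3 by (intro mult_right_mono) auto
        finally show "\<bar>t\<bar> ^ 3 * k ^ 3 / 3 \<le> t\<^sup>2 * k ^ 3" .
      qed (use pk2 in \<open>auto intro: mult_left_mono\<close>)
      finally have "norm (u x + t *\<^sub>R v x) ^ 3 / 3 \<le> p ^ 3 / 3 + t * (p * (u x \<bullet> v x)) + t\<^sup>2 * (p ^ 3 + 2 * k ^ 3)"
        using norm_cube_upper[of "u x" "t *\<^sub>R v x"] by (simp add: p_def k_def algebra_simps)
      then have "\<beta> x * (norm (u x + t *\<^sub>R v x) ^ 3 / 3) \<le> \<beta> x * (p ^ 3 / 3 + t * (p * (u x \<bullet> v x)) + t\<^sup>2 * (p ^ 3 + 2 * k ^ 3))"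
        using beta(1)[OF x] bl by (intro mult_left_mono) auto
      moreover have "\<beta> x * (t\<^sup>2 * (p ^ 3 + 2 * k ^ 3)) \<le> bh * (t\<^sup>2 * (p ^ 3 + 2 * k ^ 3))"
        using beta(2)[OF x] pk by (intro mult_right_mono) auto
      moreover have "\<beta> x * (p ^ 3 / 3 + t * (p * (u x \<bullet> v x)) + t\<^sup>2 * (p ^ 3 + 2 * k ^ 3)) =
          \<beta> x * p ^ 3 / 3 + t * (\<beta> x * p * (u x \<bullet> v x)) + \<beta> x * (t\<^sup>2 * (p ^ 3 + 2 * k ^ 3))"
        by (simp add: algebra_simps)
      moreover have "\<alpha> x ((u + t *\<^sub>R v) x) \<bullet> (u + t *\<^sub>R v) x =
          \<alpha> x (u x) \<bullet> u x + 2 * (t * (\<alpha> x (u x) \<bullet> v x)) + t\<^sup>2 * (\<alpha> x (v x) \<bullet> v x)"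
        using sym[OF x, of "v x" "u x"]
        by (simp add: alpha_add[OF x] alpha_scale[OF x] inner_add_left inner_add_right power2_eq_square algebra_simps)
      moreover have "t * (law u x \<bullet> v x) = t * (\<alpha> x (u x) \<bullet> v x) + t * (\<beta> x * p * (u x \<bullet> v x))"
        by (simp add: law_def inner_add_left p_def algebra_simps)
      moreover have "t\<^sup>2 * R x = t\<^sup>2 * (\<alpha> x (v x) \<bullet> v x) / 2 + bh * (t\<^sup>2 * (p ^ 3 + 2 * k ^ 3))"
        by (simp add: R_def p_def k_def algebra_simps)
      moreover have "\<beta> x * norm ((u + t *\<^sub>R v) x) ^ 3 / 3 = \<beta> x * (norm (u x + t *\<^sub>R v x) ^ 3 / 3)" by simp
      ultimately show "\<alpha> x ((u + t *\<^sub>R v) x) \<bullet> (u + t *\<^sub>R v) x / 2 + \<beta> x * norm ((u + t *\<^sub>R v) x) ^ 3 / 3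
          \<le> (\<alpha> x (u x) \<bullet> u x / 2 + \<beta> x * norm (u x) ^ 3 / 3) + t * (law u x \<bullet> v x) + t\<^sup>2 * R x"
        unfolding p_def[symmetric] by linarith
    qed
    also have "\<dots> = energy u + t * form u v + (\<integral>x. R x \<partial>M) * t\<^sup>2"
      unfolding energy_def form_def using energy_integrable[OF u] form_integrable[OF u v] R by simp
    finally show ?thesis .
  qed
  then show ?thesis using that by blast
qed

end

text \<open>For \<open>\<alpha> = 0\<close> and \<open>\<beta> = 1\<close> the law is the map from
  \<open>u\<close> to \<open>\<bar>u\<bar> * u\<close>, the duality map from \<open>L^3\<close> to
  \<open>L^(3/2)\<close>. The critical point of \<open>energy u - F u\<close> thus satisfies
  \<open>form u z = F z\<close> for all \<open>z\<close>, and \<open>law u\<close> represents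
  \<open>F\<close>.\<close>

proposition Lp_3_Riesz:
  fixes F :: "('x \<Rightarrow> real) \<Rightarrow> real"
  assumes "finite_measure M"
    and add: "\<And>f g. f \<in> Lp 3 M \<Longrightarrow> g \<in> Lp 3 M \<Longrightarrow> F (f + g) = F f + F g"
    and hom: "\<And>f c. f \<in> Lp 3 M \<Longrightarrow> F (c *\<^sub>R f) = c * F f"
    and bound: "\<And>f. f \<in> Lp 3 M \<Longrightarrow> \<bar>F f\<bar> \<le> B * cube_int M f + C"
  obtains p where "p \<in> Lp (3/2) M" "\<And>f. f \<in> Lp 3 M \<Longrightarrow> F f = (\<integral>x. f x * p x \<partial>M)"
proof -
  interpret finite_measure M by fact
  interpret darcy_forchheimer M "\<lambda>_ _. 0 :: real" "\<lambda>_. 1" 0 1 1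
    by standard (auto simp: linear_iff)
  \<comment> \<open>The modulus of convexity that \<open>energy_lower\<close> gives for
    \<open>bl = 1\<close>.\<close>
  define N where "N z = cube_int M z / 16" for z :: "'x \<Rightarrow> real"
  obtain u where u: "u \<in> Lp 3 M" and crit: "\<And>z. z \<in> Lp 3 M \<Longrightarrow> form u z - F z = 0"
  proof (rule uniformly_convex_critical_point[where K = "Lp 3 M" and Z = "Lp 3 M" and N = N
        and E = "\<lambda>u. energy u - F u" and A = "\<lambda>u z. form u z - F z"])
    show "Lp 3 M \<noteq> ({} :: ('x \<Rightarrow> real) set)" using Lp_0 by blast
    show "u + z \<in> Lp 3 M" "u - z \<in> Lp 3 M" if "u \<in> Lp 3 M" "z \<in> Lp 3 M" for u z :: "'x \<Rightarrow> real"
      using that by (auto intro: Lp_plus Lp_sub)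
    show "c *\<^sub>R z \<in> Lp 3 M" if "z \<in> Lp 3 M" for z :: "'x \<Rightarrow> real" and c
      using that by (rule Lp_scale)
    show "form u (c *\<^sub>R z) - F (c *\<^sub>R z) = c * (form u z - F z)" if "z \<in> Lp 3 M" for u z c
      using that by (simp add: form_scale hom algebra_simps)
    show "energy u - F u + (form u z - F z) + N z \<le> energy (u + z) - F (u + z)"
      if "u \<in> Lp 3 M" "z \<in> Lp 3 M" for u z
      using energy_lower[OF that] add[OF that] by (simp add: N_def)
    show "\<exists>C. \<forall>t. \<bar>t\<bar> \<le> 1 \<longrightarrow> energy (u + t *\<^sub>R z) - F (u + t *\<^sub>R z) \<le> energy u - F u + t * (form u z - F z) + C * t\<^sup>2"
      if uz: "u \<in> Lp 3 M" "z \<in> Lp 3 M" for u z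
    proof -
      from energy_upper[OF uz] obtain D
        where "\<And>t. \<bar>t\<bar> \<le> 1 \<Longrightarrow> energy (u + t *\<^sub>R z) \<le> energy u + t * form u z + D * t\<^sup>2" by blast
      then show ?thesis
        using add[OF uz(1) Lp_scale[OF uz(2)]] hom[OF uz(2)] by (auto simp: algebra_simps)
    qed
    show "\<exists>B C. \<forall>z\<in>Lp 3 M. \<bar>form u z - F z\<bar> \<le> B * N z + C" if "u \<in> Lp 3 M" for u
    proof -
      from form_bound[OF that] obtain D where D: "\<And>v. v \<in> Lp 3 M \<Longrightarrow> \<bar>form u v\<bar> \<le> cube_int M v + D" by blast
      have "\<bar>form u z - F z\<bar> \<le> (16 * (1 + B)) * N z + (D + C)" if "z \<in> Lp 3 M" for z
        using D[OF that] bound[OF that] by (simp add: N_def algebra_simps)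
      then show ?thesis by blast
    qed
    show "N (c *\<^sub>R z) \<le> c\<^sup>2 * N z" if "0 \<le> c" "c \<le> 1" for z c
    proof -
      have "c ^ 3 * cube_int M z \<le> c\<^sup>2 * cube_int M z"
        using that cube_int_nonneg[of M z] by (intro mult_right_mono power_decreasing) auto
      then show ?thesis using that by (simp add: N_def cube_int_scale)
    qed
    show "N (c *\<^sub>R z) \<le> c ^ 3 * N z" if "1 \<le> c" for z c
      using that by (simp add: N_def cube_int_scale)
    show "0 \<le> N z" for z by (simp add: N_def cube_int_nonneg)
    show "\<exists>u\<in>Lp 3 M. (\<lambda>k. N (X k - u)) \<longlonglongrightarrow> 0"
      if X: "\<And>k. X k \<in> Lp 3 M" and c: "\<And>e. e > 0 \<Longrightarrow> \<exists>n. \<forall>k\<ge>n. \<forall>l\<ge>n. N (X k - X l) < e" for X :: "nat \<Rightarrow> 'x \<Rightarrow> real"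
    proof -
      have "\<exists>n. \<forall>k\<ge>n. \<forall>l\<ge>n. (\<integral>x. norm (X k x - X l x) powr 3 \<partial>M) < e" if "e > 0" for e
        using c[of "e / 16"] that by (simp add: N_def cube_int_def powr_numeral)
      from Lp_complete[OF _ X this] obtain f where "f \<in> Lp 3 M" "(\<lambda>k. \<integral>x. norm (X k x - f x) powr 3 \<partial>M) \<longlonglongrightarrow> 0"
        by auto
      then show ?thesis
        by (intro bexI[of _ f]) (auto simp: N_def cube_int_def powr_numeral intro!: tendsto_divide_zero)
    qed
  qed blast
  show ?thesis
  proof (rule that)
    show "law u \<in> Lp (3/2) M" by (rule law_Lp[OF u])
    show "F f = (\<integral>x. f x * law u x \<partial>M)" if "f \<in> Lp 3 M" for f
      using crit[OF that] by (simp add: form_def mult.commute)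
  qed
qed

section \<open>Test functions\<close>

text \<open>The classical smooth function \<open>exp (- 1 / x)\<close>, divided by powers of
  \<open>x\<close>: the derivative of \<open>flat k\<close> is a combination of
  \<open>flat (k + 2)\<close> and \<open>flat (k + 1)\<close>, so the family generates its own
  derivatives.\<close>

definition flat :: "nat \<Rightarrow> real \<Rightarrow> real" where
  "flat k x = (if 0 < x then exp (- 1 / x) / x ^ k else 0)"

lemma flat_tendsto_0: "(flat k \<longlongrightarrow> 0) (at 0)"
proof -
  have "((\<lambda>x. inverse x ^ k / exp (inverse x)) \<longlongrightarrow> (0::real)) (at_right 0)"
    by (rule filterlim_compose[OF tendsto_power_div_exp_0 filterlim_inverse_at_top_right])
  then have "((\<lambda>x. exp (- 1 / x) / x ^ k) \<longlongrightarrow> (0::real)) (at_right 0)"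
    by (simp add: exp_minus field_simps)
  then have r: "(flat k \<longlongrightarrow> 0) (at_right 0)"
    by (rule Lim_transform_eventually) (auto simp: flat_def eventually_at_right_field intro!: exI[of _ 1])
  have "((\<lambda>_. 0) \<longlongrightarrow> (0::real)) (at_left 0)" by simp
  then have l: "(flat k \<longlongrightarrow> 0) (at_left 0)"
    by (rule Lim_transform_eventually) (auto simp: flat_def eventually_at_left_field intro!: exI[of _ "-1"])
  show ?thesis using l r by (simp add: filterlim_split_at)
qed

lemma flat_has_derivative:
  "(flat k has_real_derivative flat (k + 2) x - real k * flat (k + 1) x) (at x)"
proof -
  consider "0 < x" | "x < 0" | "x = 0" by linarith
  then show ?thesis
  proof cases
    case 1
    have "((\<lambda>x. exp (- 1 / x) / x ^ k) has_real_derivative flat (k + 2) x - real k * flat (k + 1) x) (at x)"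
    proof -
      have "((\<lambda>x. exp (- 1 / x)) has_real_derivative exp (- 1 / x) / x\<^sup>2) (at x)"
        using 1 by (auto intro!: derivative_eq_intros simp: power2_eq_square)
      from DERIV_divide[OF this DERIV_pow[of k x]] 1
      have "((\<lambda>x. exp (- 1 / x) / x ^ k) has_real_derivative
          (exp (- 1 / x) / x\<^sup>2 * x ^ k - exp (- 1 / x) * (real k * x ^ (k - Suc 0))) / (x ^ k * x ^ k)) (at x)"
        by simp
      moreover have "(exp (- 1 / x) / x\<^sup>2 * x ^ k - exp (- 1 / x) * (real k * x ^ (k - Suc 0))) / (x ^ k * x ^ k)
          = flat (k + 2) x - real k * flat (k + 1) x"
        using 1 by (cases k) (simp_all add: flat_def power2_eq_square field_simps)
      ultimately show ?thesis by simp
    qed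
    then show ?thesis
      by (rule has_field_derivative_transform_within[where d = x]) (use 1 in \<open>auto simp: flat_def dist_real_def\<close>)
  next
    case 2
    have "((\<lambda>x. 0) has_real_derivative flat (k + 2) x - real k * flat (k + 1) x) (at x)"
      using 2 by (simp add: flat_def)
    then show ?thesis
      by (rule has_field_derivative_transform_within[where d = "- x"]) (use 2 in \<open>auto simp: flat_def dist_real_def\<close>)
  next
    case 3
    \<comment> \<open>At the origin the difference quotient of \<open>flat k\<close> is
      \<open>flat (Suc k)\<close>, which tends to 0.\<close>
    have "((\<lambda>h. (flat k (0 + h) - flat k 0) / h) \<longlongrightarrow> 0) (at 0)"
      using flat_tendsto_0[of "Suc k"]
      by (rule Lim_transform_eventually) (auto simp: flat_def eventually_at intro!: exI[of _ 1])
    then show ?thesis using 3 by (simp add: DERIV_def flat_def)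
  qed
qed

lemma flat_0_bounds: "0 \<le> flat 0 x" "flat 0 x \<le> 1"
  by (auto simp: flat_def)

text \<open>Dilations of \<open>flat 0\<close> approximate the indicator of an open half-line
  pointwise and stay within [0, 1]. Products of them approximate indicators of open boxes and balls
  by smooth functions, so dominated convergence can do the work of mollifiers.\<close>

lemma flat_0_tendsto_indicator: "(\<lambda>n. flat 0 (real n * s)) \<longlonglongrightarrow> indicat_real {0<..} s"
proof (cases "0 < s")
  case True
  have "filterlim (\<lambda>n. real n * s) at_top sequentially"
    using True by (intro filterlim_at_top_mult_tendsto_pos[OF tendsto_const _ filterlim_real_sequentially])
  then have "(\<lambda>n. - inverse (real n * s)) \<longlonglongrightarrow> - 0"
    by (intro tendsto_minus tendsto_inverse_0_at_top)
  then have "(\<lambda>n. exp (- 1 / (real n * s))) \<longlonglongrightarrow> 1"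
    using tendsto_exp by (force simp: divide_inverse)
  then have "(\<lambda>n. flat 0 (real n * s)) \<longlonglongrightarrow> 1"
    by (rule Lim_transform_eventually)
       (use True in \<open>auto simp: flat_def eventually_sequentially zero_less_mult_iff intro!: exI[of _ 1]\<close>)
  then show ?thesis using True by simp
next
  case False
  then have "flat 0 (real n * s) = 0" for n by (simp add: flat_def zero_less_mult_iff)
  then show ?thesis using False by simp
qed

text \<open>A syntactic class that contains the cut-off functions needed for testing and is closed
  under directional derivatives. Since \<open>Ck\<close> iterates directional derivatives,
  smoothness of its members follows by one induction on the order.\<close>

inductive elementary :: "('a::euclidean_space \<Rightarrow> real) \<Rightarrow> bool" where
  const: "elementary (\<lambda>x. c)"
| inner: "elementary (\<lambda>x. x \<bullet> e)"
| square: "elementary (\<lambda>x. x \<bullet> x)"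
| add: "elementary f \<Longrightarrow> elementary g \<Longrightarrow> elementary (\<lambda>x. f x + g x)"
| mult: "elementary f \<Longrightarrow> elementary g \<Longrightarrow> elementary (\<lambda>x. f x * g x)"
| flat: "elementary f \<Longrightarrow> elementary (\<lambda>x. flat k (f x))"

lemma elementary_inner_left: "elementary ((\<bullet>) e)"
  using elementary.inner[of e] by (simp add: inner_commute[of _ e])

lemma elementary_diff: "elementary f \<Longrightarrow> elementary g \<Longrightarrow> elementary (\<lambda>x. f x - g x)"
  using elementary.add[OF _ elementary.mult[OF elementary.const[of "-1"]], of f g] by simp

lemma elementary_prod:
  "finite I \<Longrightarrow> (\<And>i. i \<in> I \<Longrightarrow> elementary (f i)) \<Longrightarrow> elementary (\<lambda>x. \<Prod>i\<in>I. f i x)"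
  by (induction rule: finite_induct) (auto intro: elementary.intros)

lemma elementary_has_derivative:
  assumes "elementary f"
  shows "\<exists>f'. (\<forall>x. (f has_derivative f' x) (at x)) \<and> (\<forall>e. elementary (\<lambda>x. f' x e))"
  using assms
proof induction
  case (const c)
  show ?case by (rule exI[of _ "\<lambda>x h. 0"]) (auto intro: elementary.const)
next
  case (inner e)
  show ?case
    by (rule exI[of _ "\<lambda>x h. h \<bullet> e"]) (auto intro!: derivative_eq_intros elementary.const)
next
  case square
  show ?case
    by (rule exI[of _ "\<lambda>x h. 2 * (x \<bullet> h)"])
       (auto intro!: derivative_eq_intros elementary.const elementary.mult elementary_inner_left simp: inner_commute)
next
  case (add f g)
  then obtain f' g' where fg: "\<And>x. (f has_derivative f' x) (at x)" "\<And>e. elementary (\<lambda>x. f' x e)"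
    "\<And>x. (g has_derivative g' x) (at x)" "\<And>e. elementary (\<lambda>x. g' x e)" by blast
  show ?case
    by (rule exI[of _ "\<lambda>x h. f' x h + g' x h"]) (auto intro!: has_derivative_add fg elementary.add)
next
  case (mult f g)
  then obtain f' g' where fg: "\<And>x. (f has_derivative f' x) (at x)" "\<And>e. elementary (\<lambda>x. f' x e)"
    "\<And>x. (g has_derivative g' x) (at x)" "\<And>e. elementary (\<lambda>x. g' x e)" by blast
  show ?case
    by (rule exI[of _ "\<lambda>x h. f x * g' x h + f' x h * g x"])
       (auto intro!: has_derivative_mult fg elementary.add elementary.mult mult.hyps)
next
  case (flat f k)
  then obtain f' where f: "\<And>x. (f has_derivative f' x) (at x)" "\<And>e. elementary (\<lambda>x. f' x e)" by blast
  have "((\<lambda>x. flat k (f x)) has_derivative (\<lambda>h. (flat (k + 2) (f x) - real k * flat (k + 1) (f x)) * f' x h)) (at x)" for x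
    using has_derivative_compose[OF f(1)[of x] flat_has_derivative[of k "f x", unfolded has_field_derivative_def]]
    by simp
  then show ?case
    by (intro exI[of _ "\<lambda>x h. (flat (k + 2) (f x) - real k * flat (k + 1) (f x)) * f' x h"])
       (auto intro!: f elementary.mult elementary_diff elementary.const elementary.flat flat.hyps)
qed

lemma elementary_Ck: "elementary f \<Longrightarrow> Ck k f"
proof (induction k arbitrary: f)
  case 0
  obtain f' where "\<And>x. (f has_derivative f' x) (at x)" using elementary_has_derivative[OF 0] by blast
  then show ?case by (auto intro!: continuous_at_imp_continuous_on has_derivative_continuous)
next
  case (Suc k)
  obtain f' where f: "\<And>x. (f has_derivative f' x) (at x)" "\<And>e. elementary (\<lambda>x. f' x e)"
    using elementary_has_derivative[OF Suc.prems] by blast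
  have "frechet_derivative f (at x) = f' x" for x using frechet_derivative_at[OF f(1)] by simp
  then show ?case using f Suc.IH by (auto simp: differentiable_def)
qed

lemma elementary_smooth: "elementary f \<Longrightarrow> smooth f"
  by (simp add: smooth_def elementary_Ck)

lemma test_functionI:
  assumes "elementary f" "\<And>x. f x \<noteq> 0 \<Longrightarrow> x \<in> cball c r" "cball c r \<subseteq> D"
  shows "f \<in> test_functions D"
proof -
  have "closure {x. f x \<noteq> 0} \<subseteq> cball c r" using assms(2) by (intro closure_minimal) auto
  moreover from this have "compact (closure {x. f x \<noteq> 0})"
    by (meson bounded_cball bounded_subset closed_closure compact_eq_bounded_closed)
  ultimately show ?thesis using assms elementary_smooth by (auto simp: test_functions_def)
qed

lemma test_functionD:
  assumes "f \<in> test_functions D"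
  shows "f differentiable at x" "continuous_on UNIV f" "continuous_on UNIV (grad f)"
    and "frechet_derivative f (at x) e = grad f x \<bullet> e"
    and "\<exists>K B. compact K \<and> K \<subseteq> D \<and> (\<forall>x. x \<notin> K \<longrightarrow> f x = 0 \<and> grad f x = 0) \<and>
      (\<forall>x. \<bar>f x\<bar> \<le> B) \<and> (\<forall>x. norm (grad f x) \<le> B)"
proof -
  have sm: "Ck (Suc 0) f" "Ck 0 f" using assms by (auto simp: test_functions_def smooth_def simp del: Ck.simps)
  then show d: "f differentiable at x" and cf: "continuous_on UNIV f" for x by auto
  have c: "continuous_on UNIV (\<lambda>x. frechet_derivative f (at x) e)" if "e \<in> Basis" for e
    using sm(1) that by auto
  then show cg: "continuous_on UNIV (grad f)" unfolding grad_def[abs_def] by (intro continuous_intros)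
  have lin: "linear (frechet_derivative f (at x))" for x
    using d linear_frechet_derivative by blast
  show "frechet_derivative f (at x) e = grad f x \<bullet> e" for x e
  proof -
    have "frechet_derivative f (at x) e = frechet_derivative f (at x) (\<Sum>b\<in>Basis. (e \<bullet> b) *\<^sub>R b)"
      by (simp add: euclidean_representation)
    also have "\<dots> = (\<Sum>b\<in>Basis. (e \<bullet> b) * frechet_derivative f (at x) b)"
      by (simp only: linear_sum[OF lin] linear_cmul[OF lin] real_scaleR_def)
    also have "\<dots> = grad f x \<bullet> e" by (simp add: grad_def inner_sum_left inner_sum_right inner_commute mult.commute)
    finally show ?thesis .
  qed
  define K where "K = closure {x. f x \<noteq> 0}"
  have K: "compact K" "K \<subseteq> D" using assms by (auto simp: test_functions_def K_def)
  have f0: "f x = 0" if "x \<notin> K" for x using that closure_subset by (force simp: K_def)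
  have g0: "grad f x = 0" if "x \<notin> K" for x
  proof -
    have op: "open (- K)" using K compact_imp_closed by auto
    have "(f has_derivative (\<lambda>h. 0)) (at x)"
      by (rule has_derivative_transform_within_open[OF has_derivative_const op]) (use that f0 in auto)
    then have "frechet_derivative f (at x) = (\<lambda>h. 0)" using frechet_derivative_at by metis
    then show ?thesis by (simp add: grad_def)
  qed
  obtain B1 where B1: "\<And>x. x \<in> K \<Longrightarrow> \<bar>f x\<bar> \<le> B1"
    using compact_imp_bounded[OF compact_continuous_image[OF continuous_on_subset[OF cf] K(1)]]
    by (auto simp: bounded_iff)
  obtain B2 where B2: "\<And>x. x \<in> K \<Longrightarrow> norm (grad f x) \<le> B2"
    using compact_imp_bounded[OF compact_continuous_image[OF continuous_on_subset[OF cg] K(1)]]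
    by (auto simp: bounded_iff)
  have "\<bar>f x\<bar> \<le> \<bar>B1\<bar> + \<bar>B2\<bar>" "norm (grad f x) \<le> \<bar>B1\<bar> + \<bar>B2\<bar>" for x
    using B1[of x] B2[of x] f0[of x] g0[of x] by (cases "x \<in> K"; force)+
  with K f0 g0 show "\<exists>K B. compact K \<and> K \<subseteq> D \<and> (\<forall>x. x \<notin> K \<longrightarrow> f x = 0 \<and> grad f x = 0) \<and>
      (\<forall>x. \<bar>f x\<bar> \<le> B) \<and> (\<forall>x. norm (grad f x) \<le> B)" by blast
qed

section \<open>Functions determined by their integrals against test functions\<close>

lemma locally_integrable_indicator:
  assumes "locally_integrable D f" "compact K" "K \<subseteq> D"
  shows "integrable lebesgue (\<lambda>x. indicator K x *\<^sub>R f x)"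
proof -
  have "integrable (lebesgue_on K) f" using assms by (auto simp: locally_integrable_def)
  then show ?thesis
    using assms(2) by (subst (asm) integrable_restrict_space) (auto simp: fmeasurableD[OF lmeasurable_compact])
qed

text \<open>Boxes generate the Borel sets and are stable under intersection, so the vanishing of the
  integrals spreads to all Borel sets by Dynkin's theorem, and a density whose integrals all vanish
  is 0 almost everywhere.\<close>

lemma AE_zero_if_boxes_zero:
  fixes f :: "'a::euclidean_space \<Rightarrow> real"
  assumes f: "integrable lborel f"
    and box: "\<And>a b. (\<integral>x. indicator (box a b) x * f x \<partial>lborel) = 0"
  shows "AE x in lborel. f x = 0"
proof (rule sigma_finite_measure.density_zero[OF lborel.sigma_finite_measure_axioms f])
  have [measurable]: "f \<in> borel_measurable borel" using f by simp
  have int: "integrable lborel (\<lambda>x. indicator A x * f x)" if "A \<in> sets borel" for A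
    using integrable_mult_indicator[of A lborel f] that f by simp
  \<comment> \<open>The complement step of the induction needs the integral over the whole space,
    which is the limit over growing boxes.\<close>
  have all: "(\<integral>x. f x \<partial>lborel) = 0"
  proof (rule LIMSEQ_unique)
    let ?B = "\<lambda>n. box (- (real n *\<^sub>R One)) (real n *\<^sub>R One :: 'a)"
    show "(\<lambda>n. \<integral>x. indicator (?B n) x * f x \<partial>lborel) \<longlonglongrightarrow> (\<integral>x. f x \<partial>lborel)"
    proof (rule integral_dominated_convergence[where w = "\<lambda>x. \<bar>f x\<bar>"])
      show "AE x in lborel. (\<lambda>n. indicator (?B n) x * f x) \<longlonglongrightarrow> f x"
      proof (rule AE_I2)
        fix x :: 'a
        obtain m where m: "x \<in> ?B m" using UN_box_eq_UNIV by blast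
        have "?B m \<subseteq> ?B n" if "m \<le> n" for n
          using that by (auto simp: mem_box) (smt (verit, best) of_nat_mono)+
        then have "\<forall>\<^sub>F n in sequentially. f x = indicator (?B n) x * f x"
          using m by (intro eventually_sequentiallyI[of m]) (auto simp: indicator_def)
        then show "(\<lambda>n. indicator (?B n) x * f x) \<longlonglongrightarrow> f x"
          by (rule Lim_transform_eventually[OF tendsto_const])
      qed
    qed (use f in \<open>auto simp: indicator_def\<close>)
    show "(\<lambda>n. \<integral>x. indicator (?B n) x * f x \<partial>lborel) \<longlonglongrightarrow> 0"
      by (simp add: box)
  qed
  fix A :: "'a set" assume "A \<in> sets lborel"
  then have A: "A \<in> sigma_sets UNIV (range (\<lambda>(a, b). box a b))" by (simp add: borel_eq_box)
  have borel: "sigma_sets UNIV (range (\<lambda>(a, b). box a b :: 'a set)) = sets borel" by (simp add: borel_eq_box)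
  have "Int_stable (range (\<lambda>(a, b). box a b :: 'a set))" "range (\<lambda>(a, b). box a b :: 'a set) \<subseteq> Pow UNIV"
    by (auto simp: Int_stable_def box_Int_box)
  then have "(\<integral>x. indicator A x * f x \<partial>lborel) = 0"
    using A
  proof (induction rule: sigma_sets_induct_disjoint)
    case (basic A)
    then show ?case using box by auto
  next
    case (compl A)
    have "A \<in> sets borel" using compl(1) borel by simp
    moreover have "(\<lambda>x. indicator (UNIV - A) x * f x) = (\<lambda>x. f x - indicator A x * f x)"
      by (auto simp: indicator_def)
    ultimately show ?case using compl int[of A] f all by simp
  next
    case (union A)
    have A: "A i \<in> sets borel" for i using union(2) borel by blast
    have s: "(\<lambda>n. indicator (A n) x * f x) sums (indicator (\<Union>i. A i) x * f x)" for x
    proof (cases "x \<in> (\<Union>i. A i)")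
      case True
      then obtain i where i: "x \<in> A i" by blast
      then have "x \<notin> A j" if "j \<noteq> i" for j using union(1) that by (auto simp: disjoint_family_on_def)
      then have "(\<lambda>n. indicator (A n) x * f x) sums (\<Sum>n\<in>{i}. indicator (A n) x * f x)"
        by (intro sums_finite) auto
      then show ?thesis using True i by simp
    qed (auto simp: indicator_def)
    have "(\<lambda>n. \<integral>x. (\<Sum>i<n. indicator (A i) x * f x) \<partial>lborel) \<longlonglongrightarrow> (\<integral>x. indicator (\<Union>i. A i) x * f x \<partial>lborel)"
    proof (rule integral_dominated_convergence[where w = "\<lambda>x. \<bar>f x\<bar>"])
      show "AE x in lborel. (\<lambda>n. \<Sum>i<n. indicator (A i) x * f x) \<longlonglongrightarrow> indicator (\<Union>i. A i) x * f x"
        using s by (simp add: sums_def)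
      have "norm (\<Sum>i<n. indicator (A i) x * f x) \<le> \<bar>f x\<bar>" for n x
      proof -
        have "(\<Sum>i<n. indicator (A i) x * f x) = indicator (\<Union>i<n. A i) x * f x"
        proof -
          have "indicat_real (\<Union>i<n. A i) x = (\<Sum>i<n. indicat_real (A i) x)"
            by (rule indicator_UN_disjoint) (auto intro: disjoint_family_on_mono[OF _ union(1)])
          then show ?thesis by (simp flip: sum_distrib_right)
        qed
        then show ?thesis by (simp only: real_norm_def) (auto simp add: abs_mult indicator_def)
      qed
      then show "AE x in lborel. norm (\<Sum>i<n. indicator (A i) x * f x) \<le> \<bar>f x\<bar>" for n by simp
    qed (use f A in auto)
    moreover have "(\<integral>x. (\<Sum>i<n. indicator (A i) x * f x) \<partial>lborel) = 0" for n
      using union(3) int[OF A] by (subst Bochner_Integration.integral_sum) auto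
    ultimately show ?case by (simp add: LIMSEQ_const_iff)
  qed simp
  then show "set_lebesgue_integral lborel A f = 0" by (simp add: set_lebesgue_integral_def)
qed

text \<open>Representatives chosen by \<open>SOME\<close>, such as \<open>weak_div\<close>, come
  with local integrability only; measurability on all of \<open>D\<close> is assembled from a
  compact exhaustion.\<close>

lemma locally_integrable_measurable:
  fixes f :: "'a::euclidean_space \<Rightarrow> 'b::euclidean_space"
  assumes D: "open D" and f: "locally_integrable D f"
  shows "f \<in> borel_measurable (lebesgue_on D)"
proof -
  obtain K where K: "\<And>n. compact (K n)" "\<And>n::nat. K n \<subseteq> D" "\<Union>(range K) = D"
    using open_Union_compact_subsets[OF D] by metis
  have Ks: "K n \<in> sets lebesgue" for n using fmeasurableD[OF lmeasurable_compact[OF K(1)]] .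
  show ?thesis
  proof (rule measurable_piecewise_restrict[of "range K"])
    fix A assume "A \<in> range K"
    then obtain n where A: "A = K n" by blast
    show "A \<inter> space (lebesgue_on D) \<in> sets (lebesgue_on D)"
      using A K Ks by (auto simp: sets_restrict_space)
    have "f \<in> borel_measurable (lebesgue_on (K n))"
      using f K(1,2)[of n] unfolding locally_integrable_def by (blast dest: borel_measurable_integrable)
    moreover have "restrict_space (lebesgue_on D) A = lebesgue_on (K n)"
      using A K D by (simp add: restrict_restrict_space Ks inf.absorb2)
    ultimately show "f \<in> borel_measurable (restrict_space (lebesgue_on D) A)" by simp
  qed (use K in auto)
qed

text \<open>Test functions of \<open>D\<close> that read off coordinates along the image of
  \<open>T\<close> already approximate indicators of small boxes in \<open>U\<close>. This form of
  the fundamental lemma of the calculus of variations serves twice: the identity map gives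
  uniqueness of weak divergences, the chart of the fracture gives uniqueness of normal
  traces.\<close>

lemma weak_eq_AE:
  fixes T :: "'b::euclidean_space \<Rightarrow> 'a::euclidean_space"
  assumes D: "open D" and U: "open U" and T: "linear T" "\<And>y. norm (T y) = norm y"
    and hU: "(\<lambda>y. x0 + T y) ` U \<subseteq> D"
    and w: "locally_integrable U w" "locally_integrable U w'"
    and eq: "\<And>\<phi>. \<phi> \<in> test_functions D \<Longrightarrow>
      (\<integral>y. w y * \<phi> (x0 + T y) \<partial>lebesgue_on U) = (\<integral>y. w' y * \<phi> (x0 + T y) \<partial>lebesgue_on U)"
  shows "AE y in lebesgue_on U. w y = w' y"
proof -
  have local: "\<exists>r>0. AE y in lebesgue. y \<in> ball y0 r \<longrightarrow> w y = w' y" if y0: "y0 \<in> U" for y0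
  proof -
    define h where "h = (\<lambda>y. x0 + T y)"
    obtain r1 where r1: "r1 > 0" "cball y0 r1 \<subseteq> U" using U y0 open_contains_cball by blast
    have "h y0 \<in> D" using hU y0 by (auto simp: h_def)
    then obtain r2 where r2: "r2 > 0" "cball (h y0) r2 \<subseteq> D" using D open_contains_cball by blast
    define r where "r = min r1 r2"
    have r: "r > 0" "cball y0 r \<subseteq> U" "cball (h y0) r \<subseteq> D" using r1 r2 by (auto simp: r_def)
    have Tinner: "T u \<bullet> T v = u \<bullet> v" for u v
      unfolding dot_norm T(2) by (simp flip: linear_add[OF T(1)] add: T(2))
    have dist_h: "h y - h z = T (y - z)" for y z by (simp add: h_def linear_diff[OF T(1)])
    define d where "d y = indicator (cball y0 r) y * (w y - w' y)" for y
    have iw: "integrable lebesgue (\<lambda>y. indicator (cball y0 r) y * w y)"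
      "integrable lebesgue (\<lambda>y. indicator (cball y0 r) y * w' y)"
      using locally_integrable_indicator[OF w(1) _ r(2)] locally_integrable_indicator[OF w(2) _ r(2)] by auto
    have d: "integrable lebesgue d"
      using Bochner_Integration.integrable_diff[OF iw] by (simp add: d_def[abs_def] algebra_simps)
    have box: "(\<integral>y. indicator (box a b) y * (indicator (ball y0 r) y * d y) \<partial>lebesgue) = 0" for a b
    proof -
      \<comment> \<open>The first factor cuts off to the ball of radius \<open>r\<close> about
        \<open>h y0\<close> and provides compact support in \<open>D\<close>. The others depend on
        \<open>x\<close> through \<open>(x - x0) \<bullet> T e\<close>, which equals
        \<open>y \<bullet> e\<close> at \<open>x = h y\<close>, because \<open>T\<close> preserves
        inner products. As \<open>n\<close> grows, the pull-back by \<open>h\<close> tends to the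
        indicator of \<open>box a b \<inter> ball y0 r\<close>.\<close>
      define \<phi> where "\<phi> n x = flat 0 (real n * (r\<^sup>2 - (norm (x - h y0))\<^sup>2)) *
        (\<Prod>e\<in>Basis. flat 0 (real n * ((x - x0) \<bullet> T e - a \<bullet> e)) * flat 0 (real n * (b \<bullet> e - (x - x0) \<bullet> T e)))" for n x
      have "elementary (\<phi> n)" for n
        unfolding \<phi>_def[abs_def] power2_norm_eq_inner inner_diff_left inner_diff_right
        by (intro elementary.intros elementary_diff elementary_prod elementary_inner_left) auto
      moreover have "x \<in> cball (h y0) r" if "\<phi> n x \<noteq> 0" for n x
      proof -
        have "0 < real n * (r\<^sup>2 - (norm (x - h y0))\<^sup>2)" using that by (auto simp: \<phi>_def flat_def split: if_splits)
        then have "(norm (x - h y0))\<^sup>2 \<le> r\<^sup>2" by (simp add: zero_less_mult_iff)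
        then show ?thesis using r(1) by (simp add: dist_norm norm_minus_commute)
      qed
      ultimately have \<phi>: "\<phi> n \<in> test_functions D" for n
        using r(3) by (intro test_functionI)
      have \<phi>h: "\<phi> n (h y) = flat 0 (real n * (r\<^sup>2 - (norm (y - y0))\<^sup>2)) *
        (\<Prod>e\<in>Basis. flat 0 (real n * (y \<bullet> e - a \<bullet> e)) * flat 0 (real n * (b \<bullet> e - y \<bullet> e)))" for n y
        by (simp add: \<phi>_def dist_h T(2)) (simp add: h_def Tinner)
      have \<phi>0: "\<phi> n (h y) = 0" if "y \<notin> cball y0 r" for n y
      proof -
        have "r\<^sup>2 \<le> (norm (y - y0))\<^sup>2" using that r(1) by (intro power_mono) (auto simp: dist_norm norm_minus_commute)
        then have "\<not> 0 < real n * (r\<^sup>2 - (norm (y - y0))\<^sup>2)" by (simp add: zero_less_mult_iff)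
        then show ?thesis by (simp add: \<phi>h flat_def)
      qed
      have \<phi>1: "\<bar>\<phi> n (h y)\<bar> \<le> 1" for n y
        unfolding \<phi>h abs_mult abs_prod
        by (intro mult_le_one prod_le_1) (auto simp: flat_0_bounds intro: mult_le_one prod_nonneg)
      have \<phi>c: "(\<lambda>y. \<phi> n (h y)) \<in> borel_measurable lebesgue" for n
      proof -
        have "continuous_on UNIV (\<lambda>y. \<phi> n (h y))"
          unfolding h_def
          by (intro continuous_on_compose2[OF test_functionD(2)[OF \<phi>]] continuous_intros linear_continuous_on
              linear_conv_bounded_linear[THEN iffD1, OF T(1)]) auto
        then show ?thesis by (intro measurable_completion) (simp add: borel_measurable_continuous_onI)
      qed
      have red: "(\<integral>y. v y * \<phi> n (h y) \<partial>lebesgue_on U) = (\<integral>y. (indicator (cball y0 r) y * v y) * \<phi> n (h y) \<partial>lebesgue)" for v n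
      proof -
        have "(\<integral>y. v y * \<phi> n (h y) \<partial>lebesgue_on U) = (\<integral>y. indicator U y *\<^sub>R (v y * \<phi> n (h y)) \<partial>lebesgue)"
          using U by (intro integral_restrict_space) auto
        also have "\<dots> = (\<integral>y. (indicator (cball y0 r) y * v y) * \<phi> n (h y) \<partial>lebesgue)"
          using r(2) \<phi>0 by (intro Bochner_Integration.integral_cong) (auto simp: indicator_def)
        finally show ?thesis .
      qed
      have ip: "integrable lebesgue (\<lambda>y. v y * \<phi> n (h y))" if "integrable lebesgue v" for v n
        using \<phi>1 \<phi>c that
        by (intro Bochner_Integration.integrable_bound[OF that]) (auto simp: abs_mult intro!: mult_right_le_one_le)
      have zero: "(\<integral>y. d y * \<phi> n (h y) \<partial>lebesgue) = 0" for n
      proof -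
        have "(\<integral>y. d y * \<phi> n (h y) \<partial>lebesgue) =
          (\<integral>y. (indicator (cball y0 r) y * w y) * \<phi> n (h y) - (indicator (cball y0 r) y * w' y) * \<phi> n (h y) \<partial>lebesgue)"
          by (simp add: d_def algebra_simps)
        also have "\<dots> = 0"
          using Bochner_Integration.integral_diff[OF ip[OF iw(1)] ip[OF iw(2)], of n n] eq[OF \<phi>[of n]] red
          by (simp add: h_def)
        finally show ?thesis .
      qed
      have "(\<lambda>n. \<integral>y. d y * \<phi> n (h y) \<partial>lebesgue) \<longlonglongrightarrow> (\<integral>y. indicator (box a b) y * (indicator (ball y0 r) y * d y) \<partial>lebesgue)"
      proof (rule integral_dominated_convergence[where w = "\<lambda>y. \<bar>d y\<bar>"])
        show "AE y in lebesgue. (\<lambda>n. d y * \<phi> n (h y)) \<longlonglongrightarrow> indicator (box a b) y * (indicator (ball y0 r) y * d y)"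
        proof (rule AE_I2)
          fix y
          have "(\<lambda>n. \<phi> n (h y)) \<longlonglongrightarrow> indicator {0<..} (r\<^sup>2 - (norm (y - y0))\<^sup>2) *
            (\<Prod>e\<in>Basis. indicat_real {0<..} (y \<bullet> e - a \<bullet> e) * indicator {0<..} (b \<bullet> e - y \<bullet> e))"
            unfolding \<phi>h by (intro tendsto_intros flat_0_tendsto_indicator)
          also have "indicat_real {0<..} (r\<^sup>2 - (norm (y - y0))\<^sup>2) = indicator (ball y0 r) y"
            using r(1) power_strict_mono[of "norm (y - y0)" r 2] power_mono[of r "norm (y - y0)" 2]
            by (auto simp: indicator_def dist_norm norm_minus_commute not_less)
          also have "(\<Prod>e\<in>Basis. indicat_real {0<..} (y \<bullet> e - a \<bullet> e) * indicator {0<..} (b \<bullet> e - y \<bullet> e)) = indicator (box a b) y"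
            by (auto simp: indicator_def mem_box not_less)
          finally have "(\<lambda>n. \<phi> n (h y)) \<longlonglongrightarrow> indicator (ball y0 r) y * indicator (box a b) y" .
          then show "(\<lambda>n. d y * \<phi> n (h y)) \<longlonglongrightarrow> indicator (box a b) y * (indicator (ball y0 r) y * d y)"
            by (auto dest: tendsto_mult[OF tendsto_const[of "d y"]] simp: ac_simps)
        qed
        show "AE y in lebesgue. norm (d y * \<phi> n (h y)) \<le> \<bar>d y\<bar>" for n
          using \<phi>1 by (auto simp: abs_mult intro!: mult_right_le_one_le)
      qed (use d \<phi>c in \<open>auto intro!: borel_measurable_times borel_measurable_indicator\<close>)
      then show ?thesis by (simp add: zero LIMSEQ_const_iff)
    qed
    define f where "f y = indicator (ball y0 r) y * d y" for y
    have f: "integrable lebesgue f"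
      using integrable_mult_indicator[of "ball y0 r" lebesgue d] d by (simp add: f_def[abs_def])
    \<comment> \<open>The box criterion is formulated for \<open>lborel\<close>, hence the passage
      to a Borel representative.\<close>
    obtain g where g: "g \<in> borel_measurable lborel" "AE y in lborel. f y = g y"
      using completion_ex_borel_measurable_real[of f lborel] f by auto
    have fg: "AE y in lebesgue. f y = g y" using g(2) by (rule AE_completion)
    have "integrable lebesgue g"
      using f g by (subst integrable_cong_AE[OF _ _ fg, symmetric]) (auto intro: measurable_completion)
    then have "integrable lborel g" using g(1) by (simp add: integrable_completion)
    moreover have "(\<integral>y. indicator (box a b) y * g y \<partial>lborel) = 0" for a b
    proof -
      have "(\<integral>y. indicator (box a b) y * g y \<partial>lborel) = (\<integral>y. indicator (box a b) y * g y \<partial>lebesgue)"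
        using g(1) by (intro integral_completion[symmetric]) auto
      also have "\<dots> = (\<integral>y. indicator (box a b) y * f y \<partial>lebesgue)"
        using f g fg by (intro integral_cong_AE borel_measurable_times borel_measurable_indicator)
          (auto intro: measurable_completion)
      finally show ?thesis using box by (simp add: f_def)
    qed
    ultimately have "AE y in lborel. g y = 0" by (rule AE_zero_if_boxes_zero)
    then have "AE y in lebesgue. g y = 0" by (rule AE_completion)
    with fg have "AE y in lebesgue. y \<in> ball y0 r \<longrightarrow> w y = w' y"
      by eventually_elim (auto simp: f_def d_def indicator_def split: if_splits)
    then show ?thesis using r(1) by blast
  qed
  then obtain \<rho> where \<rho>: "\<And>y. y \<in> U \<Longrightarrow> \<rho> y > 0" "\<And>y. y \<in> U \<Longrightarrow> AE z in lebesgue. z \<in> ball y (\<rho> y) \<longrightarrow> w z = w' z"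
    by metis
  \<comment> \<open>Countably many of the balls suffice by Lindeloef's theorem, so the local
    exceptional sets add up to a null set.\<close>
  obtain F where F: "F \<subseteq> (\<lambda>y. ball y (\<rho> y)) ` U" "countable F" "\<Union>F = (\<Union>y\<in>U. ball y (\<rho> y))"
    using Lindelof[of "(\<lambda>y. ball y (\<rho> y)) ` U"] by auto
  have "AE z in lebesgue. \<forall>S\<in>F. z \<in> S \<longrightarrow> w z = w' z"
    using F(1,2) \<rho>(2) by (subst AE_ball_countable) auto
  then have "AE z in lebesgue. z \<in> U \<longrightarrow> w z = w' z"
  proof eventually_elim
    case (elim z)
    show ?case
    proof
      assume "z \<in> U"
      then have "z \<in> \<Union>F" using F(3) \<rho>(1)[of z] by force
      then show "w z = w' z" using elim by blast
    qed
  qed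
  then show ?thesis using U by (subst AE_restrict_space_iff) auto
qed

section \<open>Hausdorff measure\<close>

definition hausdorff_weight :: "nat \<Rightarrow> 'a::euclidean_space set \<Rightarrow> ennreal" where
  "hausdorff_weight k S = (if S = {} then 0 else ennreal (unit_ball_vol (real k) * (diameter S / 2) ^ k))"

definition hausdorff_covers :: "real \<Rightarrow> 'a::euclidean_space set \<Rightarrow> (nat \<Rightarrow> 'a set) set" where
  "hausdorff_covers \<delta> A = {C. A \<subseteq> (\<Union>j. C j) \<and> (\<forall>j. bounded (C j) \<and> diameter (C j) \<le> \<delta>)}"

definition hausdorff_pre :: "nat \<Rightarrow> real \<Rightarrow> 'a::euclidean_space set \<Rightarrow> ennreal" where
  "hausdorff_pre k \<delta> A = (INF C\<in>hausdorff_covers \<delta> A. \<Sum>j. hausdorff_weight k (C j))"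

lemma hausdorff_outer_eq: "hausdorff_outer k A = (SUP \<delta>\<in>{0<..}. hausdorff_pre k \<delta> A)"
  by (simp add: hausdorff_outer_def hausdorff_pre_def hausdorff_covers_def hausdorff_weight_def)

lemma hausdorff_pre_le_outer: "0 < \<delta> \<Longrightarrow> hausdorff_pre k \<delta> A \<le> hausdorff_outer k A"
  unfolding hausdorff_outer_eq by (rule SUP_upper) simp

lemma hausdorff_pre_antimono: "\<delta> \<le> \<delta>' \<Longrightarrow> hausdorff_pre k \<delta>' A \<le> hausdorff_pre k \<delta> A"
  unfolding hausdorff_pre_def by (rule INF_superset_mono) (auto simp: hausdorff_covers_def intro: order_trans)

lemma hausdorff_outer_mono: "A \<subseteq> B \<Longrightarrow> hausdorff_outer k A \<le> hausdorff_outer k B"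
  unfolding hausdorff_outer_eq hausdorff_pre_def
  by (intro SUP_mono' INF_superset_mono) (auto simp: hausdorff_covers_def)

lemma hausdorff_pre_empty: "0 \<le> \<delta> \<Longrightarrow> hausdorff_pre k \<delta> {} = 0"
proof -
  assume "0 \<le> \<delta>"
  then have "hausdorff_pre k \<delta> ({} :: 'a set) \<le> (\<Sum>j. hausdorff_weight k (({} :: 'a set)))"
    unfolding hausdorff_pre_def
    by (intro INF_lower2[of "\<lambda>_. {}"]) (auto simp: hausdorff_covers_def diameter_def)
  then show ?thesis by (simp add: hausdorff_weight_def)
qed

lemma hausdorff_outer_empty: "hausdorff_outer k {} = 0"
  unfolding hausdorff_outer_eq by (auto simp: hausdorff_pre_empty intro!: antisym SUP_least)

lemma hausdorff_pre_UN: "hausdorff_pre k \<delta> (\<Union>i. A i) \<le> (\<Sum>i. hausdorff_pre k \<delta> (A i))"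
proof (rule ennreal_le_epsilon)
  fix e :: real assume e: "0 < e" and fin: "(\<Sum>i. hausdorff_pre k \<delta> (A i)) < top"
  have lt: "hausdorff_pre k \<delta> (A n) < top" for n using fin by (rule ennreal_suminf_lessD)
  have "\<exists>C\<in>hausdorff_covers \<delta> (A n). (\<Sum>j. hausdorff_weight k (C j)) < hausdorff_pre k \<delta> (A n) + ennreal (e * (1/2)^Suc n)" for n
  proof (rule INF_approx_ennreal)
    show "hausdorff_pre k \<delta> (A n) = (INF C\<in>hausdorff_covers \<delta> (A n). \<Sum>j. hausdorff_weight k (C j))"
      by (rule hausdorff_pre_def)
    show "hausdorff_pre k \<delta> (A n) \<noteq> \<infinity>" using lt[of n] by simp
  qed (use e in simp)
  then obtain B where B: "\<And>n. B n \<in> hausdorff_covers \<delta> (A n)"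
    "\<And>n. (\<Sum>j. hausdorff_weight k (B n j)) < hausdorff_pre k \<delta> (A n) + ennreal (e * (1/2)^Suc n)"
    by metis
  \<comment> \<open>The countably many covers are enumerated as a single sequence by the pairing
    function.\<close>
  define C where "C = case_prod B o prod_decode"
  have "C \<in> hausdorff_covers \<delta> (\<Union>i. A i)"
  proof -
    have "(\<Union>i. A i) \<subseteq> (\<Union>i. C i)"
      using B(1) by (auto simp add: C_def hausdorff_covers_def subset_eq) (metis prod.case prod_encode_inverse)
    moreover have "bounded (C j) \<and> diameter (C j) \<le> \<delta>" for j
      using B(1) by (auto simp: C_def hausdorff_covers_def split: prod.splits)
    ultimately show ?thesis by (simp add: hausdorff_covers_def)
  qed
  then have "hausdorff_pre k \<delta> (\<Union>i. A i) \<le> (\<Sum>i. hausdorff_weight k (C i))"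
    unfolding hausdorff_pre_def by (rule INF_lower)
  also have "\<dots> = (\<Sum>n. \<Sum>i. hausdorff_weight k (B n i))"
    using suminf_ennreal_2dimen[where f = "\<lambda>p. hausdorff_weight k (case_prod B p)"] by (simp add: C_def)
  also have "\<dots> \<le> (\<Sum>n. hausdorff_pre k \<delta> (A n) + e * (1/2) ^ Suc n)"
    by (intro suminf_le allI less_imp_le[OF B(2)]) auto
  also have "... = (\<Sum>n. hausdorff_pre k \<delta> (A n)) + (\<Sum>n. ennreal e * ennreal ((1/2) ^ Suc n))"
    using \<open>0 < e\<close> by (subst suminf_add[symmetric])
      (auto simp del: ennreal_suminf_cmult simp add: ennreal_mult[symmetric])
  also have "\<dots> = (\<Sum>n. hausdorff_pre k \<delta> (A n)) + e"
    unfolding ennreal_suminf_cmult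
    by (subst suminf_ennreal_eq[OF zero_le_power power_half_series]) auto
  finally show "hausdorff_pre k \<delta> (\<Union>i. A i) \<le> (\<Sum>n. hausdorff_pre k \<delta> (A n)) + e" .
qed

lemma hausdorff_outer_UN: "hausdorff_outer k (\<Union>i. A i) \<le> (\<Sum>i. hausdorff_outer k (A i))"
  unfolding hausdorff_outer_eq[of k "\<Union>i. A i"]
proof (rule SUP_least)
  fix \<delta> :: real assume "\<delta> \<in> {0<..}"
  then have "(\<Sum>i. hausdorff_pre k \<delta> (A i)) \<le> (\<Sum>i. hausdorff_outer k (A i))"
    by (intro suminf_le hausdorff_pre_le_outer) auto
  then show "hausdorff_pre k \<delta> (\<Union>i. A i) \<le> (\<Sum>i. hausdorff_outer k (A i))"
    using hausdorff_pre_UN order_trans by blast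
qed

lemma hausdorff_outer_measure_space: "outer_measure_space (Pow UNIV) (hausdorff_outer k)"
  by (auto simp: outer_measure_space_def positive_def increasing_def countably_subadditive_def
      hausdorff_outer_empty hausdorff_outer_mono hausdorff_outer_UN)

section \<open>Additivity of the Hausdorff outer measure on Borel sets\<close>

lemma hausdorff_outer_Un: "hausdorff_outer k (A \<union> B) \<le> hausdorff_outer k A + hausdorff_outer k B"
proof -
  interpret sigma_algebra UNIV "Pow UNIV :: 'a set set" by (rule sigma_algebra_Pow)
  have "subadditive (Pow UNIV) (hausdorff_outer k :: 'a set \<Rightarrow> ennreal)"
    using hausdorff_outer_measure_space countably_subadditive_subadditive
    by (auto simp: outer_measure_space_def)
  then have "hausdorff_outer k (A \<union> (B - A)) \<le> hausdorff_outer k A + hausdorff_outer k (B - A)"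
    unfolding subadditive_def by blast
  also have "\<dots> \<le> hausdorff_outer k A + hausdorff_outer k B"
    by (intro add_left_mono hausdorff_outer_mono) auto
  finally show ?thesis by (simp add: Un_Diff_cancel)
qed

text \<open>Once \<delta> is below the distance \<open>d\<close>, no set of a cover meets both
  \<open>A\<close> and \<open>B\<close>, so every cover of the union splits into one of
  \<open>A\<close> and one of \<open>B\<close>.\<close>

lemma hausdorff_outer_separated:
  assumes d: "0 < d" and sep: "\<And>a b. a \<in> A \<Longrightarrow> b \<in> B \<Longrightarrow> d \<le> dist a b"
  shows "hausdorff_outer k A + hausdorff_outer k B \<le> hausdorff_outer k (A \<union> B)"
proof -
  have pre: "hausdorff_pre k \<delta> A + hausdorff_pre k \<delta> B \<le> hausdorff_pre k \<delta> (A \<union> B)" if \<delta>: "0 < \<delta>" "\<delta> < d" for \<delta>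
    unfolding hausdorff_pre_def[of k \<delta> "A \<union> B"]
  proof (rule INF_greatest)
    fix C assume C: "C \<in> hausdorff_covers \<delta> (A \<union> B)"
    define CA where "CA j = (if C j \<inter> A \<noteq> {} then C j else {})" for j
    define CB where "CB j = (if C j \<inter> A \<noteq> {} then {} else C j)" for j
    have "CA \<in> hausdorff_covers \<delta> A"
      using C \<delta> by (auto simp: CA_def hausdorff_covers_def) blast
    moreover have "CB \<in> hausdorff_covers \<delta> B"
    proof -
      have "b \<in> (\<Union>j. CB j)" if b: "b \<in> B" for b
      proof -
        obtain j where j: "b \<in> C j" using C b by (auto simp: hausdorff_covers_def)
        have "C j \<inter> A = {}"
        proof (rule ccontr)
          assume "C j \<inter> A \<noteq> {}"
          then obtain a where a: "a \<in> C j" "a \<in> A" by blast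
          have "dist a b \<le> diameter (C j)"
            using C a j by (intro diameter_bounded_bound) (auto simp: hausdorff_covers_def)
          also have "\<dots> \<le> \<delta>" using C by (auto simp: hausdorff_covers_def)
          finally show False using sep[OF a(2) b] \<delta> by simp
        qed
        then show ?thesis using j by (auto simp: CB_def)
      qed
      then show ?thesis using C \<delta> by (auto simp: CB_def hausdorff_covers_def)
    qed
    ultimately have "hausdorff_pre k \<delta> A + hausdorff_pre k \<delta> B
        \<le> (\<Sum>j. hausdorff_weight k (CA j)) + (\<Sum>j. hausdorff_weight k (CB j))"
      unfolding hausdorff_pre_def by (intro add_mono INF_lower)
    also have "\<dots> = (\<Sum>j. hausdorff_weight k (CA j) + hausdorff_weight k (CB j))"
      by (rule suminf_add) auto
    also have "\<dots> = (\<Sum>j. hausdorff_weight k (C j))"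
      by (intro suminf_cong) (auto simp: CA_def CB_def hausdorff_weight_def)
    finally show "hausdorff_pre k \<delta> A + hausdorff_pre k \<delta> B \<le> (\<Sum>j. hausdorff_weight k (C j))" .
  qed
  \<comment> \<open>The suprema that define the two summands run over independent scales; both
    scales are lowered to a common one below \<open>d\<close>.\<close>
  have "hausdorff_pre k \<delta>1 A + hausdorff_pre k \<delta>2 B \<le> hausdorff_outer k (A \<union> B)" if "0 < \<delta>1" "0 < \<delta>2" for \<delta>1 \<delta>2
  proof -
    define \<delta> where "\<delta> = min (min \<delta>1 \<delta>2) (d / 2)"
    have \<delta>: "0 < \<delta>" "\<delta> < d" "\<delta> \<le> \<delta>1" "\<delta> \<le> \<delta>2" using that d by (auto simp: \<delta>_def)
    have "hausdorff_pre k \<delta>1 A + hausdorff_pre k \<delta>2 B \<le> hausdorff_pre k \<delta> A + hausdorff_pre k \<delta> B"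
      using \<delta> by (intro add_mono hausdorff_pre_antimono)
    also have "\<dots> \<le> hausdorff_pre k \<delta> (A \<union> B)" by (rule pre[OF \<delta>(1,2)])
    also have "\<dots> \<le> hausdorff_outer k (A \<union> B)" by (rule hausdorff_pre_le_outer[OF \<delta>(1)])
    finally show ?thesis .
  qed
  then show ?thesis
    unfolding hausdorff_outer_eq[of k A] hausdorff_outer_eq[of k B]
    by (subst ennreal_SUP_add_left[symmetric], simp)
       (auto simp: ennreal_SUP_add_right intro!: SUP_least)
qed

lemma hausdorff_outer_separated_sum:
  fixes R :: "nat \<Rightarrow> 'a::euclidean_space set"
  assumes "\<And>i j. i < j \<Longrightarrow> j < n \<Longrightarrow> \<exists>d>0. \<forall>a\<in>R i. \<forall>b\<in>R j. d \<le> dist a b"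
  shows "(\<Sum>i<n. hausdorff_outer k (R i)) \<le> hausdorff_outer k (\<Union>i<n. R i)"
  using assms
proof (induction n)
  case 0
  then show ?case by simp
next
  case (Suc n)
  have "\<forall>i\<in>{..<n}. \<exists>d>0. \<forall>a\<in>R i. \<forall>b\<in>R n. d \<le> dist a b" using Suc.prems by auto
  then obtain \<delta> where \<delta>: "\<And>i. i < n \<Longrightarrow> \<delta> i > 0" "\<And>i a b. i < n \<Longrightarrow> a \<in> R i \<Longrightarrow> b \<in> R n \<Longrightarrow> \<delta> i \<le> dist a b"
    unfolding bchoice_iff by auto
  define d where "d = Min (insert 1 (\<delta> ` {..<n}))"
  have d: "d > 0" "\<And>i. i < n \<Longrightarrow> d \<le> \<delta> i" using \<delta>(1) by (auto simp: d_def)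
  have "(\<Sum>i<Suc n. hausdorff_outer k (R i)) \<le> hausdorff_outer k (\<Union>i<n. R i) + hausdorff_outer k (R n)"
    using Suc.IH Suc.prems by (simp add: add_right_mono)
  also have "\<dots> \<le> hausdorff_outer k ((\<Union>i<n. R i) \<union> R n)"
    using d(1)
  proof (rule hausdorff_outer_separated)
    fix a b assume "a \<in> (\<Union>i<n. R i)" and b: "b \<in> R n"
    then obtain i where i: "i < n" "a \<in> R i" by blast
    from d(2)[OF i(1)] \<delta>(2)[OF i b] show "d \<le> dist a b" by simp
  qed
  also have "(\<Union>i<n. R i) \<union> R n = (\<Union>i<Suc n. R i)" by (auto simp: lessThan_Suc)
  finally show ?case .
qed

text \<open>Caratheodory's criterion: consecutive shells around a closed set touch, but the shells of even
  index, and those of odd index, have positive distance from each other.\<close>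

lemma hausdorff_outer_closed:
  assumes F: "closed F"
  shows "hausdorff_outer k (F \<inter> X) + hausdorff_outer k (X - F) \<le> hausdorff_outer k X"
proof (cases "F = {} \<or> hausdorff_outer k X = top")
  case True
  then show ?thesis by (auto simp: hausdorff_outer_empty)
next
  case False
  then have ne: "F \<noteq> {}" and fin: "hausdorff_outer k X < top" by (auto simp: less_top)
  \<comment> \<open>\<open>A j\<close> keeps the distance \<open>1 / (j + 1)\<close> from
    \<open>F\<close>, and \<open>R j\<close> is the shell between \<open>A j\<close> and
    \<open>A (Suc j)\<close>. Additivity on the separated sets \<open>F \<inter> X\<close> and
    \<open>A j\<close> gives the claim up to the shells with index at least
    \<open>j\<close>.\<close>
  define A where "A j = {x \<in> X. 1 / real (Suc j) \<le> infdist x F}" for j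
  define R where "R j = A (Suc j) - A j" for j
  have fin': "hausdorff_outer k S < top" if "S \<subseteq> X" for S
    using hausdorff_outer_mono[OF that] fin by (rule order_le_less_trans)
  have inf: "infdist x F \<le> infdist y F + dist x y" for x y by (rule infdist_triangle)
  have sepA: "hausdorff_outer k (F \<inter> X) + hausdorff_outer k (A j) \<le> hausdorff_outer k X" for j
  proof -
    have "hausdorff_outer k (F \<inter> X) + hausdorff_outer k (A j) \<le> hausdorff_outer k ((F \<inter> X) \<union> A j)"
    proof (rule hausdorff_outer_separated)
      fix a b assume "a \<in> F \<inter> X" "b \<in> A j"
      then show "1 / real (Suc j) \<le> dist a b" using inf[of b a] by (auto simp: A_def dist_commute)
    qed simp
    also have "\<dots> \<le> hausdorff_outer k X" by (rule hausdorff_outer_mono) (auto simp: A_def)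
    finally show ?thesis .
  qed
  have sepR: "\<exists>d>0. \<forall>a\<in>R i. \<forall>b\<in>R j. d \<le> dist a b" if "i + 2 \<le> j" for i j
  proof -
    define d where "d = 1 / real (Suc (Suc i)) - 1 / real (Suc j)"
    have "1 / real (Suc j) < 1 / real (Suc (Suc i))" using that by (intro divide_strict_left_mono) auto
    then have "d > 0" by (simp add: d_def)
    moreover have "d \<le> dist a b" if "a \<in> R i" "b \<in> R j" for a b
      using that inf[of a b] by (auto simp: R_def A_def d_def)
    ultimately show ?thesis by blast
  qed
  \<comment> \<open>The parity is \<open>c\<close>. Each of the two families has a total of at most
    the outer measure of \<open>X\<close>, which is finite here; hence the shells form a convergent
    series, and the error of stopping at \<open>A j\<close> tends to 0.\<close>
  have half: "(\<Sum>i<n. hausdorff_outer k (R (2 * i + c))) \<le> hausdorff_outer k X" for n c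
  proof -
    have "(\<Sum>i<n. hausdorff_outer k (R (2 * i + c))) \<le> hausdorff_outer k (\<Union>i<n. R (2 * i + c))"
      by (rule hausdorff_outer_separated_sum) (auto intro: sepR)
    also have "\<dots> \<le> hausdorff_outer k X" by (rule hausdorff_outer_mono) (auto simp: R_def A_def)
    finally show ?thesis .
  qed
  define r where "r j = enn2real (hausdorff_outer k (R j))" for j
  have r: "hausdorff_outer k (R j) = ennreal (r j)" "0 \<le> r j" for j
  proof -
    have "R j \<subseteq> X" by (auto simp: R_def A_def)
    from fin'[OF this] show "hausdorff_outer k (R j) = ennreal (r j)" "0 \<le> r j" by (auto simp: r_def)
  qed
  define x where "x = enn2real (hausdorff_outer k X)"
  have x: "hausdorff_outer k X = ennreal x" "0 \<le> x" using fin by (auto simp: x_def)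
  have half': "(\<Sum>i<n. r (2 * i + c)) \<le> x" for n c
    using half[of c n] by (simp add: r x sum_nonneg)
  have sum2: "(\<Sum>i<2 * n. r i) = (\<Sum>i<n. r (2 * i + 0)) + (\<Sum>i<n. r (2 * i + 1))" for n
    by (induction n) auto
  have "summable r"
  proof (rule summableI_nonneg_bounded)
    fix n
    have "(\<Sum>i<n. r i) \<le> (\<Sum>i<2 * n. r i)" using r(2) by (intro sum_mono2) auto
    also have "\<dots> \<le> 2 * x" using sum2[of n] half'[of 0 n] half'[of 1 n] by simp
    finally show "(\<Sum>i<n. r i) \<le> 2 * x" .
  qed (rule r(2))
  have cover: "X - F \<subseteq> A j \<union> (\<Union>i. R (i + j))" for j
  proof
    fix z assume z: "z \<in> X - F"
    then have "0 < infdist z F" using F ne by (simp add: infdist_pos_not_in_closed)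
    then obtain m where "inverse (real (Suc m)) < infdist z F" using reals_Archimedean by blast
    then have zm: "z \<in> A m" using z by (auto simp: A_def inverse_eq_divide)
    show "z \<in> A j \<union> (\<Union>i. R (i + j))"
    proof (rule ccontr)
      assume not: "z \<notin> A j \<union> (\<Union>i. R (i + j))"
      have "z \<notin> A (i + j)" for i
        using not by (induction i) (auto simp: R_def)
      moreover have "z \<in> A (m + j)"
      proof -
        have "1 / real (Suc (m + j)) \<le> 1 / real (Suc m)" by (intro divide_left_mono) auto
        then show ?thesis using zm by (auto simp: A_def)
      qed
      ultimately show False by blast
    qed
  qed
  have tail: "hausdorff_outer k (X - F) \<le> hausdorff_outer k (A j) + ennreal (\<Sum>i. r (i + j))" for j
  proof -
    have "hausdorff_outer k (\<Union>i. R (i + j)) \<le> (\<Sum>i. hausdorff_outer k (R (i + j)))"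
      by (rule hausdorff_outer_UN)
    also have "\<dots> = ennreal (\<Sum>i. r (i + j))"
      unfolding r(1) using r(2) \<open>summable r\<close> by (intro suminf_ennreal2) (auto simp: summable_iff_shift)
    finally have *: "hausdorff_outer k (\<Union>i. R (i + j)) \<le> ennreal (\<Sum>i. r (i + j))" .
    have "hausdorff_outer k (X - F) \<le> hausdorff_outer k (A j \<union> (\<Union>i. R (i + j)))"
      by (rule hausdorff_outer_mono[OF cover])
    also have "\<dots> \<le> hausdorff_outer k (A j) + hausdorff_outer k (\<Union>i. R (i + j))" by (rule hausdorff_outer_Un)
    finally show ?thesis using * by (meson add_left_mono order_trans)
  qed
  show ?thesis
  proof (rule ennreal_le_epsilon)
    fix e :: real assume "0 < e"
    then obtain j where "norm (\<Sum>i. r (i + j)) < e"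
      using suminf_exist_split[OF _ \<open>summable r\<close>] by blast
    then have "ennreal (\<Sum>i. r (i + j)) \<le> ennreal e" by (intro ennreal_leI) auto
    then have "hausdorff_outer k (X - F) \<le> hausdorff_outer k (A j) + ennreal e"
      using tail[of j] by (meson add_left_mono order_trans)
    then have "hausdorff_outer k (F \<inter> X) + hausdorff_outer k (X - F)
        \<le> (hausdorff_outer k (F \<inter> X) + hausdorff_outer k (A j)) + ennreal e"
      by (simp add: add.assoc add_left_mono)
    also have "\<dots> \<le> hausdorff_outer k X + ennreal e" by (intro add_right_mono sepA)
    finally show "hausdorff_outer k (F \<inter> X) + hausdorff_outer k (X - F) \<le> hausdorff_outer k X + ennreal e" .
  qed
qed

text \<open>\<open>measure_of\<close> falls back to the zero measure unless the given function is a
  measure on the sigma algebra. Closed sets belong to the Caratheodory system by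
  \<open>hausdorff_outer_closed\<close>, hence so do all Borel sets, and the outer measure is a
  measure there.\<close>

lemma emeasure_hausdorff:
  assumes "A \<in> sets borel"
  shows "emeasure (hausdorff k) A = hausdorff_outer k A"
proof -
  interpret P: sigma_algebra UNIV "Pow UNIV :: 'a set set" by (rule sigma_algebra_Pow)
  let ?L = "lambda_system UNIV (Pow UNIV) (hausdorff_outer k :: 'a set \<Rightarrow> ennreal)"
  have L: "measure_space UNIV ?L (hausdorff_outer k)"
    by (rule P.caratheodory_lemma[OF hausdorff_outer_measure_space])
  have "F \<in> ?L" if "closed F" for F
  proof -
    have "hausdorff_outer k (F \<inter> X) + hausdorff_outer k ((UNIV - F) \<inter> X) = hausdorff_outer k X" for X
    proof (rule antisym)
      show "hausdorff_outer k (F \<inter> X) + hausdorff_outer k ((UNIV - F) \<inter> X) \<le> hausdorff_outer k X"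
        using hausdorff_outer_closed[OF that, of k X] by (simp add: Diff_eq Int_commute)
      have "F \<inter> X \<union> (UNIV - F) \<inter> X = X" by auto
      then show "hausdorff_outer k X \<le> hausdorff_outer k (F \<inter> X) + hausdorff_outer k ((UNIV - F) \<inter> X)"
        using hausdorff_outer_Un[of k "F \<inter> X" "(UNIV - F) \<inter> X"] by simp
    qed
    then show ?thesis by (simp add: lambda_system_def)
  qed
  then have "Collect closed \<subseteq> ?L" by blast
  moreover have "sigma_algebra UNIV ?L" using L by (simp only: measure_space_def)
  ultimately have "sigma_sets UNIV (Collect closed) \<subseteq> ?L" by (rule sigma_algebra.sigma_sets_subset[rotated])
  then have sub: "sets (borel :: 'a measure) \<subseteq> ?L"
    by (simp add: borel_eq_closed)
  have "measure_space UNIV (sets (borel :: 'a measure)) (hausdorff_outer k)"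
    using measure_down[OF L _ sub] sets.sigma_algebra_axioms[of "borel :: 'a measure"] by simp
  then show ?thesis
    using assms sets.sigma_sets_eq[of "borel :: 'a measure"]
    by (simp add: hausdorff_def emeasure_measure_of_conv)
qed

lemma sets_hausdorff [simp]: "sets (hausdorff k :: 'a::euclidean_space measure) = sets borel"
  using sets.sigma_sets_eq[of "borel :: 'a measure"] by (simp add: hausdorff_def sets_measure_of_conv)

lemma space_hausdorff [simp]: "space (hausdorff k :: 'a::euclidean_space measure) = UNIV"
  by (simp add: hausdorff_def space_measure_of_conv)

text \<open>The factor could be removed by the isodiametric inequality.\<close>

lemma emeasure_le_hausdorff_isometric:
  fixes h :: "'b::euclidean_space \<Rightarrow> 'a::euclidean_space"
  assumes h: "\<And>y z. dist (h y) (h z) = dist y z" and B: "h ` B \<subseteq> A"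
  shows "emeasure lborel B \<le> ennreal (2 ^ DIM('b)) * hausdorff_outer (DIM('b)) A"
proof -
  have "emeasure lborel B \<le> ennreal (2 ^ DIM('b)) * (\<Sum>j. hausdorff_weight (DIM('b)) (C j))"
    if C: "C \<in> hausdorff_covers 1 A" for C
  proof -
    have "\<exists>S. h -` C j \<subseteq> S \<and> S \<in> sets lborel \<and> emeasure lborel S \<le> ennreal (2 ^ DIM('b)) * hausdorff_weight (DIM('b)) (C j)" for j
    proof (cases "h -` C j = {}")
      case True
      then show ?thesis by (intro exI[of _ "{}"]) auto
    next
      case False
      then obtain y where y: "h y \<in> C j" by blast
      have b: "bounded (C j)" using C by (auto simp: hausdorff_covers_def)
      \<comment> \<open>A set lies in the closed ball about any of its points whose radius is its
        diameter, whereas its weight uses half the diameter; this costs the factor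
        \<open>2 ^ DIM('b)\<close>.\<close>
      have sub: "h -` C j \<subseteq> cball y (diameter (C j))"
      proof
        fix x assume "x \<in> h -` C j"
        then have "dist (h y) (h x) \<le> diameter (C j)" using diameter_bounded_bound[OF b y] by simp
        then show "x \<in> cball y (diameter (C j))" by (simp only: h mem_cball)
      qed
      have "emeasure lborel (cball y (diameter (C j))) = ennreal (unit_ball_vol (real DIM('b)) * diameter (C j) ^ DIM('b))"
        by (rule emeasure_cball) (rule diameter_ge_0[OF b])
      also have "\<dots> = ennreal (2 ^ DIM('b) * (unit_ball_vol (real DIM('b)) * (diameter (C j) / 2) ^ DIM('b)))"
        by (simp add: power_divide)
      also have "\<dots> = ennreal (2 ^ DIM('b)) * hausdorff_weight (DIM('b)) (C j)"
        using y by (auto simp: hausdorff_weight_def ennreal_mult' )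
      finally show ?thesis using sub by (intro exI[of _ "cball y (diameter (C j))"]) auto
    qed
    then obtain S where S: "\<And>j. h -` C j \<subseteq> S j" "\<And>j. S j \<in> sets lborel"
      "\<And>j. emeasure lborel (S j) \<le> ennreal (2 ^ DIM('b)) * hausdorff_weight (DIM('b)) (C j)" by metis
    have "B \<subseteq> (\<Union>j. S j)" 
    proof
      fix y assume "y \<in> B"
      then have "h y \<in> (\<Union>j. C j)" using B C unfolding hausdorff_covers_def by blast
      then obtain j where "y \<in> h -` C j" by blast
      then show "y \<in> (\<Union>j. S j)" using S(1) by blast
    qed
    then have "emeasure lborel B \<le> emeasure lborel (\<Union>j. S j)" using S(2) by (intro emeasure_mono) auto
    also have "\<dots> \<le> (\<Sum>j. emeasure lborel (S j))" using S(2) by (intro emeasure_subadditive_countably) auto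
    also have "\<dots> \<le> (\<Sum>j. ennreal (2 ^ DIM('b)) * hausdorff_weight (DIM('b)) (C j))"
      by (intro suminf_le S(3)) auto
    finally show ?thesis by simp
  qed
  then have "emeasure lborel B / ennreal (2 ^ DIM('b)) \<le> hausdorff_pre (DIM('b)) 1 A"
    unfolding hausdorff_pre_def by (intro INF_greatest divide_le_posI_ennreal) auto
  then have le: "ennreal (2 ^ DIM('b)) * (emeasure lborel B / ennreal (2 ^ DIM('b)))
      \<le> ennreal (2 ^ DIM('b)) * hausdorff_pre (DIM('b)) 1 A"
    by (rule mult_left_mono) simp
  have "emeasure lborel B = ennreal (2 ^ DIM('b)) * (emeasure lborel B / ennreal (2 ^ DIM('b)))"
    unfolding ennreal_times_divide mult.commute[of "ennreal (2 ^ DIM('b))"]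
    by (rule mult_divide_eq_ennreal[symmetric]) auto
  also have "\<dots> \<le> ennreal (2 ^ DIM('b)) * hausdorff_pre (DIM('b)) 1 A" by (rule le)
  also have "\<dots> \<le> ennreal (2 ^ DIM('b)) * hausdorff_outer (DIM('b)) A"
    by (intro mult_left_mono hausdorff_pre_le_outer) auto
  finally show ?thesis .
qed

text \<open>The image of Lebesgue measure under an isometry is at most a multiple of Hausdorff
  measure, so integrals of functions pulled back from the surface are controlled. This brings the
  trace of a lifting from the boundary of a subdomain to \<gamma>, as a square integrable function
  on \<open>cut\<close>.\<close>

proposition Lp_surface_isometric:
  fixes h :: "'b::euclidean_space \<Rightarrow> 'a::euclidean_space" and t :: "'a \<Rightarrow> real"
  assumes dim: "DIM('a) = DIM('b) + 1" and h: "\<And>y z. dist (h y) (h z) = dist y z"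
    and S: "S \<in> sets borel" and U: "U \<in> sets borel" "h ` U \<subseteq> S" and t: "t \<in> Lp p (surface_on S)"
  shows "(\<lambda>y. t (h y)) \<in> Lp p (lebesgue_on U)"
proof -
  have k: "DIM('a) - 1 = DIM('b)" using dim by simp
  \<comment> \<open>\<open>t\<close> is only measurable on \<open>S\<close>; its extension by 0 is
    Borel on the whole space and can be composed with \<open>h\<close>.\<close>
  define \<tau> where "\<tau> x = indicator S x * t x" for x
  have "t \<in> borel_measurable (restrict_space (hausdorff (DIM('b))) S)"
    using LpD(1)[OF t] unfolding surface_on_def k .
  then have "\<tau> \<in> borel_measurable (hausdorff (DIM('b)))"
    using S by (subst (asm) borel_measurable_restrict_space_iff) (auto simp: \<tau>_def[abs_def])
  then have [measurable]: "\<tau> \<in> borel_measurable borel" by (simp cong: measurable_cong_sets)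
  have [measurable]: "h \<in> borel_measurable borel"
    using h by (intro borel_measurable_continuous_onI) (auto simp: continuous_on_iff)
  have "(\<integral>\<^sup>+y. ennreal (norm (t (h y)) powr p) \<partial>lebesgue_on U) = (\<integral>\<^sup>+y. ennreal (norm (t (h y)) powr p) * indicator U y \<partial>lebesgue)"
    using U by (intro nn_integral_restrict_space) auto
  also have "\<dots> \<le> (\<integral>\<^sup>+y. ennreal (norm (\<tau> (h y)) powr p) \<partial>lebesgue)"
    using U by (intro nn_integral_mono) (auto simp: \<tau>_def indicator_def)
  also have "\<dots> = (\<integral>\<^sup>+y. ennreal (norm (\<tau> (h y)) powr p) \<partial>lborel)"
    by (rule nn_integral_completion)
  also have "\<dots> = (\<integral>\<^sup>+x. ennreal (norm (\<tau> x) powr p) \<partial>distr lborel borel h)"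
    by (subst nn_integral_distr) auto
  also have "\<dots> \<le> (\<integral>\<^sup>+x. ennreal (norm (\<tau> x) powr p) \<partial>scale_measure (ennreal (2 ^ DIM('b))) (hausdorff (DIM('b))))"
  proof (rule nn_integral_mono_measure)
    show "distr lborel borel h \<le> scale_measure (ennreal (2 ^ DIM('b))) (hausdorff (DIM('b)))"
    proof -
      have "emeasure (distr lborel borel h) A \<le> emeasure (scale_measure (ennreal (2 ^ DIM('b))) (hausdorff (DIM('b)))) A" for A
      proof (cases "A \<in> sets borel")
        case True
        have "emeasure lborel (h -` A) \<le> ennreal (2 ^ DIM('b)) * hausdorff_outer (DIM('b)) A"
          using h by (rule emeasure_le_hausdorff_isometric) auto
        then show ?thesis using True by (simp add: emeasure_distr emeasure_hausdorff)
      qed (simp add: emeasure_notin_sets)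
      then show ?thesis by (simp add: le_measure_iff le_fun_def space_scale_measure)
    qed
  qed simp
  also have "\<dots> = ennreal (2 ^ DIM('b)) * (\<integral>\<^sup>+x. ennreal (norm (\<tau> x) powr p) \<partial>hausdorff (DIM('b)))"
    by (rule nn_integral_scale_measure) (simp cong: measurable_cong_sets)
  also have "(\<integral>\<^sup>+x. ennreal (norm (\<tau> x) powr p) \<partial>hausdorff (DIM('b)))
      \<le> (\<integral>\<^sup>+x. ennreal (norm (t x) powr p) * indicator S x \<partial>hausdorff (DIM('b)))"
    by (intro nn_integral_mono) (auto simp: \<tau>_def indicator_def)
  also have "\<dots> = (\<integral>\<^sup>+x. ennreal (norm (t x) powr p) \<partial>surface_on S)"
    unfolding surface_on_def k using S by (intro nn_integral_restrict_space[symmetric]) auto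
  finally have "(\<integral>\<^sup>+y. ennreal (norm (t (h y)) powr p) \<partial>lebesgue_on U)
      \<le> ennreal (2 ^ DIM('b)) * (\<integral>\<^sup>+x. ennreal (norm (t x) powr p) \<partial>surface_on S)"
    by (simp add: mult_left_mono)
  also have "\<dots> < \<infinity>"
    using LpD(2)[OF t] by (simp add: integrable_iff_bounded ennreal_mult_less_top)
  finally have fin: "(\<integral>\<^sup>+y. ennreal (norm (t (h y)) powr p) \<partial>lebesgue_on U) < \<infinity>" .
  have "(\<lambda>y. \<tau> (h y)) \<in> borel_measurable (lebesgue_on U)"
    by (intro measurable_restrict_space1 measurable_completion) simp
  then have "(\<lambda>y. t (h y)) \<in> borel_measurable (lebesgue_on U)"
    by (rule measurable_cong[THEN iffD1, rotated]) (use U in \<open>auto simp: \<tau>_def indicator_def\<close>)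
  moreover from this fin have "integrable (lebesgue_on U) (\<lambda>y. norm (t (h y)) powr p)"
    by (intro integrableI_bounded) auto
  ultimately show ?thesis by (simp add: Lp_def)
qed

section \<open>Antiderivatives along a direction\<close>

text \<open>Jensen's inequality for the cube, from the supporting line at the mean \<open>m\<close>
  of \<open>\<bar>f t\<bar>\<close> over the interval. The factor arises from
  \<open>(R * m) ^ 3 = R\<^sup>2 * (R * m ^ 3)\<close>.\<close>

lemma integral_cube_le:
  fixes f :: "real \<Rightarrow> real"
  assumes R: "0 < R" and f: "f \<in> borel_measurable borel"
    and int: "integrable lborel (\<lambda>t. indicator {0..R} t * \<bar>f t\<bar> ^ 3)"
  shows "\<bar>\<integral>t. indicator {0..R} t * f t \<partial>lborel\<bar> ^ 3 \<le> R\<^sup>2 * (\<integral>t. indicator {0..R} t * \<bar>f t\<bar> ^ 3 \<partial>lborel)"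
proof -
  have ind: "integrable lborel (indicat_real {0..R})"
    "(\<integral>t. indicat_real {0..R} t \<partial>lborel) = R" using R by auto
  have int1: "integrable lborel (\<lambda>t. indicator {0..R} t * \<bar>f t\<bar>)"
  proof (rule Bochner_Integration.integrable_bound)
    show "integrable lborel (\<lambda>t. indicat_real {0..R} t + indicator {0..R} t * \<bar>f t\<bar> ^ 3)"
      using ind int by simp
    have "a \<le> 1 + a ^ 3" if "0 \<le> a" for a :: real
    proof (cases "a \<le> 1")
      case True
      then show ?thesis using that by (simp add: add_increasing2)
    next
      case False
      then have "a ^ 1 \<le> a ^ 3" by (intro power_increasing) auto
      then show ?thesis by simp
    qed
    then show "AE t in lborel. norm (indicator {0..R} t * \<bar>f t\<bar>) \<le> norm (indicat_real {0..R} t + indicator {0..R} t * \<bar>f t\<bar> ^ 3)"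
      by (auto simp: indicator_def)
  qed (use f in simp)
  define m where "m = (\<integral>t. indicator {0..R} t * \<bar>f t\<bar> \<partial>lborel) / R"
  have m: "0 \<le> m" using R by (auto simp: m_def intro!: divide_nonneg_nonneg integral_nonneg_AE)
  have mR: "(\<integral>t. indicator {0..R} t * \<bar>f t\<bar> \<partial>lborel) = R * m" using R by (simp add: m_def)
  have pt: "m ^ 3 + 3 * m\<^sup>2 * (a - m) \<le> a ^ 3" if "0 \<le> a" for a :: real
  proof -
    have "0 \<le> (a - m)\<^sup>2 * (a + 2 * m)" using that m by simp
    then show ?thesis by (simp add: power2_eq_square power3_eq_cube algebra_simps)
  qed
  have "R * m ^ 3 = (\<integral>t. (m ^ 3 - 3 * m\<^sup>2 * m) * indicator {0..R} t + 3 * m\<^sup>2 * (indicator {0..R} t * \<bar>f t\<bar>) \<partial>lborel)"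
  proof -
    have "(\<integral>t. (m ^ 3 - 3 * m\<^sup>2 * m) * indicator {0..R} t + 3 * m\<^sup>2 * (indicator {0..R} t * \<bar>f t\<bar>) \<partial>lborel)
        = (m ^ 3 - 3 * m\<^sup>2 * m) * R + 3 * m\<^sup>2 * (R * m)"
      using R ind(1) int1 mR by simp
    then show ?thesis by (simp add: power2_eq_square power3_eq_cube algebra_simps)
  qed
  also have "\<dots> \<le> (\<integral>t. indicator {0..R} t * \<bar>f t\<bar> ^ 3 \<partial>lborel)"
  proof (rule integral_mono)
    show "integrable lborel (\<lambda>t. (m ^ 3 - 3 * m\<^sup>2 * m) * indicator {0..R} t + 3 * m\<^sup>2 * (indicator {0..R} t * \<bar>f t\<bar>))"
      by (intro Bochner_Integration.integrable_add integrable_mult_right ind int1)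
    show "(m ^ 3 - 3 * m\<^sup>2 * m) * indicator {0..R} t + 3 * m\<^sup>2 * (indicator {0..R} t * \<bar>f t\<bar>) \<le> indicator {0..R} t * \<bar>f t\<bar> ^ 3" for t
      using pt[OF abs_ge_zero[of "f t"]] by (auto simp: indicator_def algebra_simps)
  qed (rule int)
  finally have "R\<^sup>2 * (R * m ^ 3) \<le> R\<^sup>2 * (\<integral>t. indicator {0..R} t * \<bar>f t\<bar> ^ 3 \<partial>lborel)"
    by (intro mult_left_mono) auto
  moreover have "\<bar>\<integral>t. indicator {0..R} t * f t \<partial>lborel\<bar> \<le> R * m"
    using integral_abs_bound[of lborel "\<lambda>t. indicator {0..R} t * f t"] mR by (simp add: abs_mult)
  then have "\<bar>\<integral>t. indicator {0..R} t * f t \<partial>lborel\<bar> ^ 3 \<le> (R * m) ^ 3"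
    by (intro power_mono) auto
  ultimately show ?thesis by (simp add: power_mult_distrib power2_eq_square power3_eq_cube ac_simps)
qed

lemma lborel_shift:
  fixes f :: "'a::euclidean_space \<Rightarrow> real"
  assumes "f \<in> borel_measurable borel"
  shows "(\<integral>x. f (x + c) \<partial>lborel) = (\<integral>x. f x \<partial>lborel)"
    and "(\<integral>\<^sup>+x. ennreal (f (x + c)) \<partial>lborel) = (\<integral>\<^sup>+x. ennreal (f x) \<partial>lborel)"
proof -
  have e: "lborel = distr lborel borel ((+) c)" by (rule lborel_distr_plus[symmetric])
  show "(\<integral>x. f (x + c) \<partial>lborel) = (\<integral>x. f x \<partial>lborel)"
    using assms by (subst (2) e) (simp add: integral_distr add.commute)
  show "(\<integral>\<^sup>+x. ennreal (f (x + c)) \<partial>lborel) = (\<integral>\<^sup>+x. ennreal (f x) \<partial>lborel)"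
    using assms by (subst (2) e) (simp add: nn_integral_distr add.commute)
qed

text \<open>The length \<open>R\<close> is fixed instead of integrating up to the boundary. For
  \<open>s\<close> extended by 0 from a domain of diameter below \<open>R\<close> this is, at points
  of the domain, the full primitive from the outside. The operator is an integral of translations,
  which makes \<open>L^3\<close> bounds and the adjoint easy.\<close>

definition line_primitive :: "'a::euclidean_space \<Rightarrow> real \<Rightarrow> ('a \<Rightarrow> real) \<Rightarrow> 'a \<Rightarrow> real" where
  "line_primitive e R s x = (\<integral>t. indicator {0..R} t * s (x - t *\<^sub>R e) \<partial>lborel)"

context
  fixes e :: "'a::euclidean_space" and R :: real and s :: "'a \<Rightarrow> real"
  assumes R: "0 < R" and s [measurable]: "s \<in> borel_measurable borel"
    and s3: "integrable lborel (\<lambda>x. \<bar>s x\<bar> ^ 3)" and s1: "integrable lborel s"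
begin

lemma line_primitive_measurable: "line_primitive e R s \<in> borel_measurable borel"
  unfolding line_primitive_def[abs_def] by measurable

text \<open>Jensen along each line, then Tonelli and translation invariance:
  \<open>R\<^sup>2\<close> comes from \<open>integral_cube_le\<close>, one more \<open>R\<close>
  from the length of the interval.\<close>

lemma line_primitive_cube:
  shows "integrable lborel (\<lambda>x. \<bar>line_primitive e R s x\<bar> ^ 3)"
    and "(\<integral>x. \<bar>line_primitive e R s x\<bar> ^ 3 \<partial>lborel) \<le> R ^ 3 * (\<integral>x. \<bar>s x\<bar> ^ 3 \<partial>lborel)"
proof -
  note [measurable] = line_primitive_measurable
  define S where "S = (\<integral>x. \<bar>s x\<bar> ^ 3 \<partial>lborel)"
  have S: "0 \<le> S" by (auto simp: S_def intro!: integral_nonneg_AE)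
  have sh: "(\<integral>\<^sup>+x. ennreal (\<bar>s (x - t *\<^sub>R e)\<bar> ^ 3) \<partial>lborel) = ennreal S" for t
    using lborel_shift(2)[of "\<lambda>x. \<bar>s x\<bar> ^ 3" "- (t *\<^sub>R e)"] nn_integral_eq_integral[OF s3] by (simp add: S_def)
  have "(\<integral>\<^sup>+x. \<integral>\<^sup>+t. ennreal (indicator {0..R} t * \<bar>s (x - t *\<^sub>R e)\<bar> ^ 3) \<partial>lborel \<partial>lborel)
      = (\<integral>\<^sup>+t. \<integral>\<^sup>+x. ennreal (indicator {0..R} t * \<bar>s (x - t *\<^sub>R e)\<bar> ^ 3) \<partial>lborel \<partial>lborel)"
    by (rule lborel_pair.Fubini') measurable
  also have "\<dots> = (\<integral>\<^sup>+t. ennreal S * indicator {0..R} t \<partial>lborel)"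
  proof (intro nn_integral_cong)
    fix t :: real
    show "(\<integral>\<^sup>+x. ennreal (indicator {0..R} t * \<bar>s (x - t *\<^sub>R e)\<bar> ^ 3) \<partial>lborel) = ennreal S * indicator {0..R} t"
      using sh[of t] by (cases "t \<in> {0..R}") simp_all
  qed
  also have "\<dots> = ennreal (S * R)" using S R by (simp add: nn_integral_cmult ennreal_mult'')
  finally have tot: "(\<integral>\<^sup>+x. \<integral>\<^sup>+t. ennreal (indicator {0..R} t * \<bar>s (x - t *\<^sub>R e)\<bar> ^ 3) \<partial>lborel \<partial>lborel) = ennreal (S * R)" .
  then have "AE x in lborel. (\<integral>\<^sup>+t. ennreal (indicator {0..R} t * \<bar>s (x - t *\<^sub>R e)\<bar> ^ 3) \<partial>lborel) \<noteq> \<infinity>"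
    by (intro nn_integral_PInf_AE) auto
  then have "AE x in lborel. ennreal (\<bar>line_primitive e R s x\<bar> ^ 3)
      \<le> ennreal (R\<^sup>2) * (\<integral>\<^sup>+t. ennreal (indicator {0..R} t * \<bar>s (x - t *\<^sub>R e)\<bar> ^ 3) \<partial>lborel)"
  proof eventually_elim
    case (elim x)
    then have int: "integrable lborel (\<lambda>t. indicator {0..R} t * \<bar>s (x - t *\<^sub>R e)\<bar> ^ 3)"
      by (intro integrableI_bounded) (auto simp: less_top)
    have "\<bar>line_primitive e R s x\<bar> ^ 3 \<le> R\<^sup>2 * (\<integral>t. indicator {0..R} t * \<bar>s (x - t *\<^sub>R e)\<bar> ^ 3 \<partial>lborel)"
      unfolding line_primitive_def by (rule integral_cube_le[OF R _ int]) measurable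
    then have "ennreal (\<bar>line_primitive e R s x\<bar> ^ 3) \<le> ennreal (R\<^sup>2 * (\<integral>t. indicator {0..R} t * \<bar>s (x - t *\<^sub>R e)\<bar> ^ 3 \<partial>lborel))"
      by (rule ennreal_leI)
    also have "\<dots> = ennreal (R\<^sup>2) * (\<integral>\<^sup>+t. ennreal (indicator {0..R} t * \<bar>s (x - t *\<^sub>R e)\<bar> ^ 3) \<partial>lborel)"
      by (subst nn_integral_eq_integral[OF int]) (auto simp: ennreal_mult')
    finally show ?case .
  qed
  then have "(\<integral>\<^sup>+x. ennreal (\<bar>line_primitive e R s x\<bar> ^ 3) \<partial>lborel)
      \<le> (\<integral>\<^sup>+x. ennreal (R\<^sup>2) * (\<integral>\<^sup>+t. ennreal (indicator {0..R} t * \<bar>s (x - t *\<^sub>R e)\<bar> ^ 3) \<partial>lborel) \<partial>lborel)"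
    by (rule nn_integral_mono_AE)
  also have "\<dots> = ennreal (R\<^sup>2) * ennreal (S * R)" by (subst nn_integral_cmult) (simp_all add: tot)
  also have "\<dots> = ennreal (R ^ 3 * S)"
    using R S by (simp add: power2_eq_square power3_eq_cube ac_simps flip: ennreal_mult)
  finally have le: "(\<integral>\<^sup>+x. ennreal (\<bar>line_primitive e R s x\<bar> ^ 3) \<partial>lborel) \<le> ennreal (R ^ 3 * S)" .
  show int: "integrable lborel (\<lambda>x. \<bar>line_primitive e R s x\<bar> ^ 3)"
    using le by (intro integrableI_bounded) (auto simp: less_top[symmetric] top_unique)
  show "(\<integral>x. \<bar>line_primitive e R s x\<bar> ^ 3 \<partial>lborel) \<le> R ^ 3 * (\<integral>x. \<bar>s x\<bar> ^ 3 \<partial>lborel)"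
    using le R S nn_integral_eq_integral[OF int] by (simp add: S_def)
qed

text \<open>Fubini and a translation move the shift from \<open>s\<close> to \<open>g\<close>.
  Integrability on the product holds because \<open>s\<close> is in \<open>L^1\<close>,
  \<open>g\<close> is bounded and the interval is finite.\<close>

lemma line_primitive_adjoint:
  fixes g :: "'a \<Rightarrow> real"
  assumes g [measurable]: "g \<in> borel_measurable borel" and B: "\<And>x. \<bar>g x\<bar> \<le> B"
  shows "(\<integral>x. line_primitive e R s x * g x \<partial>lborel)
    = (\<integral>y. s y * (\<integral>t. indicator {0..R} t * g (y + t *\<^sub>R e) \<partial>lborel) \<partial>lborel)"
proof -
  have B0: "0 \<le> B" using B[of 0] by simp
  have n1: "(\<integral>\<^sup>+x. ennreal \<bar>s x\<bar> \<partial>lborel) < \<infinity>"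
    using s1 by (simp add: integrable_iff_bounded)
  have shn: "(\<integral>\<^sup>+x. ennreal \<bar>s (x - t *\<^sub>R e)\<bar> \<partial>lborel) = (\<integral>\<^sup>+x. ennreal \<bar>s x\<bar> \<partial>lborel)" for t
    using lborel_shift(2)[of "\<lambda>x. \<bar>s x\<bar>" "- (t *\<^sub>R e)"] by simp
  have int: "integrable (lborel \<Otimes>\<^sub>M lborel) (\<lambda>(t, x). indicator {0..R} t * k t x)"
    if k[measurable]: "(\<lambda>p. k (fst p) (snd p)) \<in> borel_measurable (borel \<Otimes>\<^sub>M borel)"
      and kb: "\<And>t. (\<integral>\<^sup>+x. ennreal \<bar>k t x\<bar> \<partial>lborel) \<le> ennreal B * (\<integral>\<^sup>+x. ennreal \<bar>s x\<bar> \<partial>lborel)" for k :: "real \<Rightarrow> 'a \<Rightarrow> real"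
  proof (rule integrableI_bounded)
    show m: "(\<lambda>(t, x). indicator {0..R} t * k t x) \<in> borel_measurable (lborel \<Otimes>\<^sub>M lborel)"
      unfolding split_beta' by measurable
    have "(\<integral>\<^sup>+p. ennreal (norm (case p of (t, x) \<Rightarrow> indicator {0..R} t * k t x)) \<partial>(lborel \<Otimes>\<^sub>M lborel))
        = (\<integral>\<^sup>+t. \<integral>\<^sup>+x. ennreal (norm (indicator {0..R} t * k t x)) \<partial>lborel \<partial>lborel)"
      using m by (subst lborel.nn_integral_fst[symmetric]) auto
    also have "\<dots> \<le> (\<integral>\<^sup>+t. (ennreal B * (\<integral>\<^sup>+x. ennreal \<bar>s x\<bar> \<partial>lborel)) * indicator {0..R} t \<partial>lborel)"
    proof (intro nn_integral_mono)
      fix t :: real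
      show "(\<integral>\<^sup>+x. ennreal (norm (indicator {0..R} t * k t x)) \<partial>lborel) \<le> (ennreal B * (\<integral>\<^sup>+x. ennreal \<bar>s x\<bar> \<partial>lborel)) * indicator {0..R} t"
        using kb[of t] by (cases "t \<in> {0..R}") simp_all
    qed
    also have "\<dots> < \<infinity>" using n1 R by (simp add: nn_integral_cmult ennreal_mult_less_top)
    finally show "(\<integral>\<^sup>+p. ennreal (norm (case p of (t, x) \<Rightarrow> indicator {0..R} t * k t x)) \<partial>(lborel \<Otimes>\<^sub>M lborel)) < \<infinity>" .
  qed
  have bnd: "ennreal \<bar>a * g x\<bar> \<le> ennreal B * ennreal \<bar>a\<bar>" for a x
    using B[of x] B0 by (simp add: abs_mult mult.commute[of B] mult_left_mono ennreal_leI flip: ennreal_mult)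
  have i1: "integrable (lborel \<Otimes>\<^sub>M lborel) (\<lambda>(t, x). indicator {0..R} t * (s (x - t *\<^sub>R e) * g x))"
  proof (rule int)
    fix t
    have "(\<integral>\<^sup>+x. ennreal \<bar>s (x - t *\<^sub>R e) * g x\<bar> \<partial>lborel) \<le> (\<integral>\<^sup>+x. ennreal B * ennreal \<bar>s (x - t *\<^sub>R e)\<bar> \<partial>lborel)"
      by (intro nn_integral_mono bnd)
    also have "\<dots> = ennreal B * (\<integral>\<^sup>+x. ennreal \<bar>s x\<bar> \<partial>lborel)" by (subst nn_integral_cmult) (simp_all add: shn)
    finally show "(\<integral>\<^sup>+x. ennreal \<bar>s (x - t *\<^sub>R e) * g x\<bar> \<partial>lborel) \<le> ennreal B * (\<integral>\<^sup>+x. ennreal \<bar>s x\<bar> \<partial>lborel)" .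
  qed measurable
  have i2: "integrable (lborel \<Otimes>\<^sub>M lborel) (\<lambda>(t, y). indicator {0..R} t * (s y * g (y + t *\<^sub>R e)))"
  proof (rule int)
    fix t
    have "(\<integral>\<^sup>+x. ennreal \<bar>s x * g (x + t *\<^sub>R e)\<bar> \<partial>lborel) \<le> (\<integral>\<^sup>+x. ennreal B * ennreal \<bar>s x\<bar> \<partial>lborel)"
      by (intro nn_integral_mono bnd)
    also have "\<dots> = ennreal B * (\<integral>\<^sup>+x. ennreal \<bar>s x\<bar> \<partial>lborel)" by (subst nn_integral_cmult) simp_all
    finally show "(\<integral>\<^sup>+x. ennreal \<bar>s x * g (x + t *\<^sub>R e)\<bar> \<partial>lborel) \<le> ennreal B * (\<integral>\<^sup>+x. ennreal \<bar>s x\<bar> \<partial>lborel)" .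
  qed measurable
  have "(\<integral>x. line_primitive e R s x * g x \<partial>lborel) = (\<integral>x. (\<integral>t. indicator {0..R} t * (s (x - t *\<^sub>R e) * g x) \<partial>lborel) \<partial>lborel)"
    unfolding line_primitive_def integral_mult_left_zero[symmetric] by (simp only: mult.assoc)
  also have "\<dots> = (\<integral>t. (\<integral>x. indicator {0..R} t * (s (x - t *\<^sub>R e) * g x) \<partial>lborel) \<partial>lborel)"
    by (rule lborel_pair.Fubini_integral[OF i1])
  also have "\<dots> = (\<integral>t. (\<integral>y. indicator {0..R} t * (s y * g (y + t *\<^sub>R e)) \<partial>lborel) \<partial>lborel)"
  proof (rule Bochner_Integration.integral_cong[OF refl])
    fix t :: real
    have "(\<integral>x. s (x - t *\<^sub>R e) * g x \<partial>lborel) = (\<integral>y. s y * g (y + t *\<^sub>R e) \<partial>lborel)"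
      using lborel_shift(1)[of "\<lambda>x. s (x - t *\<^sub>R e) * g x" "t *\<^sub>R e"] by simp
    then show "(\<integral>x. indicator {0..R} t * (s (x - t *\<^sub>R e) * g x) \<partial>lborel) = (\<integral>y. indicator {0..R} t * (s y * g (y + t *\<^sub>R e)) \<partial>lborel)"
      by simp
  qed
  also have "\<dots> = (\<integral>y. (\<integral>t. indicator {0..R} t * (s y * g (y + t *\<^sub>R e)) \<partial>lborel) \<partial>lborel)"
    by (rule lborel_pair.Fubini_integral[OF i2, symmetric])
  also have "\<dots> = (\<integral>y. s y * (\<integral>t. indicator {0..R} t * g (y + t *\<^sub>R e) \<partial>lborel) \<partial>lborel)"
    unfolding integral_mult_right_zero[symmetric] by (simp only: mult.left_commute)
  finally show ?thesis .
qed

end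

lemma integral_line_derivative:
  fixes g :: "'a::euclidean_space \<Rightarrow> real"
  assumes R: "0 < R" and g: "g \<in> borel_measurable borel" "\<And>x. \<bar>g x\<bar> \<le> B"
    and der: "\<And>t. ((\<lambda>t. \<psi> (y + t *\<^sub>R e)) has_real_derivative g (y + t *\<^sub>R e)) (at t)"
  shows "(\<integral>t. indicator {0..R} t * g (y + t *\<^sub>R e) \<partial>lborel) = \<psi> (y + R *\<^sub>R e) - \<psi> y"
proof -
  have "integrable lborel (\<lambda>t. indicator {0..R} t * g (y + t *\<^sub>R e))"
  proof (rule Bochner_Integration.integrable_bound)
    show "integrable lborel (\<lambda>t. B * indicator {0..R} t)" using R by (intro integrable_mult_right) auto
    show "AE t in lborel. norm (indicator {0..R} t * g (y + t *\<^sub>R e)) \<le> norm (B * indicator {0..R} t)"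
      using g(2) by (auto simp: indicator_def intro: order_trans[OF _ abs_ge_self])
  qed (use g(1) in measurable)
  from has_integral_integral_lborel[OF this]
  have "((\<lambda>t. if t \<in> {0..R} then g (y + t *\<^sub>R e) else 0) has_integral (\<integral>t. indicator {0..R} t * g (y + t *\<^sub>R e) \<partial>lborel)) UNIV"
    by (rule has_integral_eq[rotated]) (auto simp: indicator_def)
  then have 1: "((\<lambda>t. g (y + t *\<^sub>R e)) has_integral (\<integral>t. indicator {0..R} t * g (y + t *\<^sub>R e) \<partial>lborel)) {0..R}"
    by (simp only: has_integral_restrict_UNIV)
  have 2: "((\<lambda>t. g (y + t *\<^sub>R e)) has_integral \<psi> (y + R *\<^sub>R e) - \<psi> (y + 0 *\<^sub>R e)) {0..R}"
    using R der by (intro fundamental_theorem_of_calculus)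
      (auto simp: has_real_derivative_iff_has_vector_derivative[symmetric] intro: has_field_derivative_at_within)
  from has_integral_unique[OF 1 2] show ?thesis by simp
qed

text \<open>Says that the field \<open>U\<close> times \<open>e\<close> has weak divergence
  \<open>s\<close>, with a generous class of test pairs: \<open>\<psi>\<close> has to be
  differentiable, with derivative \<open>g\<close>, only along almost every line of direction
  \<open>e\<close>. This admits test functions of \<Omega> cut off to one subdomain, although they
  jump across \<gamma>.\<close>

definition weak_line_primitive ::
    "'a::euclidean_space set \<Rightarrow> 'a \<Rightarrow> ('a \<Rightarrow> real) \<Rightarrow> ('a \<Rightarrow> real) \<Rightarrow> bool" where
  "weak_line_primitive D e s U \<longleftrightarrow>
     (\<forall>\<psi> g B. \<psi> \<in> borel_measurable borel \<longrightarrow> g \<in> borel_measurable borel \<longrightarrow>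
        (\<forall>x. x \<notin> D \<longrightarrow> \<psi> x = 0 \<and> g x = 0) \<longrightarrow> (\<forall>x. \<bar>g x\<bar> \<le> B) \<longrightarrow>
        (AE y in lborel. \<forall>t. ((\<lambda>t. \<psi> (y + t *\<^sub>R e)) has_real_derivative g (y + t *\<^sub>R e)) (at t)) \<longrightarrow>
        (\<integral>x. U x * g x \<partial>lebesgue_on D) = - (\<integral>x. s x * \<psi> x \<partial>lebesgue_on D))"

proposition directional_antiderivative:
  fixes D :: "'a::euclidean_space set" and e :: 'a
  assumes D: "D \<in> sets borel" "bounded D" and e: "norm e = 1"
  obtains C where "\<And>s. s \<in> Lp 3 (lebesgue_on D) \<Longrightarrow> \<exists>U\<in>Lp 3 (lebesgue_on D).
      cube_int (lebesgue_on D) U \<le> C * cube_int (lebesgue_on D) s \<and>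
      weak_line_primitive D e s U"
proof -
  obtain r where r: "\<And>x. x \<in> D \<Longrightarrow> norm x \<le> r" using D(2) by (auto simp: bounded_iff)
  define R where "R = 2 * \<bar>r\<bar> + 1"
  have R: "R > 0" by (simp add: R_def)
  \<comment> \<open>One step of length \<open>R\<close> leaves \<open>D\<close>. Therefore
    \<open>\<psi> (y + R *\<^sub>R e) = 0\<close> for \<open>y\<close> in \<open>D\<close>, and the
    integral of \<open>g\<close> over the segment reduces to \<open>- \<psi> y\<close>, the source
    of the minus sign.\<close>
  have out: "y + R *\<^sub>R e \<notin> D" if "y \<in> D" for y
  proof
    assume "y + R *\<^sub>R e \<in> D"
    then have "norm (R *\<^sub>R e) \<le> r + r"
      using norm_triangle_ineq4[of "y + R *\<^sub>R e" y] r[OF that] r[of "y + R *\<^sub>R e"] by simp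
    then show False using e R by (simp add: R_def)
  qed
  have Dl: "D \<in> sets lebesgue" using D by simp
  have "\<exists>U\<in>Lp 3 (lebesgue_on D).
      cube_int (lebesgue_on D) U \<le> R ^ 3 * cube_int (lebesgue_on D) s \<and>
      weak_line_primitive D e s U"
    if s: "s \<in> Lp 3 (lebesgue_on D)" for s
  proof -
    have fin: "finite_measure (lebesgue_on D)"
      using D by (intro finite_measure_lebesgue_on bounded_set_imp_lmeasurable) auto
    have sm: "(\<lambda>x. indicator D x * s x) \<in> borel_measurable lebesgue"
      using LpD(1)[OF s] Dl by (subst (asm) borel_measurable_restrict_space_iff) auto
    have s1: "integrable lebesgue (\<lambda>x. indicator D x * s x)"
    proof -
      have "s \<in> Lp 1 (lebesgue_on D)" by (rule Lp_mono_exponent[OF fin _ _ s]) auto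
      then have "integrable (lebesgue_on D) s" by (auto simp: Lp_def integrable_abs_iff)
      then show ?thesis using Dl by (subst (asm) integrable_restrict_space) auto
    qed
    have s3: "integrable lebesgue (\<lambda>x. indicator D x * \<bar>s x\<bar> ^ 3)"
    proof -
      have "integrable (lebesgue_on D) (\<lambda>x. \<bar>s x\<bar> ^ 3)" using s by (simp add: Lp_3_cube)
      then show ?thesis using Dl by (subst (asm) integrable_restrict_space) auto
    qed
    \<comment> \<open>Fubini's theorem is used on \<open>lborel\<close>, so the extension of
      \<open>s\<close> by 0 is replaced by a Borel function that agrees with it almost
      everywhere.\<close>
    obtain s0 where s0: "s0 \<in> borel_measurable lborel" "AE x in lborel. indicator D x * s x = s0 x"
      using completion_ex_borel_measurable_real[OF sm] by blast
    have s0m[measurable]: "s0 \<in> borel_measurable borel" using s0(1) by simp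
    have s0l: "s0 \<in> borel_measurable lebesgue" using s0(1) by (rule measurable_completion)
    have ae: "AE x in lebesgue. indicator D x * s x = s0 x" using s0(2) by (rule AE_completion)
    have "integrable lebesgue s0"
      using s1 sm s0l ae by (subst integrable_cong_AE[symmetric, OF _ _ ae]) auto
    then have s01: "integrable lborel s0" using s0(1) by (simp add: integrable_completion)
    have ae3: "AE x in lebesgue. indicator D x * \<bar>s x\<bar> ^ 3 = \<bar>s0 x\<bar> ^ 3"
      using ae by eventually_elim (auto simp: indicator_def split: if_splits)
    have "integrable lebesgue (\<lambda>x. \<bar>s0 x\<bar> ^ 3)"
      using s3 s0l by (subst integrable_cong_AE[symmetric, OF _ _ ae3]) auto
    then have s03: "integrable lborel (\<lambda>x. \<bar>s0 x\<bar> ^ 3)" using s0m by (simp add: integrable_completion)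
    have s0int: "(\<integral>x. \<bar>s0 x\<bar> ^ 3 \<partial>lborel) = cube_int (lebesgue_on D) s"
    proof -
      have "(\<integral>x. \<bar>s0 x\<bar> ^ 3 \<partial>lborel) = (\<integral>x. \<bar>s0 x\<bar> ^ 3 \<partial>lebesgue)"
        by (rule integral_completion[symmetric]) simp
      also have "\<dots> = (\<integral>x. indicator D x * \<bar>s x\<bar> ^ 3 \<partial>lebesgue)"
        using s3 s0l ae3 by (intro integral_cong_AE) auto
      also have "\<dots> = cube_int (lebesgue_on D) s"
        using Dl by (simp add: cube_int_def integral_restrict_space)
      finally show ?thesis .
    qed
    define U where "U = line_primitive e R s0"
    have Um[measurable]: "U \<in> borel_measurable borel"
      unfolding U_def by (rule line_primitive_measurable[OF R s0m s03 s01])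
    have U3: "integrable lborel (\<lambda>x. \<bar>U x\<bar> ^ 3)" "(\<integral>x. \<bar>U x\<bar> ^ 3 \<partial>lborel) \<le> R ^ 3 * (\<integral>x. \<bar>s0 x\<bar> ^ 3 \<partial>lborel)"
      unfolding U_def by (rule line_primitive_cube[OF R s0m s03 s01])+
    have iD: "integrable lborel (\<lambda>x. indicator D x * \<bar>U x\<bar> ^ 3)"
      using integrable_mult_indicator[of D lborel "\<lambda>x. \<bar>U x\<bar> ^ 3"] U3(1) D(1) by simp
    have iD': "integrable lebesgue (\<lambda>x. indicator D x * \<bar>U x\<bar> ^ 3)"
      using iD D(1) by (simp add: integrable_completion)
    have ULp: "U \<in> Lp 3 (lebesgue_on D)"
      unfolding Lp_3_cube
    proof
      show "U \<in> borel_measurable (lebesgue_on D)"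
        by (intro measurable_restrict_space1 measurable_completion) simp
      show "integrable (lebesgue_on D) (\<lambda>x. norm (U x) ^ 3)"
        using iD' Dl by (subst integrable_restrict_space) auto
    qed
    have "cube_int (lebesgue_on D) U = (\<integral>x. indicator D x * \<bar>U x\<bar> ^ 3 \<partial>lborel)"
      using Dl D(1) by (simp add: cube_int_def integral_restrict_space integral_completion)
    also have "\<dots> \<le> (\<integral>x. \<bar>U x\<bar> ^ 3 \<partial>lborel)"
      using iD U3(1) by (intro integral_mono) (auto simp: indicator_def)
    also have "\<dots> \<le> R ^ 3 * cube_int (lebesgue_on D) s" using U3(2) s0int by simp
    finally have cube: "cube_int (lebesgue_on D) U \<le> R ^ 3 * cube_int (lebesgue_on D) s" .
    have adj: "(\<integral>x. U x * g x \<partial>lebesgue_on D) = - (\<integral>x. s x * \<psi> x \<partial>lebesgue_on D)"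
      if \<psi>[measurable]: "\<psi> \<in> borel_measurable borel" and g[measurable]: "g \<in> borel_measurable borel"
        and zero: "\<forall>x. x \<notin> D \<longrightarrow> \<psi> x = 0 \<and> g x = 0" and B: "\<forall>x. \<bar>g x\<bar> \<le> B"
        and der: "AE y in lborel. \<forall>t. ((\<lambda>t. \<psi> (y + t *\<^sub>R e)) has_real_derivative g (y + t *\<^sub>R e)) (at t)" for \<psi> g B
    proof -
      have "(\<integral>x. U x * g x \<partial>lebesgue_on D) = (\<integral>x. indicator D x *\<^sub>R (U x * g x) \<partial>lebesgue)"
        using Dl by (intro integral_restrict_space) auto
      also have "\<dots> = (\<integral>x. U x * g x \<partial>lebesgue)"
        using zero by (intro Bochner_Integration.integral_cong) (auto simp: indicator_def)
      also have "\<dots> = (\<integral>x. U x * g x \<partial>lborel)" by (rule integral_completion) simp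
      also have "\<dots> = (\<integral>y. s0 y * (\<integral>t. indicator {0..R} t * g (y + t *\<^sub>R e) \<partial>lborel) \<partial>lborel)"
        unfolding U_def using line_primitive_adjoint[OF R s0m s03 s01 g] B by blast
      also have "\<dots> = (\<integral>y. - (s0 y * \<psi> y) \<partial>lborel)"
      proof (rule integral_cong_AE)
        show "AE y in lborel. s0 y * (\<integral>t. indicator {0..R} t * g (y + t *\<^sub>R e) \<partial>lborel) = - (s0 y * \<psi> y)"
          using der s0(2)
        proof eventually_elim
          case (elim y)
          show ?case
          proof (cases "y \<in> D")
            case True
            have "(\<integral>t. indicator {0..R} t * g (y + t *\<^sub>R e) \<partial>lborel) = \<psi> (y + R *\<^sub>R e) - \<psi> y"
              using elim(1) B by (intro integral_line_derivative[OF R g]) auto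
            then show ?thesis using zero out[OF True] by simp
          next
            case False
            then show ?thesis using elim(2) by simp
          qed
        qed
      qed measurable
      also have "\<dots> = - (\<integral>y. s0 y * \<psi> y \<partial>lborel)" by simp
      also have "(\<integral>y. s0 y * \<psi> y \<partial>lborel) = (\<integral>y. s0 y * \<psi> y \<partial>lebesgue)"
        by (rule integral_completion[symmetric]) simp
      also have "\<dots> = (\<integral>y. indicator D y *\<^sub>R (s y * \<psi> y) \<partial>lebesgue)"
      proof (rule integral_cong_AE)
        have "(\<lambda>y. (indicator D y * s y) * \<psi> y) \<in> borel_measurable lebesgue"
          using \<psi> by (intro borel_measurable_times[OF sm] measurable_completion) simp
        then show "(\<lambda>y. indicator D y *\<^sub>R (s y * \<psi> y)) \<in> borel_measurable lebesgue" by (simp add: mult.assoc)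
        show "(\<lambda>y. s0 y * \<psi> y) \<in> borel_measurable lebesgue"
          by (rule measurable_completion) simp
        show "AE y in lebesgue. s0 y * \<psi> y = indicator D y *\<^sub>R (s y * \<psi> y)"
          using ae by eventually_elim (metis mult.assoc real_scaleR_def)
      qed
      also have "\<dots> = (\<integral>y. s y * \<psi> y \<partial>lebesgue_on D)"
        using Dl by (intro integral_restrict_space[symmetric]) auto
      finally show ?thesis .
    qed
    have "weak_line_primitive D e s U" unfolding weak_line_primitive_def using adj by blast
    then show ?thesis using ULp cube by blast
  qed
  then show ?thesis using that by blast
qed

section \<open>Fields with divergence and normal flux\<close>

text \<open>The pairing with a fixed \<open>g\<close> is a bounded functional in the additive sense,
  so \<open>bounded_functional_tendsto_0\<close> applies. The restriction \<open>p \<le> 3\<close>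
  matches the cubic growth allowed there.\<close>

lemma Lp_pairing_tendsto:
  assumes pq: "1 < p" "p \<le> 3" "1 < q" "1 / p + 1 / q = 1"
    and F: "\<And>k. F k \<in> Lp p M" and f: "f \<in> Lp p M" and g: "g \<in> Lp q M"
    and lim: "(\<lambda>k. \<integral>x. norm (F k x - f x) powr p \<partial>M) \<longlonglongrightarrow> 0"
  shows "(\<lambda>k. \<integral>x. F k x \<bullet> g x \<partial>M) \<longlonglongrightarrow> (\<integral>x. f x \<bullet> g x \<partial>M)"
proof -
  have d: "F k - f \<in> Lp p M" for k using F f pq by (intro Lp_sub) auto
  have "(\<lambda>k. \<integral>x. (F k - f) x \<bullet> g x \<partial>M) \<longlonglongrightarrow> 0"
  proof (rule bounded_functional_tendsto_0[where Z = "Lp p M" and N = "\<lambda>z. \<integral>x. norm (z x) powr p \<partial>M"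
        and l = "\<lambda>z. \<integral>x. z x \<bullet> g x \<partial>M" and C = "\<integral>x. norm (g x) powr q \<partial>M" and X = "\<lambda>k. F k - f"])
    show "\<bar>\<integral>x. z x \<bullet> g x \<partial>M\<bar> \<le> (\<integral>x. norm (z x) powr p \<partial>M) + (\<integral>x. norm (g x) powr q \<partial>M)" if "z \<in> Lp p M" for z
      using Lp_pairing(2)[OF _ _ _ that g] pq by simp
    show "(\<integral>x. norm ((c *\<^sub>R z) x) powr p \<partial>M) \<le> c ^ 3 * (\<integral>x. norm (z x) powr p \<partial>M)" if "1 \<le> c" for c and z :: "'a \<Rightarrow> 'b"
    proof -
      have "c powr p \<le> c powr 3" using that pq by (intro powr_mono) auto
      then have "c powr p * (\<integral>x. norm (z x) powr p \<partial>M) \<le> c ^ 3 * (\<integral>x. norm (z x) powr p \<partial>M)"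
        using that by (intro mult_right_mono integral_nonneg_AE) (auto simp: powr_numeral)
      then show ?thesis using that by (simp add: powr_mult)
    qed
  qed (use d lim Lp_scale in auto)
  then have "(\<lambda>k. (\<integral>x. (F k - f) x \<bullet> g x \<partial>M) + (\<integral>x. f x \<bullet> g x \<partial>M)) \<longlonglongrightarrow> 0 + (\<integral>x. f x \<bullet> g x \<partial>M)"
    by (intro tendsto_intros)
  moreover have "(\<integral>x. (F k - f) x \<bullet> g x \<partial>M) + (\<integral>x. f x \<bullet> g x \<partial>M) = (\<integral>x. F k x \<bullet> g x \<partial>M)" for k
    using Lp_pairing(1)[OF _ _ _ F g] Lp_pairing(1)[OF _ _ _ f g] pq by (simp add: inner_diff_left)
  ultimately show ?thesis by simp
qed

lemma finite_measure_lebesgue_on_bounded: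
  fixes D :: "'a::euclidean_space set"
  shows "open D \<Longrightarrow> bounded D \<Longrightarrow> finite_measure (lebesgue_on D)"
  by (intro finite_measure_lebesgue_on bounded_set_imp_lmeasurable) auto

lemma Lp_bounded_continuous:
  fixes h :: "'a::euclidean_space \<Rightarrow> 'b::euclidean_space"
  assumes "finite_measure (lebesgue_on D)" "continuous_on UNIV h" "\<And>x. norm (h x) \<le> B" "0 < p"
  shows "h \<in> Lp p (lebesgue_on D)"
proof (rule Lp_bound)
  interpret finite_measure "lebesgue_on D" by fact
  show "integrable (lebesgue_on D) (\<lambda>x. B powr p)" by simp
  show "h \<in> borel_measurable (lebesgue_on D)"
    using assms(2) by (intro measurable_restrict_space1 measurable_completion) (simp add: borel_measurable_continuous_onI)
  show "AE x in lebesgue_on D. norm (h x) powr p \<le> B powr p"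
    using assms(3,4) by (intro AE_I2 powr_mono2) auto
qed

lemma Lp_locally_integrable:
  fixes f :: "'a::euclidean_space \<Rightarrow> 'b::euclidean_space"
  assumes f: "f \<in> Lp p (lebesgue_on D)" and p: "1 \<le> p" and D: "finite_measure (lebesgue_on D)" "D \<in> sets lebesgue"
  shows "locally_integrable D f"
  unfolding locally_integrable_def
proof (intro allI impI)
  fix K assume K: "compact K \<and> K \<subseteq> D"
  have Kl: "K \<in> sets lebesgue" using K fmeasurableD[OF lmeasurable_compact] by blast
  have "f \<in> Lp 1 (lebesgue_on D)" using p by (intro Lp_mono_exponent[OF D(1) _ _ f]) auto
  then have "integrable (lebesgue_on D) f"
    by (auto simp: Lp_def integrable_norm_iff)
  then have "integrable lebesgue (\<lambda>x. indicator D x *\<^sub>R f x)" using D(2) by (subst (asm) integrable_restrict_space) auto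
  from integrable_mult_indicator[OF Kl this] have "integrable lebesgue (\<lambda>x. indicator K x *\<^sub>R f x)"
    by (rule Bochner_Integration.integrable_cong[THEN iffD1, rotated -1]) (use K in \<open>auto simp: indicator_def\<close>)
  then show "integrable (lebesgue_on K) f" using Kl by (subst integrable_restrict_space) auto
qed

lemma test_function_Lp:
  assumes "finite_measure (lebesgue_on D)" "\<phi> \<in> test_functions D'" "0 < p"
  shows "\<phi> \<in> Lp p (lebesgue_on D)" "grad \<phi> \<in> Lp p (lebesgue_on D)"
proof -
  obtain B where B: "\<And>x. \<bar>\<phi> x\<bar> \<le> B" "\<And>x. norm (grad \<phi> x) \<le> B" using test_functionD(5)[OF assms(2)] by blast
  show "\<phi> \<in> Lp p (lebesgue_on D)"
    using B(1) by (intro Lp_bounded_continuous[OF assms(1) test_functionD(2)[OF assms(2)] _ assms(3)]) auto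
  show "grad \<phi> \<in> Lp p (lebesgue_on D)"
    by (rule Lp_bounded_continuous[OF assms(1) test_functionD(3)[OF assms(2)] B(2) assms(3)])
qed

lemma has_weak_div_unique:
  fixes D :: "'a::euclidean_space set"
  assumes "open D" "has_weak_div D u g" "has_weak_div D u h"
  shows "AE x in lebesgue_on D. g x = h x"
proof (rule weak_eq_AE[OF \<open>open D\<close> \<open>open D\<close>, of "\<lambda>x. x" 0])
  show "linear (\<lambda>x::'a. x)" by (rule bounded_linear.linear[OF bounded_linear_ident])
  show "(\<integral>x. g x * \<phi> (0 + x) \<partial>lebesgue_on D) = (\<integral>x. h x * \<phi> (0 + x) \<partial>lebesgue_on D)" if "\<phi> \<in> test_functions D" for \<phi>
    using assms(2,3) that by (auto simp: has_weak_div_def dest!: bspec)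
qed (use assms in \<open>auto simp: has_weak_div_def\<close>)

text \<open>Sign of the exterior normal of a subdomain relative to n: it translates between
  \<open>normal_trace\<close>, which refers to the exterior normal, and \<open>normal_flux\<close>,
  which refers to n.\<close>

definition side :: "2 \<Rightarrow> real" where
  "side i = (if i = 1 then 1 else - 1)"

lemma side_square [simp]: "side i * side i = 1" "side i * (side i * x) = x"
  by (auto simp: side_def)

lemma normal_flux_eq: "normal_flux G u i y = side i * normal_trace G i (fst u i) y"
  by (simp add: normal_flux_def side_def)

type_synonym ('n, 'm) field = "('n, 'm) velocity \<times> ('n, 'm) pressure \<times> (2 \<Rightarrow> real^'m \<Rightarrow> real)"

text \<open>\<open>weak_div\<close> and \<open>normal_trace\<close> are arbitrarily chosen representatives, hence linear only almost everywhere. Carrying the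
  divergence \<open>s\<close> and the fluxes \<open>w\<close> along with the field \<open>u\<close> gives an exactly linear space.\<close>

definition flux_fields :: "('n::finite, 'm::finite) geometry \<Rightarrow> ('n, 'm) field set" where
  "flux_fields G = {(u, s, w). u \<in> V_space G \<and> s \<in> M_dual G \<and> (\<forall>i. w i \<in> Lp 2 (cut_measure G)) \<and>
     (\<forall>i. \<forall>\<phi>\<in>test_functions (part G i).
        (\<integral>x. fst u i x \<bullet> grad \<phi> x \<partial>bulk_measure G i) = - (\<integral>x. fst s i x * \<phi> x \<partial>bulk_measure G i)) \<and>
     (\<forall>\<phi>\<in>test_functions (cut G).
        (\<integral>y. snd u y \<bullet> grad \<phi> y \<partial>cut_measure G) = - (\<integral>y. (snd s y + (w 1 y - w 2 y)) * \<phi> y \<partial>cut_measure G)) \<and>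
     (\<forall>i. \<forall>\<phi>\<in>test_functions (bulk G).
        (\<integral>x. fst u i x \<bullet> grad \<phi> x \<partial>bulk_measure G i) + (\<integral>x. fst s i x * \<phi> x \<partial>bulk_measure G i)
          = side i * (\<integral>y. w i y * \<phi> (chart G y) \<partial>cut_measure G))}"

section \<open>Fields with exactly linear divergence and flux components\<close>

locale fractured =
  fixes G :: "('n::finite, 'm::finite) geometry"
  assumes fd: "fractured_domain G"
begin

abbreviation "\<mu> i \<equiv> bulk_measure G i"
abbreviation "\<nu> \<equiv> cut_measure G"

lemma parts: "lipschitz_domain (part G i)"
proof -
  have "lipschitz_domain (part G 1)" "lipschitz_domain (part G 2)"
    using fd unfolding fractured_domain_def by blast+
  then show ?thesis using exhaust_2[of i] by metis
qed

lemma part_open: "open (part G i)" and part_bounded: "bounded (part G i)"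
  using parts[of i] unfolding lipschitz_domain_def by blast+

lemma cut_open: "open (cut G)" and cut_bounded: "bounded (cut G)" and bulk_open: "open (bulk G)"
  using fd unfolding fractured_domain_def lipschitz_domain_def by blast+

lemma bulk_eq: "bulk G = part G 1 \<union> fracture G \<union> part G 2"
  and parts_disjoint: "part G 1 \<inter> part G 2 = {}"
  using fd unfolding fractured_domain_def by blast+

lemma fracture_sub_bulk: "fracture G \<subseteq> bulk G"
  using bulk_eq by blast

text \<open>Points of \<gamma> are limits of either subdomain but lie in neither, and the subdomains
  are open. This makes traces on the boundary of a subdomain available on \<gamma>.\<close>

lemma fracture_sub_frontier: "chart G ` cut G \<subseteq> frontier (part G i)"
proof -
  have "fracture G \<subseteq> closure (part G 1)" "fracture G \<subseteq> closure (part G 2)"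
    "fracture G \<inter> part G 1 = {}" "fracture G \<inter> part G 2 = {}"
    using fd unfolding fractured_domain_def by blast+
  then have "fracture G \<subseteq> closure (part G i)" "fracture G \<inter> part G i = {}"
    using exhaust_2[of i] by metis+
  then show ?thesis using interior_open[OF part_open[of i]] by (auto simp: frontier_def fracture_def)
qed

lemma fin_part: "finite_measure (\<mu> i)" and fin_cut: "finite_measure \<nu>"
  using part_open part_bounded cut_open cut_bounded by (auto intro: finite_measure_lebesgue_on_bounded)

lemma part_sets: "part G i \<in> sets lebesgue" and cut_sets: "cut G \<in> sets lebesgue"
  using part_open cut_open by auto

lemma chart_isometry:
  obtains x0 T where "linear T" "\<And>y. norm (T y) = norm y" "chart G = (\<lambda>y. x0 + T y)"
  using fd unfolding fractured_domain_def hyperplane_chart_def by blast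

lemma chart_dist: "dist (chart G y) (chart G z) = dist y z"
  by (rule chart_isometry) (simp add: dist_norm flip: linear_diff)

lemma dims: "CARD('n) = CARD('m) + 1"
  using fd unfolding fractured_domain_def hyperplane_chart_def by blast

lemma test_chart_Lp:
  assumes "\<phi> \<in> test_functions D" "0 < p"
  shows "(\<lambda>y. \<phi> (chart G y)) \<in> Lp p \<nu>"
proof -
  obtain B where B: "\<And>x. \<bar>\<phi> x\<bar> \<le> B" using test_functionD(5)[OF assms(1)] by blast
  have "continuous_on UNIV (chart G)" by (auto simp: continuous_on_iff chart_dist)
  then have "continuous_on UNIV (\<lambda>y. \<phi> (chart G y))"
    by (intro continuous_on_compose2[OF test_functionD(2)[OF assms(1)]]) auto
  then show ?thesis using B assms(2) by (intro Lp_bounded_continuous[OF fin_cut]) auto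
qed

lemma fieldsD:
  assumes "(u, s, w) \<in> flux_fields G"
  shows "fst u i \<in> Lp 3 (\<mu> i)" "snd u \<in> Lp 3 \<nu>" "fst s i \<in> Lp 3 (\<mu> i)" "snd s \<in> Lp 3 \<nu>"
    "w i \<in> Lp 2 \<nu>" "(\<lambda>y. snd s y + (w 1 y - w 2 y)) \<in> Lp 2 \<nu>"
proof -
  show *: "fst u i \<in> Lp 3 (\<mu> i)" "snd u \<in> Lp 3 \<nu>" "fst s i \<in> Lp 3 (\<mu> i)" "snd s \<in> Lp 3 \<nu>" "w i \<in> Lp 2 \<nu>" for i
    using assms by (auto simp: flux_fields_def V_space_def M_dual_def)
  show "(\<lambda>y. snd s y + (w 1 y - w 2 y)) \<in> Lp 2 \<nu>"
    by (intro Lp_add Lp_diff * Lp_mono_exponent[OF fin_cut _ _ *(4)]) auto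
qed

lemma fields_weak_div:
  assumes "(u, s, w) \<in> flux_fields G"
  shows "has_weak_div (part G i) (fst u i) (fst s i)"
    and "has_weak_div (cut G) (snd u) (\<lambda>y. snd s y + (w 1 y - w 2 y))"
  unfolding has_weak_div_def
  using assms fieldsD[OF assms] fin_part fin_cut part_sets cut_sets
  by (auto simp: flux_fields_def intro!: Lp_locally_integrable)

lemma bulk_pairing:
  assumes "u \<in> Lp 3 (\<mu> i)" "s \<in> Lp 3 (\<mu> i)" "\<phi> \<in> test_functions D"
  shows "integrable (\<mu> i) (\<lambda>x. u x \<bullet> grad \<phi> x)" "integrable (\<mu> i) (\<lambda>x. s x * \<phi> x)"
  using Lp_pairing_3(1)[OF assms(1) test_function_Lp(2)[OF fin_part assms(3)]]
    Lp_pairing_3(1)[OF assms(2) test_function_Lp(1)[OF fin_part assms(3)]] by auto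

lemma cut_pairing:
  assumes "\<phi> \<in> test_functions D"
  shows "u \<in> Lp 3 \<nu> \<Longrightarrow> integrable \<nu> (\<lambda>x. u x \<bullet> grad \<phi> x)" "s \<in> Lp 2 \<nu> \<Longrightarrow> integrable \<nu> (\<lambda>x. s x * \<phi> x)"
  using Lp_pairing_3(1)[OF _ test_function_Lp(2)[OF fin_cut assms]]
    Lp_pairing_2(1)[OF _ test_function_Lp(1)[OF fin_cut assms]] by auto

lemma chart_pairing:
  assumes "\<phi> \<in> test_functions D"
  shows "w \<in> Lp 2 \<nu> \<Longrightarrow> integrable \<nu> (\<lambda>y. w y * \<phi> (chart G y))"
  using Lp_pairing_2(1)[OF _ test_chart_Lp[OF assms]] by auto

text \<open>\<open>has_normal_trace\<close> refers to the representative \<open>weak_div\<close>.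
  Since weak divergences agree almost everywhere, any known divergence \<open>s\<close> may take its
  place, and the integral splits because both parts are integrable.\<close>

lemma has_normal_trace_iff:
  assumes u: "u \<in> Lp 3 (\<mu> i)" and s: "s \<in> Lp 3 (\<mu> i)" and d: "has_weak_div (part G i) u s"
  shows "has_normal_trace G i u w \<longleftrightarrow> locally_integrable (cut G) w \<and> (\<forall>\<phi>\<in>test_functions (bulk G).
      (\<integral>x. u x \<bullet> grad \<phi> x \<partial>\<mu> i) + (\<integral>x. s x * \<phi> x \<partial>\<mu> i) = (\<integral>y. w y * \<phi> (chart G y) \<partial>\<nu>))"
proof -
  have wd: "has_weak_div (part G i) u (weak_div (part G i) u)"
    unfolding weak_div_def by (rule someI[of "has_weak_div (part G i) u", OF d])
  have ae: "AE x in \<mu> i. s x = weak_div (part G i) u x"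
    by (rule has_weak_div_unique[OF part_open d wd])
  have "weak_div (part G i) u \<in> borel_measurable (\<mu> i)"
    using locally_integrable_measurable[OF part_open] wd by (auto simp: has_weak_div_def)
  then have s': "weak_div (part G i) u \<in> Lp 3 (\<mu> i)" by (rule Lp_cong_AE[OF s _ ae])
  have "(\<integral>x. u x \<bullet> grad \<phi> x + weak_div (part G i) u x * \<phi> x \<partial>\<mu> i) =
      (\<integral>x. u x \<bullet> grad \<phi> x \<partial>\<mu> i) + (\<integral>x. s x * \<phi> x \<partial>\<mu> i)" if \<phi>: "\<phi> \<in> test_functions (bulk G)" for \<phi>
  proof -
    have "(\<integral>x. weak_div (part G i) u x * \<phi> x \<partial>\<mu> i) = (\<integral>x. s x * \<phi> x \<partial>\<mu> i)"
      using ae bulk_pairing[OF u s \<phi>] bulk_pairing[OF u s' \<phi>] by (intro integral_cong_AE) auto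
    then show ?thesis using bulk_pairing[OF u s' \<phi>] by simp
  qed
  then show ?thesis unfolding has_normal_trace_def by simp
qed

lemma has_normal_trace_unique:
  assumes "has_normal_trace G i u w" "has_normal_trace G i u w'"
  shows "AE y in \<nu>. w y = w' y"
proof -
  obtain x0 T where T: "linear T" "\<And>y. norm (T y) = norm y" "chart G = (\<lambda>y. x0 + T y)"
    using chart_isometry by blast
  show ?thesis
  proof (rule weak_eq_AE[OF bulk_open cut_open T(1,2), of x0])
    show "(\<lambda>y. x0 + T y) ` cut G \<subseteq> bulk G" using fracture_sub_bulk unfolding fracture_def T(3) .
    show "(\<integral>y. w y * \<phi> (x0 + T y) \<partial>\<nu>) = (\<integral>y. w' y * \<phi> (x0 + T y) \<partial>\<nu>)" if "\<phi> \<in> test_functions (bulk G)" for \<phi>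
    proof -
      have "(\<integral>y. w y * \<phi> (chart G y) \<partial>\<nu>) = (\<integral>y. w' y * \<phi> (chart G y) \<partial>\<nu>)"
        using assms[unfolded has_normal_trace_def, THEN conjunct2, THEN bspec, OF that] by simp
      then show ?thesis by (simp only: T(3))
    qed
  qed (use assms in \<open>auto simp: has_normal_trace_def\<close>)
qed

lemma fields_normal_trace:
  assumes f: "(u, s, w) \<in> flux_fields G"
  shows "has_normal_trace G i (fst u i) (\<lambda>y. side i * w i y)"
proof -
  have "locally_integrable (cut G) (\<lambda>y. side i * w i y)"
    using Lp_locally_integrable[OF Lp_scaleR[OF fieldsD(5)[OF f, of i], of "side i"] _ fin_cut cut_sets] by simp
  then show ?thesis
    unfolding has_normal_trace_iff[OF fieldsD(1)[OF f] fieldsD(3)[OF f] fields_weak_div(1)[OF f]]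
    using f by (auto simp: flux_fields_def mult.assoc)
qed

text \<open>Together with \<open>W_fields\<close> this identifies \<open>W_space\<close> with the
  projection of \<open>flux_fields\<close> to its first component; the carried divergence and fluxes
  are determined by the field up to null sets.\<close>

lemma fields_W:
  assumes f: "(u, s, w) \<in> flux_fields G"
  shows "u \<in> W_space G"
    and "AE x in \<mu> i. fst (Div G u) i x = fst s i x"
    and "AE y in \<nu>. snd (Div G u) y = snd s y"
    and "AE y in \<nu>. normal_flux G u i y = w i y"
proof -
  note fD = fieldsD[OF f] and wd = fields_weak_div[OF f] and nt = fields_normal_trace[OF f]
  have wd': "has_weak_div (part G i) (fst u i) (weak_div (part G i) (fst u i))" for i
    unfolding weak_div_def by (rule someI[of "has_weak_div (part G i) (fst u i)", OF wd(1)])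
  have wdc: "has_weak_div (cut G) (snd u) (weak_div (cut G) (snd u))"
    unfolding weak_div_def by (rule someI[of "has_weak_div (cut G) (snd u)", OF wd(2)])
  have nt': "has_normal_trace G i (fst u i) (normal_trace G i (fst u i))" for i
    unfolding normal_trace_def by (rule someI[of "has_normal_trace G i (fst u i)", OF nt])
  show 1: "AE x in \<mu> i. fst (Div G u) i x = fst s i x" for i
    using has_weak_div_unique[OF part_open wd' wd(1)] by (simp add: Div_def)
  have nf: "normal_flux G u i \<in> borel_measurable \<nu>" for i
    using locally_integrable_measurable[OF cut_open, of "normal_trace G i (fst u i)"] nt'[of i]
    unfolding normal_flux_eq[abs_def] by (auto simp: has_normal_trace_def)
  show 2: "AE y in \<nu>. normal_flux G u i y = w i y" for i
    using has_normal_trace_unique[OF nt' nt, of i] by eventually_elim (simp add: normal_flux_eq)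
  have "AE y in \<nu>. weak_div (cut G) (snd u) y = snd s y + (w 1 y - w 2 y)"
    by (rule has_weak_div_unique[OF cut_open wdc wd(2)])
  then show 3: "AE y in \<nu>. snd (Div G u) y = snd s y"
    using 2[of 1] 2[of 2] by eventually_elim (simp add: Div_def)
  have mcut: "weak_div (cut G) (snd u) \<in> borel_measurable \<nu>"
    using locally_integrable_measurable[OF cut_open] wdc by (auto simp: has_weak_div_def)
  have "Div G u \<in> M_dual G"
    unfolding M_dual_def
  proof (intro CollectI conjI allI)
    fix i
    have "fst (Div G u) i \<in> borel_measurable (\<mu> i)"
      using locally_integrable_measurable[OF part_open] wd'[of i] by (auto simp: has_weak_div_def Div_def)
    then show "fst (Div G u) i \<in> Lp 3 (\<mu> i)"
      using 1[of i] by (intro Lp_cong_AE[OF fD(3)]) (auto elim: eventually_mono)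
  next
    have "snd (Div G u) \<in> borel_measurable \<nu>" using mcut nf by (simp add: Div_def)
    then show "snd (Div G u) \<in> Lp 3 \<nu>"
      using 3 by (intro Lp_cong_AE[OF fD(4)]) (auto elim: eventually_mono)
  qed
  moreover have "normal_flux G u i \<in> Lp 2 \<nu>" for i
    using 2[of i] nf by (intro Lp_cong_AE[OF fD(5)]) (auto elim: eventually_mono)
  ultimately show "u \<in> W_space G"
    using f wd nt unfolding W_space_def by (auto simp: flux_fields_def)
qed

lemma W_fields:
  assumes u: "u \<in> W_space G"
  shows "(u, Div G u, normal_flux G u) \<in> flux_fields G"
proof -
  have V: "u \<in> V_space G" "Div G u \<in> M_dual G" "\<And>i. normal_flux G u i \<in> Lp 2 \<nu>"
    using u by (auto simp: W_space_def)
  have wd: "has_weak_div (part G i) (fst u i) (fst (Div G u) i)" for i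
  proof -
    obtain g where "has_weak_div (part G i) (fst u i) g" using u unfolding W_space_def by blast
    then have "has_weak_div (part G i) (fst u i) (weak_div (part G i) (fst u i))"
      unfolding weak_div_def by (rule someI[of "has_weak_div (part G i) (fst u i)"])
    then show ?thesis by (simp add: Div_def)
  qed
  have wdc: "has_weak_div (cut G) (snd u) (\<lambda>y. snd (Div G u) y + (normal_flux G u 1 y - normal_flux G u 2 y))"
  proof -
    obtain g where "has_weak_div (cut G) (snd u) g" using u unfolding W_space_def by blast
    then have "has_weak_div (cut G) (snd u) (weak_div (cut G) (snd u))"
      unfolding weak_div_def by (rule someI[of "has_weak_div (cut G) (snd u)"])
    then show ?thesis by (simp add: Div_def)
  qed
  have "has_normal_trace G i (fst u i) (\<lambda>y. side i * normal_flux G u i y)" for i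
  proof -
    obtain w where "has_normal_trace G i (fst u i) w" using u unfolding W_space_def by blast
    then have "has_normal_trace G i (fst u i) (normal_trace G i (fst u i))"
      unfolding normal_trace_def by (rule someI[of "has_normal_trace G i (fst u i)"])
    then show ?thesis by (simp add: normal_flux_eq)
  qed
  then have "(\<integral>x. fst u i x \<bullet> grad \<phi> x \<partial>\<mu> i) + (\<integral>x. fst (Div G u) i x * \<phi> x \<partial>\<mu> i)
      = side i * (\<integral>y. normal_flux G u i y * \<phi> (chart G y) \<partial>\<nu>)" if "\<phi> \<in> test_functions (bulk G)" for i \<phi>
    using V that by (subst (asm) has_normal_trace_iff[OF _ _ wd]) (auto simp: V_space_def M_dual_def mult.assoc)
  then show ?thesis using V wd wdc unfolding flux_fields_def by (auto simp: has_weak_div_def)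
qed

lemma fields_add:
  assumes f: "(u, s, w) \<in> flux_fields G" and g: "(u', s', w') \<in> flux_fields G"
  shows "(u + u', s + s', w + w') \<in> flux_fields G"
proof -
  note fD = fieldsD[OF f] and gD = fieldsD[OF g]
  have fe: "(\<integral>x. fst u i x \<bullet> grad \<phi> x \<partial>\<mu> i) = - (\<integral>x. fst s i x * \<phi> x \<partial>\<mu> i)"
      "(\<integral>x. fst u' i x \<bullet> grad \<phi> x \<partial>\<mu> i) = - (\<integral>x. fst s' i x * \<phi> x \<partial>\<mu> i)" if "\<phi> \<in> test_functions (part G i)" for i \<phi>
    using f g that by (auto simp: flux_fields_def)
  have fc: "(\<integral>y. snd u y \<bullet> grad \<phi> y \<partial>\<nu>) = - (\<integral>y. (snd s y + (w 1 y - w 2 y)) * \<phi> y \<partial>\<nu>)"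
      "(\<integral>y. snd u' y \<bullet> grad \<phi> y \<partial>\<nu>) = - (\<integral>y. (snd s' y + (w' 1 y - w' 2 y)) * \<phi> y \<partial>\<nu>)" if "\<phi> \<in> test_functions (cut G)" for \<phi>
    using f g that by (auto simp: flux_fields_def)
  have fn: "(\<integral>x. fst u i x \<bullet> grad \<phi> x \<partial>\<mu> i) + (\<integral>x. fst s i x * \<phi> x \<partial>\<mu> i) = side i * (\<integral>y. w i y * \<phi> (chart G y) \<partial>\<nu>)"
      "(\<integral>x. fst u' i x \<bullet> grad \<phi> x \<partial>\<mu> i) + (\<integral>x. fst s' i x * \<phi> x \<partial>\<mu> i) = side i * (\<integral>y. w' i y * \<phi> (chart G y) \<partial>\<nu>)"
    if "\<phi> \<in> test_functions (bulk G)" for i \<phi>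
    using f g that by (auto simp: flux_fields_def)
  have bulk: "(\<integral>x. fst (u + u') i x \<bullet> grad \<phi> x \<partial>\<mu> i) = (\<integral>x. fst u i x \<bullet> grad \<phi> x \<partial>\<mu> i) + (\<integral>x. fst u' i x \<bullet> grad \<phi> x \<partial>\<mu> i)"
      "(\<integral>x. fst (s + s') i x * \<phi> x \<partial>\<mu> i) = (\<integral>x. fst s i x * \<phi> x \<partial>\<mu> i) + (\<integral>x. fst s' i x * \<phi> x \<partial>\<mu> i)"
    if "\<phi> \<in> test_functions D" for i \<phi> D
    using bulk_pairing[OF fD(1) fD(3) that] bulk_pairing[OF gD(1) gD(3) that]
    by (simp_all add: inner_add_left distrib_right)
  have cut: "(\<integral>y. snd (u + u') y \<bullet> grad \<phi> y \<partial>\<nu>) = (\<integral>y. snd u y \<bullet> grad \<phi> y \<partial>\<nu>) + (\<integral>y. snd u' y \<bullet> grad \<phi> y \<partial>\<nu>)"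
      "(\<integral>y. (snd (s + s') y + ((w + w') 1 y - (w + w') 2 y)) * \<phi> y \<partial>\<nu>) =
        (\<integral>y. (snd s y + (w 1 y - w 2 y)) * \<phi> y \<partial>\<nu>) + (\<integral>y. (snd s' y + (w' 1 y - w' 2 y)) * \<phi> y \<partial>\<nu>)"
    if "\<phi> \<in> test_functions D" for \<phi> D
  proof -
    show "(\<integral>y. snd (u + u') y \<bullet> grad \<phi> y \<partial>\<nu>) = (\<integral>y. snd u y \<bullet> grad \<phi> y \<partial>\<nu>) + (\<integral>y. snd u' y \<bullet> grad \<phi> y \<partial>\<nu>)"
      using cut_pairing(1)[OF that fD(2)] cut_pairing(1)[OF that gD(2)] by (simp add: inner_add_left)
    have "(snd (s + s') y + ((w + w') 1 y - (w + w') 2 y)) * \<phi> y =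
        (snd s y + (w 1 y - w 2 y)) * \<phi> y + (snd s' y + (w' 1 y - w' 2 y)) * \<phi> y" for y
      by (simp add: algebra_simps)
    then show "(\<integral>y. (snd (s + s') y + ((w + w') 1 y - (w + w') 2 y)) * \<phi> y \<partial>\<nu>) =
        (\<integral>y. (snd s y + (w 1 y - w 2 y)) * \<phi> y \<partial>\<nu>) + (\<integral>y. (snd s' y + (w' 1 y - w' 2 y)) * \<phi> y \<partial>\<nu>)"
      using cut_pairing(2)[OF that fD(6)] cut_pairing(2)[OF that gD(6)] by simp
  qed
  have chart: "(\<integral>y. (w + w') i y * \<phi> (chart G y) \<partial>\<nu>) = (\<integral>y. w i y * \<phi> (chart G y) \<partial>\<nu>) + (\<integral>y. w' i y * \<phi> (chart G y) \<partial>\<nu>)"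
    if "\<phi> \<in> test_functions D" for i \<phi> D
    using chart_pairing[OF that fD(5)] chart_pairing[OF that gD(5)] by (simp add: distrib_right)
  have Lps: "u + u' \<in> V_space G" "s + s' \<in> M_dual G" "\<And>i. (w + w') i \<in> Lp 2 \<nu>"
    using fD gD by (auto simp: V_space_def M_dual_def intro!: Lp_plus)
  show ?thesis
    unfolding flux_fields_def
  proof (intro CollectI case_prodI conjI allI ballI)
    fix i \<phi> assume "\<phi> \<in> test_functions (part G i)"
    from bulk[OF this, of i] fe[OF this]
    show "(\<integral>x. fst (u + u') i x \<bullet> grad \<phi> x \<partial>\<mu> i) = - (\<integral>x. fst (s + s') i x * \<phi> x \<partial>\<mu> i)" by simp
  next
    fix \<phi> assume "\<phi> \<in> test_functions (cut G)"
    from cut[OF this] fc[OF this]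
    show "(\<integral>y. snd (u + u') y \<bullet> grad \<phi> y \<partial>\<nu>) = - (\<integral>y. (snd (s + s') y + ((w + w') 1 y - (w + w') 2 y)) * \<phi> y \<partial>\<nu>)" by simp
  next
    fix i \<phi> assume "\<phi> \<in> test_functions (bulk G)"
    from bulk[OF this, of i] fn[OF this, of i] chart[OF this, of i]
    show "(\<integral>x. fst (u + u') i x \<bullet> grad \<phi> x \<partial>\<mu> i) + (\<integral>x. fst (s + s') i x * \<phi> x \<partial>\<mu> i) = side i * (\<integral>y. (w + w') i y * \<phi> (chart G y) \<partial>\<nu>)"
      by (simp add: distrib_left)
  qed (use Lps in auto)
qed

lemma fields_scale:
  assumes f: "(u, s, w) \<in> flux_fields G"
  shows "(c *\<^sub>R u, c *\<^sub>R s, c *\<^sub>R w) \<in> flux_fields G"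
proof -
  note fD = fieldsD[OF f]
  have Lps: "c *\<^sub>R u \<in> V_space G" "c *\<^sub>R s \<in> M_dual G" "\<And>i. (c *\<^sub>R w) i \<in> Lp 2 \<nu>"
    using fD by (auto simp: V_space_def M_dual_def intro!: Lp_scale)
  have e: "(c * snd s y + (c * w 1 y - c * w 2 y)) * \<phi> y = c * ((snd s y + (w 1 y - w 2 y)) * \<phi> y)" for y \<phi>
    by (simp add: algebra_simps)
  show ?thesis
    using f Lps unfolding flux_fields_def
    by (auto simp: e mult.assoc simp flip: distrib_left)
qed

text \<open>Each defining identity pairs the fields with fixed functions and so survives strong
  limits. The divergence \<open>s\<close> is the same for all \<open>k\<close>, because the
  minimisation takes place among fields of prescribed divergence.\<close>

lemma fields_limit:
  assumes f: "\<And>k. (U k, s, W k) \<in> flux_fields G"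
    and u: "\<And>i. fst u i \<in> Lp 3 (\<mu> i)" "snd u \<in> Lp 3 \<nu>" "\<And>i. w i \<in> Lp 2 \<nu>"
    and lim: "\<And>i. (\<lambda>k. cube_int (\<mu> i) (fst (U k) i - fst u i)) \<longlonglongrightarrow> 0"
      "(\<lambda>k. cube_int \<nu> (snd (U k) - snd u)) \<longlonglongrightarrow> 0"
      "\<And>i. (\<lambda>k. \<integral>y. (W k i y - w i y)\<^sup>2 \<partial>\<nu>) \<longlonglongrightarrow> 0"
  shows "(u, s, w) \<in> flux_fields G"
proof -
  note fD = fieldsD[OF f]
  have bulk: "(\<lambda>k. \<integral>x. fst (U k) i x \<bullet> grad \<phi> x \<partial>\<mu> i) \<longlonglongrightarrow> (\<integral>x. fst u i x \<bullet> grad \<phi> x \<partial>\<mu> i)" if "\<phi> \<in> test_functions D" for i \<phi> D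
    using lim(1)[of i] fD(1) u(1) test_function_Lp(2)[OF fin_part that]
    by (intro Lp_pairing_tendsto[where p = 3 and q = "3/2"]) (auto simp: cube_int_def powr_numeral)
  have cut: "(\<lambda>k. \<integral>x. snd (U k) x \<bullet> grad \<phi> x \<partial>\<nu>) \<longlonglongrightarrow> (\<integral>x. snd u x \<bullet> grad \<phi> x \<partial>\<nu>)" if "\<phi> \<in> test_functions D" for \<phi> D
    using lim(2) fD(2) u(2) test_function_Lp(2)[OF fin_cut that]
    by (intro Lp_pairing_tendsto[where p = 3 and q = "3/2"]) (auto simp: cube_int_def powr_numeral)
  have flux: "(\<lambda>k. \<integral>y. W k i y * h y \<partial>\<nu>) \<longlonglongrightarrow> (\<integral>y. w i y * h y \<partial>\<nu>)" if "h \<in> Lp 2 \<nu>" for i h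
    using lim(3)[of i] fD(5) u(3) that
      Lp_pairing_tendsto[where p = 2 and q = 2 and F = "\<lambda>k. W k i" and f = "w i" and g = h and M = \<nu>]
    by (simp add: powr_numeral)
  have S: "s \<in> M_dual G" using f[of 0] by (simp add: flux_fields_def)
  have wu: "(\<lambda>y. snd s y + (w 1 y - w 2 y)) \<in> Lp 2 \<nu>"
    by (intro Lp_add Lp_diff u Lp_mono_exponent[OF fin_cut _ _ fD(4)]) auto
  show ?thesis
    unfolding flux_fields_def
  proof (intro CollectI case_prodI conjI allI ballI)
    fix i \<phi> assume \<phi>: "\<phi> \<in> test_functions (part G i)"
    have "(\<lambda>k. \<integral>x. fst (U k) i x \<bullet> grad \<phi> x \<partial>\<mu> i) = (\<lambda>k. - (\<integral>x. fst s i x * \<phi> x \<partial>\<mu> i))"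
      using f \<phi> by (auto simp: flux_fields_def)
    then show "(\<integral>x. fst u i x \<bullet> grad \<phi> x \<partial>\<mu> i) = - (\<integral>x. fst s i x * \<phi> x \<partial>\<mu> i)"
      using bulk[OF \<phi>, of i] by (simp add: LIMSEQ_const_iff)
  next
    fix \<phi> assume \<phi>: "\<phi> \<in> test_functions (cut G)"
    have \<phi>2: "\<phi> \<in> Lp 2 \<nu>" by (rule test_function_Lp(1)[OF fin_cut \<phi>]) simp
    have ex: "(\<integral>y. (snd s y + (w 1 y - w 2 y)) * \<phi> y \<partial>\<nu>) =
        (\<integral>y. snd s y * \<phi> y \<partial>\<nu>) + ((\<integral>y. w 1 y * \<phi> y \<partial>\<nu>) - (\<integral>y. w 2 y * \<phi> y \<partial>\<nu>))"
      if "\<And>i. w i \<in> Lp 2 \<nu>" for w :: "2 \<Rightarrow> _"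
    proof -
      have "snd s \<in> Lp 2 \<nu>" by (rule Lp_mono_exponent[OF fin_cut _ _ fD(4)]) auto
      then show ?thesis using cut_pairing(2)[OF \<phi>] that by (simp add: distrib_right left_diff_distrib)
    qed
    have e1: "(\<lambda>k. \<integral>x. snd (U k) x \<bullet> grad \<phi> x \<partial>\<nu>) =
        (\<lambda>k. - ((\<integral>y. snd s y * \<phi> y \<partial>\<nu>) + ((\<integral>y. W k 1 y * \<phi> y \<partial>\<nu>) - (\<integral>y. W k 2 y * \<phi> y \<partial>\<nu>))))"
    proof
      fix k
      have "(\<integral>x. snd (U k) x \<bullet> grad \<phi> x \<partial>\<nu>) = - (\<integral>y. (snd s y + (W k 1 y - W k 2 y)) * \<phi> y \<partial>\<nu>)"
        using f[of k] \<phi> by (simp add: flux_fields_def)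
      then show "(\<integral>x. snd (U k) x \<bullet> grad \<phi> x \<partial>\<nu>) =
          - ((\<integral>y. snd s y * \<phi> y \<partial>\<nu>) + ((\<integral>y. W k 1 y * \<phi> y \<partial>\<nu>) - (\<integral>y. W k 2 y * \<phi> y \<partial>\<nu>)))"
        using ex[of "W k"] fD(5)[of k] by simp
    qed
    have e2: "(\<lambda>k. - ((\<integral>y. snd s y * \<phi> y \<partial>\<nu>) + ((\<integral>y. W k 1 y * \<phi> y \<partial>\<nu>) - (\<integral>y. W k 2 y * \<phi> y \<partial>\<nu>))))
        \<longlonglongrightarrow> - ((\<integral>y. snd s y * \<phi> y \<partial>\<nu>) + ((\<integral>y. w 1 y * \<phi> y \<partial>\<nu>) - (\<integral>y. w 2 y * \<phi> y \<partial>\<nu>)))"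
      by (intro tendsto_intros flux \<phi>2)
    show "(\<integral>y. snd u y \<bullet> grad \<phi> y \<partial>\<nu>) = - (\<integral>y. (snd s y + (w 1 y - w 2 y)) * \<phi> y \<partial>\<nu>)"
      using LIMSEQ_unique[OF cut[OF \<phi>, unfolded e1] e2] ex[of w] u(3) by simp
  next
    fix i \<phi> assume \<phi>: "\<phi> \<in> test_functions (bulk G)"
    have "(\<lambda>k. (\<integral>x. fst (U k) i x \<bullet> grad \<phi> x \<partial>\<mu> i) + (\<integral>x. fst s i x * \<phi> x \<partial>\<mu> i)) =
        (\<lambda>k. side i * (\<integral>y. W k i y * \<phi> (chart G y) \<partial>\<nu>))"
      using f \<phi> by (auto simp: flux_fields_def)
    moreover have "(\<lambda>k. side i * (\<integral>y. W k i y * \<phi> (chart G y) \<partial>\<nu>)) \<longlonglongrightarrow> side i * (\<integral>y. w i y * \<phi> (chart G y) \<partial>\<nu>)"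
      using test_chart_Lp[OF \<phi>, of 2] by (intro tendsto_intros flux) auto
    moreover have "(\<lambda>k. (\<integral>x. fst (U k) i x \<bullet> grad \<phi> x \<partial>\<mu> i) + (\<integral>x. fst s i x * \<phi> x \<partial>\<mu> i))
        \<longlonglongrightarrow> (\<integral>x. fst u i x \<bullet> grad \<phi> x \<partial>\<mu> i) + (\<integral>x. fst s i x * \<phi> x \<partial>\<mu> i)"
      by (intro tendsto_intros bulk[OF \<phi>])
    ultimately show "(\<integral>x. fst u i x \<bullet> grad \<phi> x \<partial>\<mu> i) + (\<integral>x. fst s i x * \<phi> x \<partial>\<mu> i)
        = side i * (\<integral>y. w i y * \<phi> (chart G y) \<partial>\<nu>)" using LIMSEQ_unique by auto
  qed (use u S in \<open>auto simp: V_space_def\<close>)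
qed

end

section \<open>A bounded right inverse of the divergence\<close>

lemma test_function_mono: "\<phi> \<in> test_functions D \<Longrightarrow> D \<subseteq> D' \<Longrightarrow> \<phi> \<in> test_functions D'"
  by (auto simp: test_functions_def)

lemma test_function_line_derivative:
  assumes "\<phi> \<in> test_functions D"
  shows "((\<lambda>t. \<phi> (y + t *\<^sub>R e)) has_real_derivative grad \<phi> (y + t *\<^sub>R e) \<bullet> e) (at t)"
proof -
  have 1: "(\<phi> has_derivative frechet_derivative \<phi> (at (y + t *\<^sub>R e))) (at (y + t *\<^sub>R e))"
    using test_functionD(1)[OF assms] frechet_derivative_works by blast
  have 2: "((\<lambda>t. y + t *\<^sub>R e) has_derivative (\<lambda>h. h *\<^sub>R e)) (at t)"
    by (auto intro!: derivative_eq_intros)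
  have "((\<lambda>t. \<phi> (y + t *\<^sub>R e)) has_derivative (\<lambda>h. frechet_derivative \<phi> (at (y + t *\<^sub>R e)) (h *\<^sub>R e))) (at t)"
    by (rule has_derivative_compose[OF 2 1])
  then show ?thesis
    unfolding has_field_derivative_def test_functionD(4)[OF assms] by (simp add: mult.commute[of _ "_ \<bullet> _"])
qed

lemma test_function_borel:
  assumes "\<phi> \<in> test_functions D"
  shows "\<phi> \<in> borel_measurable borel" "(\<lambda>x. grad \<phi> x \<bullet> e) \<in> borel_measurable borel"
  using test_functionD(2,3)[OF assms] by (auto intro!: borel_measurable_continuous_onI continuous_intros)

lemma cube_int_direction:
  assumes "norm e = 1"
  shows "cube_int M (\<lambda>x. U x *\<^sub>R e) = cube_int M U"
  using assms by (simp add: cube_int_def)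

lemma Lp_direction:
  assumes "norm e = 1" "U \<in> Lp p M"
  shows "(\<lambda>x. U x *\<^sub>R e) \<in> Lp p M"
  using assms by (auto simp: Lp_def)

text \<open>The field is an antiderivative of \<open>s\<close> times \<open>e\<close>. Testing with
  functions supported in \<open>D'\<close> rather than in \<open>D\<close> encodes that it has no
  normal flux through the part of the boundary of \<open>D\<close> inside \<open>D'\<close>. This
  holds since almost every line, while in \<open>D'\<close>, stays in the union of the disjoint open
  sets \<open>D\<close> and \<open>E\<close>, so the cut-off test function does not jump along
  it.\<close>

lemma divergence_along_lines:
  fixes e :: "'a::euclidean_space"
  assumes D: "open D" "bounded D" and e: "norm e = 1" and E: "open E" "D \<inter> E = {}"
    and line: "AE y in lborel. \<forall>t. y + t *\<^sub>R e \<in> D' \<longrightarrow> y + t *\<^sub>R e \<in> D \<union> E"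
  obtains C where "\<And>s. s \<in> Lp 3 (lebesgue_on D) \<Longrightarrow> \<exists>v\<in>Lp 3 (lebesgue_on D).
    cube_int (lebesgue_on D) v \<le> C * cube_int (lebesgue_on D) s \<and>
    (\<forall>\<phi>\<in>test_functions D'. (\<integral>x. v x \<bullet> grad \<phi> x \<partial>lebesgue_on D) = - (\<integral>x. s x * \<phi> x \<partial>lebesgue_on D))"
proof -
  have Db: "D \<in> sets borel" using D by simp
  obtain C where C: "\<And>s. s \<in> Lp 3 (lebesgue_on D) \<Longrightarrow> \<exists>U\<in>Lp 3 (lebesgue_on D).
      cube_int (lebesgue_on D) U \<le> C * cube_int (lebesgue_on D) s \<and> weak_line_primitive D e s U"
    using directional_antiderivative[OF Db D(2) e] by blast
  have "\<exists>v\<in>Lp 3 (lebesgue_on D). cube_int (lebesgue_on D) v \<le> C * cube_int (lebesgue_on D) s \<and>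
      (\<forall>\<phi>\<in>test_functions D'. (\<integral>x. v x \<bullet> grad \<phi> x \<partial>lebesgue_on D) = - (\<integral>x. s x * \<phi> x \<partial>lebesgue_on D))"
    if s: "s \<in> Lp 3 (lebesgue_on D)" for s
  proof -
    obtain U where U: "U \<in> Lp 3 (lebesgue_on D)" "cube_int (lebesgue_on D) U \<le> C * cube_int (lebesgue_on D) s"
      and adj: "weak_line_primitive D e s U" using C[OF s] by blast
    have "(\<integral>x. (U x *\<^sub>R e) \<bullet> grad \<phi> x \<partial>lebesgue_on D) = - (\<integral>x. s x * \<phi> x \<partial>lebesgue_on D)"
      if \<phi>: "\<phi> \<in> test_functions D'" for \<phi>
    proof -
      obtain K B where K: "compact K" "K \<subseteq> D'" "\<And>x. x \<notin> K \<Longrightarrow> \<phi> x = 0" "\<And>x. norm (grad \<phi> x) \<le> B"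
        using test_functionD(5)[OF \<phi>] by blast
      define \<psi> where "\<psi> x = indicator D x * \<phi> x" for x
      define g where "g x = indicator D x * (grad \<phi> x \<bullet> e)" for x
      have der: "((\<lambda>t. \<psi> (y + t *\<^sub>R e)) has_real_derivative g (y + t *\<^sub>R e)) (at t)"
        if y: "y + t *\<^sub>R e \<in> D' \<longrightarrow> y + t *\<^sub>R e \<in> D \<union> E" for y t
      proof -
        have open_line: "open {t. y + t *\<^sub>R e \<in> O'}" if "open O'" for O'
        proof -
          have "continuous_on UNIV (\<lambda>t. y + t *\<^sub>R e)" by (intro continuous_intros)
          then show ?thesis using that open_vimage[of O' "\<lambda>t. y + t *\<^sub>R e"] by (simp add: vimage_def)
        qed
        show ?thesis
        proof (cases "y + t *\<^sub>R e \<in> D")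
          case True
          then have "((\<lambda>t. \<phi> (y + t *\<^sub>R e)) has_real_derivative g (y + t *\<^sub>R e)) (at t)"
            using test_function_line_derivative[OF \<phi>, of y e t] by (simp add: g_def)
          then show ?thesis
            by (rule has_field_derivative_transform_within_open[OF _ open_line[OF D(1)]])
               (use True in \<open>auto simp: \<psi>_def\<close>)
        next
          case False
          \<comment> \<open>A neighbourhood on which \<open>\<psi>\<close> vanishes: a point outside
            of \<open>D\<close> lies either in \<open>E\<close>, or outside of \<open>D'\<close> and
            hence off the compact set \<open>K\<close> that carries \<open>\<phi>\<close>.\<close>
          define O' where "O' = E \<union> - K"
          have "open O'" using E(1) compact_imp_closed[OF K(1)] by (simp add: O'_def open_Un open_Compl)
          have inside: "y + t *\<^sub>R e \<in> O'" using y False K(2) unfolding O'_def by blast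
          have zero: "0 = \<psi> x" if "x \<in> O'" for x
            using that E(2) K(3)[of x] by (auto simp: O'_def \<psi>_def indicator_def)
          have "((\<lambda>t. 0) has_real_derivative g (y + t *\<^sub>R e)) (at t)" using False by (simp add: g_def)
          then show ?thesis
            by (rule has_field_derivative_transform_within_open[OF _ open_line[OF \<open>open O'\<close>]])
               (use inside zero in simp_all)
        qed
      qed
      have "(\<integral>x. U x * g x \<partial>lebesgue_on D) = - (\<integral>x. s x * \<psi> x \<partial>lebesgue_on D)"
      proof (rule adj[unfolded weak_line_primitive_def, rule_format])
        show "\<psi> \<in> borel_measurable borel" "g \<in> borel_measurable borel"
          unfolding \<psi>_def[abs_def] g_def[abs_def]
          using test_function_borel[OF \<phi>] Db by (auto intro!: borel_measurable_times)
        show "\<bar>g x\<bar> \<le> B" for x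
        proof -
          have "\<bar>grad \<phi> x \<bullet> e\<bar> \<le> norm (grad \<phi> x) * norm e" by (rule Cauchy_Schwarz_ineq2)
          then have "\<bar>grad \<phi> x \<bullet> e\<bar> \<le> B" using K(4)[of x] e by simp
          then show ?thesis by (auto simp: g_def indicator_def)
        qed
        show "AE y in lborel. \<forall>t. ((\<lambda>t. \<psi> (y + t *\<^sub>R e)) has_real_derivative g (y + t *\<^sub>R e)) (at t)"
          using line by eventually_elim (use der in blast)
      qed (auto simp: \<psi>_def g_def)
      moreover have "(\<integral>x. U x * g x \<partial>lebesgue_on D) = (\<integral>x. (U x *\<^sub>R e) \<bullet> grad \<phi> x \<partial>lebesgue_on D)"
        by (rule Bochner_Integration.integral_cong) (auto simp: g_def inner_commute)
      moreover have "(\<integral>x. s x * \<psi> x \<partial>lebesgue_on D) = (\<integral>x. s x * \<phi> x \<partial>lebesgue_on D)"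
        by (rule Bochner_Integration.integral_cong) (auto simp: \<psi>_def)
      ultimately show ?thesis by simp
    qed
    then show ?thesis
      using Lp_direction[OF e U(1)] U(2) cube_int_direction[OF e, of "lebesgue_on D" U]
      by (intro bexI[of _ "\<lambda>x. U x *\<^sub>R e"]) auto
  qed
  then show ?thesis using that by blast
qed

context fractured
begin

lemma range_chart_null: "AE y in lborel. y \<notin> range (chart G)"
proof -
  obtain x0 T where T: "linear T" "\<And>y. norm (T y) = norm y" "chart G = (\<lambda>y. x0 + T y)"
    using chart_isometry by blast
  have "dim (range T) \<le> dim (UNIV :: (real^'m) set)" by (rule dim_image_le[OF T(1)])
  also have "\<dots> < DIM(real^'n)" using dims by simp
  finally have "negligible (range T)" by (rule negligible_lowdim)
  then have "negligible ((+) x0 ` range T)" by (rule negligible_translation)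
  then have "range (chart G) \<in> null_sets lebesgue"
    by (simp add: T(3) image_image negligible_iff_null_sets)
  then have "AE y in lebesgue. y \<notin> range (chart G)" by (rule AE_not_in)
  then show ?thesis by (simp add: AE_completion_iff)
qed

text \<open>A line parallel to the fracture which does not lie in its hyperplane passes from one subdomain to the other
  only outside of the bulk domain. Hence the field has no flux through the fracture.\<close>

lemma bulk_right_inverse:
  obtains C where "\<And>s. s \<in> Lp 3 (\<mu> i) \<Longrightarrow> \<exists>v\<in>Lp 3 (\<mu> i). cube_int (\<mu> i) v \<le> C * cube_int (\<mu> i) s \<and>
    (\<forall>\<phi>\<in>test_functions (bulk G). (\<integral>x. v x \<bullet> grad \<phi> x \<partial>\<mu> i) = - (\<integral>x. s x * \<phi> x \<partial>\<mu> i))"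
proof -
  obtain x0 T where T: "linear T" "\<And>y. norm (T y) = norm y" "chart G = (\<lambda>y. x0 + T y)"
    using chart_isometry by blast
  obtain b :: "real^'m" where b: "norm b = 1" using vector_choose_size[of 1] by auto
  have off: "y + t *\<^sub>R T b \<notin> fracture G" if y: "y \<notin> range (chart G)" for y t
  proof
    assume "y + t *\<^sub>R T b \<in> fracture G"
    then obtain z where "y + t *\<^sub>R T b = x0 + T z" by (auto simp: T(3) fracture_def)
    then have "y = x0 + T (z - t *\<^sub>R b)"
      by (simp add: linear_diff[OF T(1)] linear_cmul[OF T(1)] algebra_simps)
    then show False using y by (simp add: T(3))
  qed
  \<comment> \<open>The other subdomain, written so that both values of \<open>i\<close> are treated
    at once.\<close>
  define E where "E = (\<Union>j\<in>- {i}. part G j)"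
  have "part G j \<inter> part G i = {}" if "j \<noteq> i" for j
    using parts_disjoint exhaust_2[of i] exhaust_2[of j] that by (metis Int_commute)
  then have E: "open E" "part G i \<inter> E = {}" using part_open by (auto simp: E_def)
  have cover: "bulk G \<subseteq> part G i \<union> E \<union> fracture G" using bulk_eq by (auto simp: E_def)
  have line: "AE y in lborel. \<forall>t. y + t *\<^sub>R T b \<in> bulk G \<longrightarrow> y + t *\<^sub>R T b \<in> part G i \<union> E"
    using range_chart_null by eventually_elim (use off cover in blast)
  have "norm (T b) = 1" using T(2)[of b] b by simp
  show ?thesis
    by (rule divergence_along_lines[OF part_open part_bounded \<open>norm (T b) = 1\<close> E line]) (erule that)
qed

lemma cut_right_inverse:
  obtains C where "\<And>s. s \<in> Lp 3 \<nu> \<Longrightarrow> \<exists>v\<in>Lp 3 \<nu>. cube_int \<nu> v \<le> C * cube_int \<nu> s \<and>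
    (\<forall>\<phi>\<in>test_functions (cut G). (\<integral>x. v x \<bullet> grad \<phi> x \<partial>\<nu>) = - (\<integral>x. s x * \<phi> x \<partial>\<nu>))"
proof -
  obtain b :: "real^'m" where b: "norm b = 1" using vector_choose_size[of 1] by auto
  \<comment> \<open>With \<open>E = {}\<close> and both domains equal to \<open>cut G\<close> the
    condition on lines is trivial.\<close>
  show ?thesis
    by (rule divergence_along_lines[OF cut_open cut_bounded b, of "{}" "cut G"], simp, simp, simp) (erule that)
qed

text \<open>Zero flux decouples the three equations: the jump disappears from the divergence on
  \<gamma>, so the bulk and fracture parts can be inverted separately. The estimates between cube
  integrals bound the right inverse in \<open>L^3\<close>.\<close>

proposition divergence_right_inverse:
  obtains C where "0 \<le> C" "\<And>s. s \<in> M_dual G \<Longrightarrow> \<exists>v. (v, s, 0) \<in> flux_fields G \<and>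
    (\<forall>i. cube_int (\<mu> i) (fst v i) \<le> C * cube_int (\<mu> i) (fst s i)) \<and> cube_int \<nu> (snd v) \<le> C * cube_int \<nu> (snd s)"
proof -
  define inv where "inv i s v \<longleftrightarrow> v \<in> Lp 3 (\<mu> i) \<and>
    (\<forall>\<phi>\<in>test_functions (bulk G). (\<integral>x. v x \<bullet> grad \<phi> x \<partial>\<mu> i) = - (\<integral>x. s x * \<phi> x \<partial>\<mu> i))"
    for i and s :: "real^'n \<Rightarrow> real" and v
  have "\<exists>C. \<forall>s\<in>Lp 3 (\<mu> i). \<exists>v. inv i s v \<and> cube_int (\<mu> i) v \<le> C * cube_int (\<mu> i) s" for i
    unfolding inv_def by (rule bulk_right_inverse[of i]) blast
  then obtain Ci where Ci: "\<And>i. \<forall>s\<in>Lp 3 (\<mu> i). \<exists>v. inv i s v \<and> cube_int (\<mu> i) v \<le> Ci i * cube_int (\<mu> i) s"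
    by metis
  obtain Cc where Cc: "\<And>s. s \<in> Lp 3 \<nu> \<Longrightarrow> \<exists>v\<in>Lp 3 \<nu>. cube_int \<nu> v \<le> Cc * cube_int \<nu> s \<and>
    (\<forall>\<phi>\<in>test_functions (cut G). (\<integral>x. v x \<bullet> grad \<phi> x \<partial>\<nu>) = - (\<integral>x. s x * \<phi> x \<partial>\<nu>))"
    using cut_right_inverse by blast
  define C where "C = \<bar>Cc\<bar> + (\<Sum>i\<in>UNIV. \<bar>Ci i\<bar>)"
  have C: "Cc \<le> C" "Ci i \<le> C" "0 \<le> C" for i
  proof -
    have "\<bar>Ci i\<bar> \<le> (\<Sum>i\<in>UNIV. \<bar>Ci i\<bar>)" by (rule member_le_sum) auto
    then show "Ci i \<le> C" by (simp add: C_def)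
    have "0 \<le> (\<Sum>i\<in>UNIV. \<bar>Ci i\<bar>)" by (rule sum_nonneg) auto
    then show "Cc \<le> C" "0 \<le> C" unfolding C_def by linarith+
  qed
  have "\<exists>v. (v, s, 0) \<in> flux_fields G \<and>
    (\<forall>i. cube_int (\<mu> i) (fst v i) \<le> C * cube_int (\<mu> i) (fst s i)) \<and> cube_int \<nu> (snd v) \<le> C * cube_int \<nu> (snd s)"
    if s: "s \<in> M_dual G" for s
  proof -
    have sL: "fst s i \<in> Lp 3 (\<mu> i)" "snd s \<in> Lp 3 \<nu>" for i using s by (auto simp: M_dual_def)
    have "\<exists>v. inv i (fst s i) v \<and> cube_int (\<mu> i) v \<le> Ci i * cube_int (\<mu> i) (fst s i)" for i
      using Ci sL(1) by blast
    then obtain V where V': "\<And>i. inv i (fst s i) (V i) \<and> cube_int (\<mu> i) (V i) \<le> Ci i * cube_int (\<mu> i) (fst s i)"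
      by metis
    then have V: "\<And>i. V i \<in> Lp 3 (\<mu> i)" "\<And>i. cube_int (\<mu> i) (V i) \<le> Ci i * cube_int (\<mu> i) (fst s i)"
      "\<And>i \<phi>. \<phi> \<in> test_functions (bulk G) \<Longrightarrow> (\<integral>x. V i x \<bullet> grad \<phi> x \<partial>\<mu> i) = - (\<integral>x. fst s i x * \<phi> x \<partial>\<mu> i)"
      unfolding inv_def by blast+
    obtain v where v: "v \<in> Lp 3 \<nu>" "cube_int \<nu> v \<le> Cc * cube_int \<nu> (snd s)"
      "\<And>\<phi>. \<phi> \<in> test_functions (cut G) \<Longrightarrow> (\<integral>x. v x \<bullet> grad \<phi> x \<partial>\<nu>) = - (\<integral>x. snd s x * \<phi> x \<partial>\<nu>)"
      using Cc[OF sL(2)] by blast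
    have sub: "part G i \<subseteq> bulk G" for i using bulk_eq exhaust_2[of i] by blast
    have "((V, v), s, 0) \<in> flux_fields G"
      unfolding flux_fields_def
      using V(1) V(3) v(1) v(3) s test_function_mono[OF _ sub] by (auto simp: V_space_def Lp_0 zero_fun_def)
    moreover have "cube_int (\<mu> i) (V i) \<le> C * cube_int (\<mu> i) (fst s i)" for i
      using V(2)[of i] mult_right_mono[OF C(2)[of i] cube_int_nonneg[of "\<mu> i" "fst s i"]] by linarith
    moreover have "cube_int \<nu> v \<le> C * cube_int \<nu> (snd s)"
      using v(2) mult_right_mono[OF C(1) cube_int_nonneg[of \<nu> "snd s"]] by linarith
    ultimately show ?thesis by (intro exI[of _ "(V, v)"]) auto
  qed
  with C(3) show ?thesis using that by blast
qed

end

section \<open>The energy of the coupled problem\<close>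

lemma two_arith: "(1::2) + 1 = 2" "(2::2) + 1 = 1"
  by simp_all

lemma Lp_2_times_bounded:
  assumes "k \<in> borel_measurable M" "\<And>x. x \<in> space M \<Longrightarrow> \<bar>k x\<bar> \<le> B" "w \<in> Lp 2 M"
  shows "(\<lambda>x. k x * w x :: real) \<in> Lp 2 M"
proof (rule Lp_bound)
  show "integrable M (\<lambda>x. B\<^sup>2 * (w x)\<^sup>2)" using assms(3) by (simp add: Lp_2_square)
  show "(\<lambda>x. k x * w x) \<in> borel_measurable M" using assms(1) LpD(1)[OF assms(3)] by simp
  show "AE x in M. norm (k x * w x) powr 2 \<le> B\<^sup>2 * (w x)\<^sup>2"
  proof (rule AE_I2)
    fix x assume "x \<in> space M"
    from assms(2)[OF this] have "(k x)\<^sup>2 \<le> B\<^sup>2" by (simp add: abs_le_square_iff[symmetric])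
    then show "norm (k x * w x) powr 2 \<le> B\<^sup>2 * (w x)\<^sup>2"
      by (simp add: powr_numeral power_mult_distrib mult_right_mono)
  qed
qed

section \<open>The quadratic flux energy on the fracture\<close>

locale flux_coupling =
  fixes M :: "'x measure" and \<kappa> :: "'x \<Rightarrow> real" and \<xi> kl kh :: real
  assumes \<kappa>: "\<kappa> \<in> borel_measurable M" "0 < kl" "\<And>x. x \<in> space M \<Longrightarrow> kl \<le> \<kappa> x" "\<And>x. x \<in> space M \<Longrightarrow> \<kappa> x \<le> kh"
    and \<xi>: "1 / 2 < \<xi>"
begin

definition coupling :: "(2 \<Rightarrow> 'x \<Rightarrow> real) \<Rightarrow> 2 \<Rightarrow> 'x \<Rightarrow> real" where
  "coupling w i x = \<kappa> x * (\<xi> * w i x + (1 - \<xi>) * w (i + 1) x)"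

definition flux_form :: "(2 \<Rightarrow> 'x \<Rightarrow> real) \<Rightarrow> (2 \<Rightarrow> 'x \<Rightarrow> real) \<Rightarrow> real" where
  "flux_form w z = (\<Sum>i\<in>UNIV. \<integral>x. coupling w i x * z i x \<partial>M)"

definition flux_square :: "(2 \<Rightarrow> 'x \<Rightarrow> real) \<Rightarrow> real" where
  "flux_square w = (\<Sum>i\<in>UNIV. \<integral>x. (w i x)\<^sup>2 \<partial>M)"

text \<open>Half of the lower bound of \<kappa> times the smaller eigenvalue of the coupling matrix;
  the half reflects that the flux energy is half the quadratic form.\<close>

definition flux_const :: real where
  "flux_const = kl * min 1 (2 * \<xi> - 1) / 2"

lemma flux_const_pos: "0 < flux_const"
  using \<kappa>(2) \<xi> by (simp add: flux_const_def)

lemma coupling_Lp: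
  assumes "\<And>i. w i \<in> Lp 2 M"
  shows "coupling w i \<in> Lp 2 M"
  unfolding coupling_def[abs_def]
proof (rule Lp_2_times_bounded[OF \<kappa>(1)])
  show "\<bar>\<kappa> x\<bar> \<le> kh" if "x \<in> space M" for x using \<kappa>(2) \<kappa>(3,4)[OF that] by simp
  show "(\<lambda>x. \<xi> * w i x + (1 - \<xi>) * w (i + 1) x) \<in> Lp 2 M"
    using Lp_add[OF _ Lp_scaleR[OF assms[of i], of \<xi>] Lp_scaleR[OF assms[of "i + 1"], of "1 - \<xi>"]] by simp
qed

lemma coupling_integrable:
  assumes "\<And>i. w i \<in> Lp 2 M" "z \<in> Lp 2 M"
  shows "integrable M (\<lambda>x. coupling w i x * z x)"
  using Lp_pairing_2(1)[OF coupling_Lp[of w i, OF assms(1)] assms(2)] by simp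

lemma flux_form_2: "flux_form w z = (\<integral>x. coupling w 1 x * z 1 x \<partial>M) + (\<integral>x. coupling w 2 x * z 2 x \<partial>M)"
  by (simp add: flux_form_def sum_2)

lemma flux_form_single:
  assumes "\<And>i. w i \<in> Lp 2 M" "\<And>i. z i \<in> Lp 2 M"
  shows "integrable M (\<lambda>x. coupling w 1 x * z 1 x + coupling w 2 x * z 2 x)"
    and "flux_form w z = (\<integral>x. coupling w 1 x * z 1 x + coupling w 2 x * z 2 x \<partial>M)"
  using coupling_integrable[of w "z 1" 1, OF assms(1) assms(2)] coupling_integrable[of w "z 2" 2, OF assms(1) assms(2)]
  by (auto simp: flux_form_2)

text \<open>The coupling matrix is symmetric, so the two mixed terms coincide and the expansion is
  exact.\<close>

lemma flux_form_expand:
  assumes w: "\<And>i. w i \<in> Lp 2 M" and z: "\<And>i. z i \<in> Lp 2 M"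
  shows "flux_form (w + z) (w + z) / 2 = flux_form w w / 2 + flux_form w z + flux_form z z / 2"
proof -
  have wz: "(w + z) i \<in> Lp 2 M" for i using Lp_plus[OF _ w[of i] z[of i]] by simp
  have "flux_form (w + z) (w + z) = (\<integral>x. (coupling w 1 x * w 1 x + coupling w 2 x * w 2 x)
      + 2 * (coupling w 1 x * z 1 x + coupling w 2 x * z 2 x) + (coupling z 1 x * z 1 x + coupling z 2 x * z 2 x) \<partial>M)"
    unfolding flux_form_single(2)[of "w + z" "w + z", OF wz wz]
    unfolding coupling_def two_arith
    by (intro Bochner_Integration.integral_cong) (simp_all add: algebra_simps)
  also have "\<dots> = flux_form w w + 2 * flux_form w z + flux_form z z"
    using flux_form_single[of w w, OF w w] flux_form_single[of w z, OF w z] flux_form_single[of z z, OF z z]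
    by (simp del: distrib_left_numeral distrib_right_numeral)
  finally show ?thesis by simp
qed

lemma flux_form_lower:
  assumes z: "\<And>i. z i \<in> Lp 2 M"
  shows "flux_const * flux_square z \<le> flux_form z z / 2"
proof -
  have sq: "integrable M (\<lambda>x. (z i x)\<^sup>2)" for i using z[of i] by (simp add: Lp_2_square)
  have "flux_const * flux_square z = (\<integral>x. flux_const * ((z 1 x)\<^sup>2 + (z 2 x)\<^sup>2) \<partial>M)"
    using sq by (simp add: flux_square_def sum_2 distrib_left)
  also have "\<dots> \<le> (\<integral>x. (coupling z 1 x * z 1 x + coupling z 2 x * z 2 x) / 2 \<partial>M)"
  proof (rule integral_mono)
    show "integrable M (\<lambda>x. flux_const * ((z 1 x)\<^sup>2 + (z 2 x)\<^sup>2))" using sq by simp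
    show "integrable M (\<lambda>x. (coupling z 1 x * z 1 x + coupling z 2 x * z 2 x) / 2)"
      using flux_form_single(1)[of z z, OF z z] by simp
    fix x assume x: "x \<in> space M"
    define a b m where "a = z 1 x" and "b = z 2 x" and "m = min 1 (2 * \<xi> - 1)"
    have m: "0 < m" "m \<le> 1" "m \<le> 2 * \<xi> - 1" using \<xi> by (auto simp: m_def)
    \<comment> \<open>Sum and difference of the fluxes are the eigendirections of the coupling
      matrix, with eigenvalues 1 and \<open>2 * \<xi> - 1\<close>; \<open>m\<close> bounds both from
      below.\<close>
    have "2 * (m * (a\<^sup>2 + b\<^sup>2)) = m * (a + b)\<^sup>2 + m * (a - b)\<^sup>2"
      by (simp add: power2_eq_square algebra_simps)
    also have "\<dots> \<le> 1 * (a + b)\<^sup>2 + (2 * \<xi> - 1) * (a - b)\<^sup>2"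
      using m by (intro add_mono mult_right_mono) auto
    also have "\<dots> = 2 * (\<xi> * (a\<^sup>2 + b\<^sup>2) + 2 * (1 - \<xi>) * a * b)"
      by (simp add: power2_eq_square algebra_simps)
    finally have q: "m * (a\<^sup>2 + b\<^sup>2) \<le> \<xi> * (a\<^sup>2 + b\<^sup>2) + 2 * (1 - \<xi>) * a * b" by simp
    have "kl * (m * (a\<^sup>2 + b\<^sup>2)) \<le> \<kappa> x * (m * (a\<^sup>2 + b\<^sup>2))"
      using \<kappa>(3)[OF x] m by (intro mult_right_mono) auto
    also have "\<dots> \<le> \<kappa> x * (\<xi> * (a\<^sup>2 + b\<^sup>2) + 2 * (1 - \<xi>) * a * b)"
      using \<kappa>(2) \<kappa>(3)[OF x] q by (intro mult_left_mono) auto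
    also have "\<dots> = coupling z 1 x * z 1 x + coupling z 2 x * z 2 x"
      unfolding coupling_def two_arith a_def b_def by (simp add: power2_eq_square algebra_simps)
    finally show "flux_const * ((z 1 x)\<^sup>2 + (z 2 x)\<^sup>2) \<le> (coupling z 1 x * z 1 x + coupling z 2 x * z 2 x) / 2"
      by (simp add: flux_const_def a_def b_def m_def)
  qed
  also have "\<dots> = flux_form z z / 2" using flux_form_single[of z z, OF z z] by simp
  finally show ?thesis .
qed

lemma flux_square_nonneg: "0 \<le> flux_square w"
  unfolding flux_square_def by (intro sum_nonneg integral_nonneg_AE) auto

lemma flux_square_scale: "flux_square (c *\<^sub>R w) = c\<^sup>2 * flux_square w"
  by (simp add: flux_square_def power_mult_distrib sum_distrib_left)

lemma flux_form_scale: "flux_form w (c *\<^sub>R z) = c * flux_form w z" "flux_form (c *\<^sub>R w) (c *\<^sub>R z) = c\<^sup>2 * flux_form w z"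
proof -
  have "coupling (c *\<^sub>R w) i x * (c *\<^sub>R z) i x = c\<^sup>2 * (coupling w i x * z i x)" for i x
    by (simp add: coupling_def power2_eq_square algebra_simps)
  then show "flux_form (c *\<^sub>R w) (c *\<^sub>R z) = c\<^sup>2 * flux_form w z"
    unfolding flux_form_def by (simp only: integral_mult_right_zero sum_distrib_left)
  have "coupling w i x * (c *\<^sub>R z) i x = c * (coupling w i x * z i x)" for i x
    by simp
  then show "flux_form w (c *\<^sub>R z) = c * flux_form w z"
    unfolding flux_form_def by (simp only: integral_mult_right_zero sum_distrib_left)
qed

end

lemma elliptic_positive_darcy_forchheimer:
  fixes D :: "(real^'k::finite) set"
  assumes A: "elliptic_on D A" and b: "positive_bounded_on D b" and fin: "finite_measure (lebesgue_on D)"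
    and D: "D \<in> sets lebesgue"
  shows "\<exists>ah bl bh. darcy_forchheimer (lebesgue_on D) (\<lambda>x v. A x *v v) b ah bl bh"
proof -
  obtain lo hi where A': "A \<in> borel_measurable (lebesgue_on D)" "\<And>y. y \<in> D \<Longrightarrow> transpose (A y) = A y" "0 < lo"
    "\<And>y x. y \<in> D \<Longrightarrow> lo * (norm x)\<^sup>2 \<le> x \<bullet> (A y *v x)" "\<And>y x. y \<in> D \<Longrightarrow> x \<bullet> (A y *v x) \<le> hi * (norm x)\<^sup>2"
    using A unfolding elliptic_on_def by blast
  obtain bl bh where b': "b \<in> borel_measurable (lebesgue_on D)" "0 < bl" "\<And>y. y \<in> D \<Longrightarrow> bl \<le> b y" "\<And>y. y \<in> D \<Longrightarrow> b y \<le> bh"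
    using b unfolding positive_bounded_on_def by blast
  have lin: "linear (\<lambda>v. B *v v)" for B :: "real^'k^'k" by simp
  \<comment> \<open>Bilinearity of the matrix-vector product makes \<open>A x *v f x\<close>
    measurable in \<open>x\<close>.\<close>
  have "linear (\<lambda>B :: real^'k^'k. B *v v)" for v
    by (simp add: linear_iff matrix_vector_mult_add_rdistrib scaleR_matrix_vector_assoc)
  then have bil: "bilinear (\<lambda>(B :: real^'k^'k) v. B *v v)" using lin by (auto simp: bilinear_def)
  have "darcy_forchheimer (lebesgue_on D) (\<lambda>x v. A x *v v) b hi bl bh"
  proof (intro darcy_forchheimer.intro fin darcy_forchheimer_axioms.intro)
    fix x u v assume x: "x \<in> space (lebesgue_on D)"
    then have xD: "x \<in> D" by simp
    show "linear (\<lambda>v. A x *v v)" by (rule lin)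
    show "(A x *v u) \<bullet> v = (A x *v v) \<bullet> u"
      using A'(2)[OF xD] dot_lmul_matrix[of u "A x" v] by (metis inner_commute transpose_matrix_vector)
    have "0 \<le> lo * (norm u)\<^sup>2" using A'(3) by simp
    then show "0 \<le> (A x *v u) \<bullet> u" using A'(4)[OF xD, of u] by (simp add: inner_commute)
    show "(A x *v u) \<bullet> u \<le> hi * (norm u)\<^sup>2" using A'(5)[OF xD, of u] by (simp add: inner_commute)
    show "bl \<le> b x" "b x \<le> bh" using b' xD by auto
  next
    fix f :: "real^'k \<Rightarrow> real^'k" assume "f \<in> borel_measurable (lebesgue_on D)"
    then show "(\<lambda>x. A x *v f x) \<in> borel_measurable (lebesgue_on D)"
      using borel_measurable_bilinear[OF bil A'(1)] D by simp
  qed (use b' in auto)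
  then show ?thesis by blast
qed

section \<open>Energy, form and size of a coupled field\<close>

locale fracture_model = fractured G for G :: "('n::finite, 'm::finite) geometry" +
  fixes C :: "('n, 'm) coefficients"
  assumes adm: "admissible_coefficients G C"
begin

text \<open>The hypotheses assert only that ellipticity and boundedness constants exist. Fixing them
  as terms, packed into a tuple for a single choice, lets the locale be instantiated for both
  subdomains.\<close>

definition bulk_consts :: "2 \<Rightarrow> real \<times> real \<times> real" where
  "bulk_consts i = (SOME c. darcy_forchheimer (\<mu> i) (\<lambda>x v. alpha C i x *v v) (beta C i)
    (fst c) (fst (snd c)) (snd (snd c)))"

definition cut_consts :: "real \<times> real \<times> real" where
  "cut_consts = (SOME c. darcy_forchheimer \<nu> (\<lambda>x v. alpha_cut C x *v v) (beta_cut C)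
    (fst c) (fst (snd c)) (snd (snd c)))"

definition kappa_consts :: "real \<times> real" where
  "kappa_consts = (SOME c. flux_coupling \<nu> (kappa C) (xi C) (fst c) (snd c))"

sublocale bulk: darcy_forchheimer "\<mu> i" "\<lambda>x v. alpha C i x *v v" "beta C i"
    "fst (bulk_consts i)" "fst (snd (bulk_consts i))" "snd (snd (bulk_consts i))" for i
proof -
  have "elliptic_on (part G i) (alpha C i)" "positive_bounded_on (part G i) (beta C i)"
    using adm unfolding admissible_coefficients_def by blast+
  from elliptic_positive_darcy_forchheimer[OF this fin_part part_sets]
  obtain ah bl bh where "darcy_forchheimer (\<mu> i) (\<lambda>x v. alpha C i x *v v) (beta C i) ah bl bh" by blast
  then have "\<exists>c. darcy_forchheimer (\<mu> i) (\<lambda>x v. alpha C i x *v v) (beta C i) (fst c) (fst (snd c)) (snd (snd c))"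
    by (intro exI[of _ "(ah, bl, bh)"]) simp
  then show "darcy_forchheimer (\<mu> i) (\<lambda>x v. alpha C i x *v v) (beta C i)
      (fst (bulk_consts i)) (fst (snd (bulk_consts i))) (snd (snd (bulk_consts i)))"
    unfolding bulk_consts_def by (rule someI_ex)
qed

sublocale cut: darcy_forchheimer \<nu> "\<lambda>x v. alpha_cut C x *v v" "beta_cut C"
    "fst cut_consts" "fst (snd cut_consts)" "snd (snd cut_consts)"
proof -
  have "elliptic_on (cut G) (alpha_cut C)" "positive_bounded_on (cut G) (beta_cut C)"
    using adm unfolding admissible_coefficients_def by blast+
  from elliptic_positive_darcy_forchheimer[OF this fin_cut cut_sets]
  obtain ah bl bh where "darcy_forchheimer \<nu> (\<lambda>x v. alpha_cut C x *v v) (beta_cut C) ah bl bh" by blast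
  then have "\<exists>c. darcy_forchheimer \<nu> (\<lambda>x v. alpha_cut C x *v v) (beta_cut C) (fst c) (fst (snd c)) (snd (snd c))"
    by (intro exI[of _ "(ah, bl, bh)"]) simp
  then show "darcy_forchheimer \<nu> (\<lambda>x v. alpha_cut C x *v v) (beta_cut C)
      (fst cut_consts) (fst (snd cut_consts)) (snd (snd cut_consts))"
    unfolding cut_consts_def by (rule someI_ex)
qed

sublocale flux: flux_coupling \<nu> "kappa C" "xi C" "fst kappa_consts" "snd kappa_consts"
proof -
  have k: "positive_bounded_on (cut G) (kappa C)" and x: "1 / 2 < xi C"
    using adm unfolding admissible_coefficients_def by blast+
  obtain kl kh where k': "kappa C \<in> borel_measurable \<nu>" "0 < kl" "\<And>y. y \<in> cut G \<Longrightarrow> kl \<le> kappa C y" "\<And>y. y \<in> cut G \<Longrightarrow> kappa C y \<le> kh"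
    using k unfolding positive_bounded_on_def by blast
  have "flux_coupling \<nu> (kappa C) (xi C) kl kh"
    using k' x by unfold_locales auto
  then have "\<exists>c. flux_coupling \<nu> (kappa C) (xi C) (fst c) (snd c)"
    by (intro exI[of _ "(kl, kh)"]) simp
  then show "flux_coupling \<nu> (kappa C) (xi C) (fst kappa_consts) (snd kappa_consts)"
    unfolding kappa_consts_def by (rule someI_ex)
qed

definition total_energy :: "('n, 'm) field \<Rightarrow> real" where
  "total_energy = (\<lambda>(u, s, w). (\<Sum>i\<in>UNIV. bulk.energy i (fst u i)) + cut.energy (snd u) + flux.flux_form w w / 2)"

definition total_form :: "('n, 'm) field \<Rightarrow> ('n, 'm) field \<Rightarrow> real" where
  "total_form = (\<lambda>(u, s, w) (v, r, z). (\<Sum>i\<in>UNIV. bulk.form i (fst u i) (fst v i)) + cut.form (snd u) (snd v) + flux.flux_form w z)"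

text \<open>Cubes for the velocities and squares for the fluxes, the quantities that the energies
  control. The energy does not control the divergence, which is measured separately by
  \<open>div_size\<close>.\<close>

definition field_size :: "('n, 'm) field \<Rightarrow> real" where
  "field_size = (\<lambda>(v, r, z). (\<Sum>i\<in>UNIV. cube_int (\<mu> i) (fst v i)) + cube_int \<nu> (snd v) + flux.flux_square z)"

definition div_size :: "('n, 'm) field \<Rightarrow> real" where
  "div_size = (\<lambda>(v, r, z). (\<Sum>i\<in>UNIV. cube_int (\<mu> i) (fst r i)) + cube_int \<nu> (snd r))"

definition convexity :: real where
  "convexity = Min (insert flux.flux_const (insert (fst (snd cut_consts) / 16) (range (\<lambda>i. fst (snd (bulk_consts i)) / 16))))"

lemma convexity: "0 < convexity" "convexity \<le> flux.flux_const" "convexity \<le> fst (snd cut_consts) / 16"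
  "convexity \<le> fst (snd (bulk_consts i)) / 16"
proof -
  define S where "S = insert flux.flux_const (insert (fst (snd cut_consts) / 16) (range (\<lambda>i. fst (snd (bulk_consts i)) / 16)))"
  have S: "finite S" "S \<noteq> {}" "convexity = Min S" by (auto simp: S_def convexity_def)
  have "0 < x" if "x \<in> S" for x using that flux.flux_const_pos cut.bl bulk.bl by (auto simp: S_def)
  then show "0 < convexity" using S by simp
  show "convexity \<le> flux.flux_const" "convexity \<le> fst (snd cut_consts) / 16"
    "convexity \<le> fst (snd (bulk_consts i)) / 16"
    unfolding S(3) by (rule Min_le[OF S(1)], simp add: S_def)+
qed

lemma field_size_nonneg: "0 \<le> field_size \<tau>"
  by (auto simp: field_size_def split: prod.split intro!: add_nonneg_nonneg sum_nonneg cube_int_nonneg flux.flux_square_nonneg)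

lemma field_plus: "\<tau> \<in> flux_fields G \<Longrightarrow> \<sigma> \<in> flux_fields G \<Longrightarrow> \<tau> + \<sigma> \<in> flux_fields G"
  by (cases \<tau>; cases \<sigma>) (simp add: fields_add)

lemma field_scale: "\<tau> \<in> flux_fields G \<Longrightarrow> c *\<^sub>R \<tau> \<in> flux_fields G"
  by (cases \<tau>) (simp add: fields_scale)

lemma field_minus: "\<tau> \<in> flux_fields G \<Longrightarrow> \<sigma> \<in> flux_fields G \<Longrightarrow> \<tau> - \<sigma> \<in> flux_fields G"
  using field_plus[of \<tau> "(-1) *\<^sub>R \<sigma>"] field_scale[of \<sigma> "-1"] by simp

lemma total_energy_lower:
  assumes "\<tau> \<in> flux_fields G" "\<sigma> \<in> flux_fields G"
  shows "total_energy \<tau> + total_form \<tau> \<sigma> + convexity * field_size \<sigma> \<le> total_energy (\<tau> + \<sigma>)"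
proof -
  obtain u s w v r z where e: "\<tau> = (u, s, w)" "\<sigma> = (v, r, z)" by (cases \<tau>; cases \<sigma>)
  note t = fieldsD[OF assms(1)[unfolded e]] and o = fieldsD[OF assms(2)[unfolded e]]
  have b: "bulk.energy i (fst u i) + bulk.form i (fst u i) (fst v i) + convexity * cube_int (\<mu> i) (fst v i)
      \<le> bulk.energy i (fst u i + fst v i)" for i
    using bulk.energy_lower[OF t(1)[of i] o(1)[of i]]
      mult_right_mono[OF convexity(4)[of i] cube_int_nonneg[of "\<mu> i" "fst v i"]] by linarith
  have c: "cut.energy (snd u) + cut.form (snd u) (snd v) + convexity * cube_int \<nu> (snd v) \<le> cut.energy (snd u + snd v)"
    using cut.energy_lower[OF t(2) o(2)]
      mult_right_mono[OF convexity(3) cube_int_nonneg[of \<nu> "snd v"]] by linarith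
  have f: "flux.flux_form w w / 2 + flux.flux_form w z + convexity * flux.flux_square z \<le> flux.flux_form (w + z) (w + z) / 2"
    using flux.flux_form_expand[of w z, OF t(5) o(5)] flux.flux_form_lower[of z, OF o(5)]
      mult_right_mono[OF convexity(2) flux.flux_square_nonneg[of z]] by linarith
  have "(\<Sum>i\<in>UNIV. bulk.energy i (fst u i)) + (\<Sum>i\<in>UNIV. bulk.form i (fst u i) (fst v i))
      + convexity * (\<Sum>i\<in>UNIV. cube_int (\<mu> i) (fst v i)) \<le> (\<Sum>i\<in>UNIV. bulk.energy i (fst u i + fst v i))"
    unfolding sum_distrib_left sum.distrib[symmetric] by (rule sum_mono) (rule b)
  with c f show ?thesis
    by (simp add: e total_energy_def total_form_def field_size_def distrib_left)
qed

lemma total_energy_upper: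
  assumes "\<tau> \<in> flux_fields G" "\<sigma> \<in> flux_fields G"
  shows "\<exists>C. \<forall>t. \<bar>t\<bar> \<le> 1 \<longrightarrow> total_energy (\<tau> + t *\<^sub>R \<sigma>) \<le> total_energy \<tau> + t * total_form \<tau> \<sigma> + C * t\<^sup>2"
proof -
  obtain u s w v r z where e: "\<tau> = (u, s, w)" "\<sigma> = (v, r, z)" by (cases \<tau>; cases \<sigma>)
  note t = fieldsD[OF assms(1)[unfolded e]] and o = fieldsD[OF assms(2)[unfolded e]]
  have "\<exists>B. \<forall>t. \<bar>t\<bar> \<le> 1 \<longrightarrow> bulk.energy i (fst u i + t *\<^sub>R fst v i) \<le> bulk.energy i (fst u i) + t * bulk.form i (fst u i) (fst v i) + B * t\<^sup>2" for i
    using bulk.energy_upper[OF t(1)[of i] o(1)[of i]] by metis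
  then obtain B where B: "\<And>i t. \<bar>t\<bar> \<le> 1 \<Longrightarrow> bulk.energy i (fst u i + t *\<^sub>R fst v i) \<le> bulk.energy i (fst u i) + t * bulk.form i (fst u i) (fst v i) + B i * t\<^sup>2"
    by metis
  obtain D where D: "\<And>t. \<bar>t\<bar> \<le> 1 \<Longrightarrow> cut.energy (snd u + t *\<^sub>R snd v) \<le> cut.energy (snd u) + t * cut.form (snd u) (snd v) + D * t\<^sup>2"
    using cut.energy_upper[OF t(2) o(2)] by metis
  have "total_energy (\<tau> + t *\<^sub>R \<sigma>) \<le> total_energy \<tau> + t * total_form \<tau> \<sigma> + ((\<Sum>i\<in>UNIV. B i) + D + flux.flux_form z z / 2) * t\<^sup>2"
    if t1: "\<bar>t\<bar> \<le> 1" for t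
  proof -
    have tz: "(t *\<^sub>R z) i \<in> Lp 2 \<nu>" for i using Lp_scale[OF o(5)[of i], of t] by simp
    have "flux.flux_form (w + t *\<^sub>R z) (w + t *\<^sub>R z) / 2 = flux.flux_form w w / 2 + t * flux.flux_form w z + flux.flux_form z z / 2 * t\<^sup>2"
      using flux.flux_form_expand[of w "t *\<^sub>R z", OF t(5) tz]
      unfolding flux.flux_form_scale(1)[of w t z] flux.flux_form_scale(2)[of t z z] by (simp add: mult.commute)
    moreover have "(\<Sum>i\<in>UNIV. bulk.energy i (fst u i + t *\<^sub>R fst v i))
        \<le> (\<Sum>i\<in>UNIV. bulk.energy i (fst u i)) + t * (\<Sum>i\<in>UNIV. bulk.form i (fst u i) (fst v i)) + (\<Sum>i\<in>UNIV. B i) * t\<^sup>2"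
      unfolding sum_distrib_left sum_distrib_right sum.distrib[symmetric] by (rule sum_mono) (rule B[OF t1])
    ultimately show ?thesis
      using D[OF t1] by (simp add: e total_energy_def total_form_def distrib_left distrib_right add_divide_distrib)
  qed
  then show ?thesis by blast
qed

text \<open>Continuous linear functionals for the full norm of \<open>W_space\<close>, expressed
  without norms. \<open>div_size\<close> enters because the boundary pairings involve the
  divergence.\<close>

definition bdd_lin :: "(('n, 'm) field \<Rightarrow> real) \<Rightarrow> bool" where
  "bdd_lin l \<longleftrightarrow> (\<forall>\<tau>\<in>flux_fields G. \<forall>\<sigma>\<in>flux_fields G. l (\<tau> + \<sigma>) = l \<tau> + l \<sigma>) \<and>
     (\<forall>\<tau>\<in>flux_fields G. \<forall>c. l (c *\<^sub>R \<tau>) = c * l \<tau>) \<and>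
     (\<exists>B\<ge>0. \<exists>C. \<forall>\<tau>\<in>flux_fields G. \<bar>l \<tau>\<bar> \<le> B * (field_size \<tau> + div_size \<tau>) + C)"

lemma bdd_lin_add:
  assumes "bdd_lin l" "bdd_lin k"
  shows "bdd_lin (\<lambda>\<tau>. l \<tau> + k \<tau>)"
proof -
  obtain B C where "0 \<le> B" and b: "\<And>\<tau>. \<tau> \<in> flux_fields G \<Longrightarrow> \<bar>l \<tau>\<bar> \<le> B * (field_size \<tau> + div_size \<tau>) + C"
    using assms(1) unfolding bdd_lin_def by blast
  obtain B' C' where "0 \<le> B'" and b': "\<And>\<tau>. \<tau> \<in> flux_fields G \<Longrightarrow> \<bar>k \<tau>\<bar> \<le> B' * (field_size \<tau> + div_size \<tau>) + C'"
    using assms(2) unfolding bdd_lin_def by blast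
  have "\<bar>l \<tau> + k \<tau>\<bar> \<le> (B + B') * (field_size \<tau> + div_size \<tau>) + (C + C')" if "\<tau> \<in> flux_fields G" for \<tau>
    using b[OF that] b'[OF that] abs_triangle_ineq[of "l \<tau>" "k \<tau>"] by (simp add: distrib_right)
  moreover have "0 \<le> B + B'" using \<open>0 \<le> B\<close> \<open>0 \<le> B'\<close> by simp
  ultimately have "\<exists>B\<ge>0. \<exists>C. \<forall>\<tau>\<in>flux_fields G. \<bar>l \<tau> + k \<tau>\<bar> \<le> B * (field_size \<tau> + div_size \<tau>) + C" by blast
  then show ?thesis using assms unfolding bdd_lin_def by (auto simp: algebra_simps)
qed

lemma bdd_lin_scale:
  assumes "bdd_lin l"
  shows "bdd_lin (\<lambda>\<tau>. c * l \<tau>)"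
proof -
  obtain B C where "0 \<le> B" and b: "\<And>\<tau>. \<tau> \<in> flux_fields G \<Longrightarrow> \<bar>l \<tau>\<bar> \<le> B * (field_size \<tau> + div_size \<tau>) + C"
    using assms unfolding bdd_lin_def by blast
  have "\<bar>c * l \<tau>\<bar> \<le> (\<bar>c\<bar> * B) * (field_size \<tau> + div_size \<tau>) + \<bar>c\<bar> * C" if "\<tau> \<in> flux_fields G" for \<tau>
    using mult_left_mono[OF b[OF that], of "\<bar>c\<bar>"] by (simp add: abs_mult algebra_simps)
  moreover have "0 \<le> \<bar>c\<bar> * B" using \<open>0 \<le> B\<close> by simp
  ultimately have "\<exists>B\<ge>0. \<exists>C. \<forall>\<tau>\<in>flux_fields G. \<bar>c * l \<tau>\<bar> \<le> B * (field_size \<tau> + div_size \<tau>) + C" by blast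
  then show ?thesis using assms unfolding bdd_lin_def by (auto simp: algebra_simps)
qed

lemma bdd_lin_diff: "bdd_lin l \<Longrightarrow> bdd_lin k \<Longrightarrow> bdd_lin (\<lambda>\<tau>. l \<tau> - k \<tau>)"
  using bdd_lin_add[OF _ bdd_lin_scale[of k "-1"], of l] by simp

lemma bdd_lin_sum: "(\<And>i::2. bdd_lin (l i)) \<Longrightarrow> bdd_lin (\<lambda>\<tau>. \<Sum>i\<in>UNIV. l i \<tau>)"
  by (simp add: sum_2 bdd_lin_add)

lemma bdd_linI:
  fixes P :: "('n, 'm) field \<Rightarrow> 'x \<Rightarrow> 'b::euclidean_space"
  assumes pq: "1 < p" "1 < q" "1 / p + 1 / q = 1" and h: "h \<in> Lp q M"
    and P: "\<And>\<tau>. \<tau> \<in> flux_fields G \<Longrightarrow> P \<tau> \<in> Lp p M" "\<And>\<tau> \<sigma>. P (\<tau> + \<sigma>) = P \<tau> + P \<sigma>" "\<And>\<tau> c. P (c *\<^sub>R \<tau>) = c *\<^sub>R P \<tau>"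
    and le: "\<And>\<tau>. \<tau> \<in> flux_fields G \<Longrightarrow> (\<integral>x. norm (P \<tau> x) powr p \<partial>M) \<le> field_size \<tau> + div_size \<tau>"
  shows "bdd_lin (\<lambda>\<tau>. \<integral>x. P \<tau> x \<bullet> h x \<partial>M)"
proof -
  note int = Lp_pairing[OF pq P(1) h]
  have "\<bar>\<integral>x. P \<tau> x \<bullet> h x \<partial>M\<bar> \<le> 1 * (field_size \<tau> + div_size \<tau>) + (\<integral>x. norm (h x) powr q \<partial>M)" if "\<tau> \<in> flux_fields G" for \<tau>
    using int(2)[OF that] le[OF that] by simp
  then have "\<exists>B\<ge>0. \<exists>C. \<forall>\<tau>\<in>flux_fields G. \<bar>\<integral>x. P \<tau> x \<bullet> h x \<partial>M\<bar> \<le> B * (field_size \<tau> + div_size \<tau>) + C"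
    using zero_le_one by blast
  moreover have "(\<integral>x. P (\<tau> + \<sigma>) x \<bullet> h x \<partial>M) = (\<integral>x. P \<tau> x \<bullet> h x \<partial>M) + (\<integral>x. P \<sigma> x \<bullet> h x \<partial>M)"
    if "\<tau> \<in> flux_fields G" "\<sigma> \<in> flux_fields G" for \<tau> \<sigma>
    using int(1)[OF that(1)] int(1)[OF that(2)] by (simp add: P(2) inner_add_left)
  moreover have "(\<integral>x. P (c *\<^sub>R \<tau>) x \<bullet> h x \<partial>M) = c * (\<integral>x. P \<tau> x \<bullet> h x \<partial>M)" for \<tau> c
    by (simp add: P(3))
  ultimately show ?thesis unfolding bdd_lin_def by blast
qed

lemma component_sizes:
  assumes "\<tau> \<in> flux_fields G"
  shows "cube_int (\<mu> i) (fst (fst \<tau>) i) \<le> field_size \<tau> + div_size \<tau>"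
    and "cube_int \<nu> (snd (fst \<tau>)) \<le> field_size \<tau> + div_size \<tau>"
    and "cube_int (\<mu> i) (fst (fst (snd \<tau>)) i) \<le> field_size \<tau> + div_size \<tau>"
    and "cube_int \<nu> (snd (fst (snd \<tau>))) \<le> field_size \<tau> + div_size \<tau>"
    and "(\<integral>y. (snd (snd \<tau>) i y)\<^sup>2 \<partial>\<nu>) \<le> field_size \<tau> + div_size \<tau>"
proof -
  obtain v r z where e: "\<tau> = (v, r, z)" by (cases \<tau>)
  have 1: "cube_int (\<mu> i) (fst v i) \<le> (\<Sum>i\<in>UNIV. cube_int (\<mu> i) (fst v i))" for i
    by (rule member_le_sum) (auto simp: cube_int_nonneg)
  have 2: "cube_int (\<mu> i) (fst r i) \<le> (\<Sum>i\<in>UNIV. cube_int (\<mu> i) (fst r i))" for i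
    by (rule member_le_sum) (auto simp: cube_int_nonneg)
  have 3: "(\<integral>y. (z i y)\<^sup>2 \<partial>\<nu>) \<le> flux.flux_square z" for i
    unfolding flux.flux_square_def by (rule member_le_sum) (auto intro!: integral_nonneg_AE)
  have nn: "0 \<le> (\<Sum>i\<in>UNIV. cube_int (\<mu> i) (fst v i))" "0 \<le> (\<Sum>i\<in>UNIV. cube_int (\<mu> i) (fst r i))"
    "0 \<le> cube_int \<nu> (snd v)" "0 \<le> cube_int \<nu> (snd r)" "0 \<le> flux.flux_square z"
    by (auto intro!: sum_nonneg cube_int_nonneg flux.flux_square_nonneg)
  show "cube_int (\<mu> i) (fst (fst \<tau>) i) \<le> field_size \<tau> + div_size \<tau>"
    "cube_int \<nu> (snd (fst \<tau>)) \<le> field_size \<tau> + div_size \<tau>"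
    "cube_int (\<mu> i) (fst (fst (snd \<tau>)) i) \<le> field_size \<tau> + div_size \<tau>"
    "cube_int \<nu> (snd (fst (snd \<tau>))) \<le> field_size \<tau> + div_size \<tau>"
    "(\<integral>y. (snd (snd \<tau>) i y)\<^sup>2 \<partial>\<nu>) \<le> field_size \<tau> + div_size \<tau>"
    using 1[of i] 2[of i] 3[of i] nn by (simp_all add: e field_size_def div_size_def)
qed

text \<open>The form with its first argument fixed and the boundary functional are both sums of
  pairings of these five kinds.\<close>

lemma bdd_lin_components:
  shows "h \<in> Lp (3/2) (\<mu> i) \<Longrightarrow> bdd_lin (\<lambda>\<tau>. \<integral>x. fst (fst \<tau>) i x \<bullet> h x \<partial>\<mu> i)"
    and "h2 \<in> Lp (3/2) \<nu> \<Longrightarrow> bdd_lin (\<lambda>\<tau>. \<integral>x. snd (fst \<tau>) x \<bullet> h2 x \<partial>\<nu>)"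
    and "h3 \<in> Lp (3/2) (\<mu> i) \<Longrightarrow> bdd_lin (\<lambda>\<tau>. \<integral>x. fst (fst (snd \<tau>)) i x * h3 x \<partial>\<mu> i)"
    and "h4 \<in> Lp (3/2) \<nu> \<Longrightarrow> bdd_lin (\<lambda>\<tau>. \<integral>x. snd (fst (snd \<tau>)) x * h4 x \<partial>\<nu>)"
    and "h5 \<in> Lp 2 \<nu> \<Longrightarrow> bdd_lin (\<lambda>\<tau>. \<integral>x. snd (snd \<tau>) i x * h5 x \<partial>\<nu>)"
proof -
  have D: "fst (fst \<tau>) i \<in> Lp 3 (\<mu> i)" "snd (fst \<tau>) \<in> Lp 3 \<nu>" "fst (fst (snd \<tau>)) i \<in> Lp 3 (\<mu> i)"
    "snd (fst (snd \<tau>)) \<in> Lp 3 \<nu>" "snd (snd \<tau>) i \<in> Lp 2 \<nu>" if "\<tau> \<in> flux_fields G" for \<tau> i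
    using that by (cases \<tau>; auto dest: fieldsD)+
  show "h \<in> Lp (3/2) (\<mu> i) \<Longrightarrow> bdd_lin (\<lambda>\<tau>. \<integral>x. fst (fst \<tau>) i x \<bullet> h x \<partial>\<mu> i)"
    using component_sizes(1) D(1) by (intro bdd_linI[where p = 3]) (auto simp: cube_int_def powr_numeral)
  show "h2 \<in> Lp (3/2) \<nu> \<Longrightarrow> bdd_lin (\<lambda>\<tau>. \<integral>x. snd (fst \<tau>) x \<bullet> h2 x \<partial>\<nu>)"
    using component_sizes(2) D(2) by (intro bdd_linI[where p = 3]) (auto simp: cube_int_def powr_numeral)
  show "h3 \<in> Lp (3/2) (\<mu> i) \<Longrightarrow> bdd_lin (\<lambda>\<tau>. \<integral>x. fst (fst (snd \<tau>)) i x * h3 x \<partial>\<mu> i)"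
    using component_sizes(3) D(3)
      bdd_linI[where p = 3 and q = "3/2" and P = "\<lambda>\<tau>. fst (fst (snd \<tau>)) i" and h = h3 and M = "\<mu> i"] by (auto simp: cube_int_def powr_numeral)
  show "h4 \<in> Lp (3/2) \<nu> \<Longrightarrow> bdd_lin (\<lambda>\<tau>. \<integral>x. snd (fst (snd \<tau>)) x * h4 x \<partial>\<nu>)"
    using component_sizes(4) D(4)
      bdd_linI[where p = 3 and q = "3/2" and P = "\<lambda>\<tau>. snd (fst (snd \<tau>))" and h = h4 and M = \<nu>] by (auto simp: cube_int_def powr_numeral)
  show "h5 \<in> Lp 2 \<nu> \<Longrightarrow> bdd_lin (\<lambda>\<tau>. \<integral>x. snd (snd \<tau>) i x * h5 x \<partial>\<nu>)"
    using component_sizes(5) D(5)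
      bdd_linI[where p = 2 and q = 2 and P = "\<lambda>\<tau>. snd (snd \<tau>) i" and h = h5 and M = \<nu>] by (auto simp: powr_numeral)
qed

lemma total_form_bdd_lin:
  assumes "\<tau> \<in> flux_fields G"
  shows "bdd_lin (total_form \<tau>)"
proof -
  obtain u s w where e: "\<tau> = (u, s, w)" by (cases \<tau>)
  note t = fieldsD[OF assms[unfolded e]]
  have "total_form \<tau> = (\<lambda>\<sigma>. (\<Sum>i\<in>UNIV. \<integral>x. fst (fst \<sigma>) i x \<bullet> bulk.law i (fst u i) x \<partial>\<mu> i)
      + (\<integral>x. snd (fst \<sigma>) x \<bullet> cut.law (snd u) x \<partial>\<nu>) + (\<Sum>i\<in>UNIV. \<integral>x. snd (snd \<sigma>) i x * flux.coupling w i x \<partial>\<nu>))"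
    by (auto simp: e fun_eq_iff total_form_def bulk.form_def cut.form_def flux.flux_form_def inner_commute mult.commute)
  moreover have "bdd_lin \<dots>"
    by (intro bdd_lin_add bdd_lin_sum bdd_lin_components bulk.law_Lp cut.law_Lp flux.coupling_Lp t)
  ultimately show ?thesis by simp
qed

end

section \<open>Existence and uniqueness\<close>

lemma cube_int_0: "cube_int M 0 = 0"
  by (simp add: cube_int_def)

lemma cube_int_null: "AE x in M. f x = 0 \<Longrightarrow> cube_int M f = 0"
  unfolding cube_int_def by (rule integral_eq_zero_AE) (auto elim: eventually_mono)

text \<open>The test function \<open>sgn (d x) * \<bar>d x\<bar> powr (1/2)\<close> belongs to
  \<open>L^3\<close>, because the cube of its modulus is \<open>\<bar>d x\<bar> powr (3/2)\<close>,
  and its product with \<open>d x\<close> is that same function.\<close>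

lemma Lp_3_half_zero:
  fixes d :: "'x \<Rightarrow> real"
  assumes d: "d \<in> Lp (3/2) M" and zero: "\<And>f. f \<in> Lp 3 M \<Longrightarrow> (\<integral>x. f x * d x \<partial>M) = 0"
  shows "AE x in M. d x = 0"
proof -
  define f where "f x = sgn (d x) * \<bar>d x\<bar> powr (1/2)" for x
  have dm: "d \<in> borel_measurable M" using LpD[OF d] by simp
  have sq: "\<bar>f x\<bar> ^ 3 = \<bar>d x\<bar> powr (3/2)" for x
  proof (cases "d x = 0")
    case False
    have "\<bar>f x\<bar> ^ 3 = (\<bar>d x\<bar> powr (1/2)) powr 3" using False by (simp add: f_def abs_mult abs_sgn_eq powr_numeral)
    then show ?thesis by (simp add: powr_powr)
  qed (simp add: f_def)
  have fd: "f x * d x = \<bar>d x\<bar> powr (3/2)" for x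
  proof (cases "d x = 0")
    case False
    have "f x * d x = \<bar>d x\<bar> powr (1/2) * \<bar>d x\<bar> powr 1"
      by (auto simp: f_def sgn_if abs_if mult.commute)
    also have "\<dots> = \<bar>d x\<bar> powr (1/2 + 1)" by (simp only: powr_add)
    finally show ?thesis by simp
  qed (simp add: f_def)
  have fm: "f \<in> borel_measurable M" unfolding f_def[abs_def] using dm by simp
  have "f \<in> Lp 3 M" unfolding Lp_3_cube using fm LpD(2)[OF d] by (simp add: sq)
  from zero[OF this] have "(\<integral>x. \<bar>d x\<bar> powr (3/2) \<partial>M) = 0" by (simp add: fd)
  then have "AE x in M. \<bar>d x\<bar> powr (3/2) = 0"
    using LpD(2)[OF d] by (subst (asm) integral_nonneg_eq_0_iff_AE) auto
  then show ?thesis by eventually_elim simp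
qed

context fracture_model
begin

lemma field_size_scale_le:
  assumes "0 \<le> c" "c \<le> 1"
  shows "field_size (c *\<^sub>R \<tau>) \<le> c\<^sup>2 * field_size \<tau>"
proof -
  obtain v r z where e: "\<tau> = (v, r, z)" by (cases \<tau>)
  have c3: "c ^ 3 * k \<le> c\<^sup>2 * k" if "0 \<le> k" for k
    using assms that by (intro mult_right_mono power_decreasing) auto
  have "(\<Sum>i\<in>UNIV. c ^ 3 * cube_int (\<mu> i) (fst v i)) \<le> (\<Sum>i\<in>UNIV. c\<^sup>2 * cube_int (\<mu> i) (fst v i))"
    by (intro sum_mono c3 cube_int_nonneg)
  then show ?thesis
    using c3[OF cube_int_nonneg[of \<nu> "snd v"]] assms
    by (simp add: e field_size_def cube_int_scale flux.flux_square_scale distrib_left sum_distrib_left)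
qed

lemma size_scale:
  assumes "1 \<le> c"
  shows "field_size (c *\<^sub>R \<tau>) \<le> c ^ 3 * field_size \<tau>" "div_size (c *\<^sub>R \<tau>) = c ^ 3 * div_size \<tau>"
proof -
  obtain v r z where e: "\<tau> = (v, r, z)" by (cases \<tau>)
  have "c\<^sup>2 * flux.flux_square z \<le> c ^ 3 * flux.flux_square z"
    using assms by (intro mult_right_mono power_increasing flux.flux_square_nonneg) auto
  then show "field_size (c *\<^sub>R \<tau>) \<le> c ^ 3 * field_size \<tau>"
    using assms by (simp add: e field_size_def cube_int_scale flux.flux_square_scale distrib_left sum_distrib_left)
  show "div_size (c *\<^sub>R \<tau>) = c ^ 3 * div_size \<tau>"
    using assms by (simp add: e div_size_def cube_int_scale distrib_left sum_distrib_left)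
qed

text \<open>Large multiples of \<tau> still have size 0, so the additive bound keeps
  \<open>l\<close> bounded along them, which forces \<open>l \<tau> = 0\<close>. Functionals
  therefore do not see null fields and do not depend on representatives.\<close>

lemma bdd_lin_null:
  assumes l: "bdd_lin l" and \<tau>: "\<tau> \<in> flux_fields G" and "field_size \<tau> = 0" "div_size \<tau> = 0"
  shows "l \<tau> = 0"
proof (rule ccontr)
  assume nz: "l \<tau> \<noteq> 0"
  obtain B C where "0 \<le> B" and b: "\<And>\<sigma>. \<sigma> \<in> flux_fields G \<Longrightarrow> \<bar>l \<sigma>\<bar> \<le> B * (field_size \<sigma> + div_size \<sigma>) + C"
    using l unfolding bdd_lin_def by blast
  have hom: "l (c *\<^sub>R \<tau>) = c * l \<tau>" for c using l \<tau> unfolding bdd_lin_def by blast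
  define c where "c = 1 + (\<bar>C\<bar> + 1) / \<bar>l \<tau>\<bar>"
  have c: "1 \<le> c" "\<bar>C\<bar> + 1 \<le> c * \<bar>l \<tau>\<bar>" using nz by (auto simp: c_def field_simps)
  have "field_size (c *\<^sub>R \<tau>) + div_size (c *\<^sub>R \<tau>) = 0"
    using size_scale[OF c(1), of \<tau>] assms(3,4) field_size_nonneg[of "c *\<^sub>R \<tau>"] by simp
  then have "\<bar>c * l \<tau>\<bar> \<le> C" using b[OF field_scale[OF \<tau>, of c]] by (simp add: hom)
  then show False using c by (simp add: abs_mult)
qed

text \<open>The carried components and the chosen representatives differ by a null field, so they
  can be exchanged in every bounded functional.\<close>

lemma bdd_lin_canonical:
  assumes l: "bdd_lin l" and f: "(v, r, z) \<in> flux_fields G"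
  shows "l (v, Div G v, normal_flux G v) = l (v, r, z)"
proof -
  note W = fields_W[OF f]
  have c: "(v, Div G v, normal_flux G v) \<in> flux_fields G" by (rule W_fields[OF W(1)])
  define \<sigma> where "\<sigma> = (v, Div G v, normal_flux G v) - (v, r, z)"
  have \<sigma>: "\<sigma> \<in> flux_fields G" unfolding \<sigma>_def by (rule field_minus[OF c f])
  have "cube_int (\<mu> i) (fst (Div G v) i - fst r i) = 0" for i
    using W(2)[of i] by (intro cube_int_null) (auto elim: eventually_mono)
  moreover have "cube_int \<nu> (snd (Div G v) - snd r) = 0"
    using W(3) by (intro cube_int_null) (auto elim: eventually_mono)
  moreover have "(\<integral>y. (normal_flux G v i y - z i y)\<^sup>2 \<partial>\<nu>) = 0" for i
    using W(4)[of i] by (intro integral_eq_zero_AE) (auto elim: eventually_mono)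
  ultimately have "field_size \<sigma> = 0" "div_size \<sigma> = 0"
    by (auto simp: \<sigma>_def field_size_def div_size_def flux.flux_square_def cube_int_0)
  then have "l \<sigma> = 0" by (rule bdd_lin_null[OF l \<sigma>])
  moreover have "(v, Div G v, normal_flux G v) = \<sigma> + (v, r, z)" by (simp add: \<sigma>_def)
  then have "l (v, Div G v, normal_flux G v) = l \<sigma> + l (v, r, z)" using l \<sigma> f unfolding bdd_lin_def by metis
  ultimately show ?thesis by simp
qed

lemma a_form_canonical:
  "a_form G C u v = total_form (u, Div G u, normal_flux G u) (v, Div G v, normal_flux G v)"
  by (simp add: a_form_def total_form_def bulk.form_def cut.form_def bulk.law_def cut.law_def
      flux.flux_form_def flux.coupling_def)

text \<open>\<open>total_form\<close> is nonlinear in its first argument, where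
  \<open>bdd_lin_null\<close> says nothing; the change of representatives is therefore made under
  the integrals.\<close>

lemma total_form_cong:
  assumes "(u, s, w) \<in> flux_fields G" "(u', s', w') \<in> flux_fields G" "\<sigma> \<in> flux_fields G"
    and "\<And>i. AE x in \<mu> i. fst u i x = fst u' i x" "AE y in \<nu>. snd u y = snd u' y" "\<And>i. AE y in \<nu>. w i y = w' i y"
  shows "total_form (u, s, w) \<sigma> = total_form (u', s', w') \<sigma>"
proof -
  obtain v r z where e: "\<sigma> = (v, r, z)" by (cases \<sigma>)
  note f = fieldsD[OF assms(1)] and g = fieldsD[OF assms(2)] and h = fieldsD[OF assms(3)[unfolded e]]
  have "bulk.form i (fst u i) (fst v i) = bulk.form i (fst u' i) (fst v i)" for i
    unfolding bulk.form_def using assms(4)[of i] bulk.form_integrable[OF f(1) h(1), of i] bulk.form_integrable[OF g(1) h(1), of i]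
    by (intro integral_cong_AE) (auto simp: bulk.law_def elim: eventually_mono)
  moreover have "cut.form (snd u) (snd v) = cut.form (snd u') (snd v)"
    unfolding cut.form_def using assms(5) cut.form_integrable[OF f(2) h(2)] cut.form_integrable[OF g(2) h(2)]
    by (intro integral_cong_AE) (auto simp: cut.law_def elim: eventually_mono)
  moreover have "(\<integral>x. flux.coupling w i x * z i x \<partial>\<nu>) = (\<integral>x. flux.coupling w' i x * z i x \<partial>\<nu>)" for i
  proof (rule integral_cong_AE)
    show "AE x in \<nu>. flux.coupling w i x * z i x = flux.coupling w' i x * z i x"
      using assms(6)[of i] assms(6)[of "i + 1"] by eventually_elim (simp add: flux.coupling_def)
  qed (use flux.coupling_integrable[of w "z i" i, OF f(5) h(5)] flux.coupling_integrable[of w' "z i" i, OF g(5) h(5)] in auto)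
  ultimately show ?thesis by (simp add: e total_form_def flux.flux_form_def)
qed

lemma pairing_canonical:
  assumes f: "(v, r, z) \<in> flux_fields G" and p: "p \<in> M_space G"
  shows "pairing G (Div G v) p = pairing G r p"
proof -
  note W = fields_W[OF f] and D = fieldsD[OF f]
  have d: "fst (Div G v) i \<in> borel_measurable (\<mu> i)" "snd (Div G v) \<in> borel_measurable \<nu>" for i
    using fieldsD(3,4)[OF W_fields[OF W(1)]] by (auto dest: LpD)
  have pm: "fst p i \<in> borel_measurable (\<mu> i)" "snd p \<in> borel_measurable \<nu>" for i
    using p by (auto simp: M_space_def dest: LpD)
  have "(\<integral>x. fst (Div G v) i x * fst p i x \<partial>\<mu> i) = (\<integral>x. fst r i x * fst p i x \<partial>\<mu> i)" for i
    using W(2)[of i] d(1)[of i] pm(1)[of i] LpD(1)[OF D(3)[of i]]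
    by (intro integral_cong_AE borel_measurable_times) (auto elim: eventually_mono)
  moreover have "(\<integral>x. snd (Div G v) x * snd p x \<partial>\<nu>) = (\<integral>x. snd r x * snd p x \<partial>\<nu>)"
    using W(3) d(2) pm(2) LpD(1)[OF D(4)]
    by (intro integral_cong_AE borel_measurable_times) (auto elim: eventually_mono)
  ultimately show ?thesis by (simp add: pairing_def)
qed

text \<open>By Green's formula \<open>g_form\<close> pairs the velocity with the weak gradient of a
  lifting, the divergence with the lifting, and the fluxes with its trace on \<gamma>. Liftings are
  in \<open>H^1\<close>; finiteness of the measures embeds \<open>L^2\<close> into
  \<open>L^(3/2)\<close>, the exponent dual to that of velocities and divergences.\<close>

lemma boundary_functional:
  assumes "admissible_boundary_data G pd"
  obtains l where "bdd_lin l" "\<And>v r z. (v, r, z) \<in> flux_fields G \<Longrightarrow> g_form G pd v = l (v, r, z)"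
proof -
  have "\<exists>Pt. is_lifting 2 (part G i) (outer_boundary G i) (fst pd i) Pt" for i
    using assms by (auto simp: admissible_boundary_data_def trace_space_def)
  then have L: "is_lifting 2 (part G i) (outer_boundary G i) (fst pd i) (lifting (part G i) (outer_boundary G i) (fst pd i))" for i
    unfolding lifting_def by (rule someI_ex)
  define P t where "P i = fst (lifting (part G i) (outer_boundary G i) (fst pd i))"
    and "t i = snd (lifting (part G i) (outer_boundary G i) (fst pd i))" for i
  have P: "P i \<in> Lp 2 (\<mu> i)" "weak_grad (part G i) (P i) \<in> Lp 2 (\<mu> i)"
    and t: "t i \<in> Lp 2 (surface_on (frontier (part G i)))" for i
    using L[of i] by (auto simp: is_lifting_def W1_def has_trace_def P_def t_def case_prod_beta)
  \<comment> \<open>Needed for the integral over \<gamma> that \<open>boundary_pairing\<close>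
    subtracts, where the trace meets a flux that is only in \<open>L^2\<close>.\<close>
  have tc: "(\<lambda>y. t i (chart G y)) \<in> Lp 2 \<nu>" for i
    using dims fracture_sub_frontier[of i] cut_open
    by (intro Lp_surface_isometric[OF _ chart_dist _ _ _ t]) (auto simp: frontier_closed borel_closed)
  have "\<exists>Pt. is_lifting 2 (cut G) (frontier (cut G)) (snd pd) Pt"
    using assms by (auto simp: admissible_boundary_data_def trace_space_def)
  then have Lc: "is_lifting 2 (cut G) (frontier (cut G)) (snd pd) (lifting (cut G) (frontier (cut G)) (snd pd))"
    unfolding lifting_def by (rule someI_ex)
  define Q where "Q = fst (lifting (cut G) (frontier (cut G)) (snd pd))"
  have Q: "Q \<in> Lp 2 \<nu>" "weak_grad (cut G) Q \<in> Lp 2 \<nu>"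
    using Lc by (auto simp: is_lifting_def W1_def Q_def case_prod_beta)
  have P': "P i \<in> Lp (3/2) (\<mu> i)" "weak_grad (part G i) (P i) \<in> Lp (3/2) (\<mu> i)"
    "Q \<in> Lp (3/2) \<nu>" "weak_grad (cut G) Q \<in> Lp (3/2) \<nu>" for i
    by (rule Lp_mono_exponent[OF fin_part _ _ P(1)] Lp_mono_exponent[OF fin_part _ _ P(2)]
        Lp_mono_exponent[OF fin_cut _ _ Q(1)] Lp_mono_exponent[OF fin_cut _ _ Q(2)]; simp)+
  \<comment> \<open>The tangential divergence of the fracture velocity is the carried divergence
    plus the flux jump, hence the terms that pair both fluxes with \<open>Q\<close>. They rely on
    \<open>Q\<close> in \<open>L^2\<close>, since the fluxes are only square integrable.\<close>
  define l :: "('n, 'm) field \<Rightarrow> real" where "l = (\<lambda>\<tau>. - 1 * (\<Sum>i\<in>UNIV.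
      (\<integral>x. fst (fst \<tau>) i x \<bullet> weak_grad (part G i) (P i) x \<partial>\<mu> i) + (\<integral>x. fst (fst (snd \<tau>)) i x * P i x \<partial>\<mu> i)
        - side i * (\<integral>y. snd (snd \<tau>) i y * t i (chart G y) \<partial>\<nu>))
      - ((\<integral>y. snd (fst \<tau>) y \<bullet> weak_grad (cut G) Q y \<partial>\<nu>) + ((\<integral>y. snd (fst (snd \<tau>)) y * Q y \<partial>\<nu>)
          + ((\<integral>y. snd (snd \<tau>) 1 y * Q y \<partial>\<nu>) - (\<integral>y. snd (snd \<tau>) 2 y * Q y \<partial>\<nu>)))))"
  have l: "bdd_lin l"
    unfolding l_def
    by (intro bdd_lin_add bdd_lin_diff bdd_lin_scale bdd_lin_sum bdd_lin_components P' tc Q)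
  have "g_form G pd v = l (v, r, z)" if f: "(v, r, z) \<in> flux_fields G" for v r z
  proof -
    have c: "(v, Div G v, normal_flux G v) \<in> flux_fields G" by (rule W_fields[OF fields_W(1)[OF f]])
    note D = fieldsD[OF c]
    have b: "boundary_pairing G i (fst pd i) (fst v i) =
        (\<integral>x. fst v i x \<bullet> weak_grad (part G i) (P i) x \<partial>\<mu> i) + (\<integral>x. fst (Div G v) i x * P i x \<partial>\<mu> i)
        - side i * (\<integral>y. normal_flux G v i y * t i (chart G y) \<partial>\<nu>)" for i
    proof -
      have "integrable (\<mu> i) (\<lambda>x. fst v i x \<bullet> weak_grad (part G i) (P i) x)"
        by (rule Lp_pairing_3(1)[OF D(1) P'(2)])
      moreover have "integrable (\<mu> i) (\<lambda>x. fst (Div G v) i x * P i x)"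
        using Lp_pairing_3(1)[OF D(3)[of i] P'(1)] by simp
      moreover have "(\<integral>y. normal_trace G i (fst v i) y * t i (chart G y) \<partial>\<nu>) = side i * (\<integral>y. normal_flux G v i y * t i (chart G y) \<partial>\<nu>)"
        by (simp add: normal_flux_eq mult.assoc)
      ultimately show ?thesis
        by (simp add: boundary_pairing_def P_def t_def case_prod_beta Div_def)
    qed
    have cb: "cut_boundary_pairing G (snd pd) (snd v) = (\<integral>y. snd v y \<bullet> weak_grad (cut G) Q y \<partial>\<nu>) +
        ((\<integral>y. snd (Div G v) y * Q y \<partial>\<nu>) + ((\<integral>y. normal_flux G v 1 y * Q y \<partial>\<nu>) - (\<integral>y. normal_flux G v 2 y * Q y \<partial>\<nu>)))"
    proof -
      have i1: "integrable \<nu> (\<lambda>y. snd v y \<bullet> weak_grad (cut G) Q y)" by (rule Lp_pairing_3(1)[OF D(2) P'(4)])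
      have i2: "integrable \<nu> (\<lambda>y. snd (Div G v) y * Q y)" using Lp_pairing_3(1)[OF D(4) P'(3)] by simp
      have i3: "integrable \<nu> (\<lambda>y. normal_flux G v i y * Q y)" for i using Lp_pairing_2(1)[OF D(5)[of i] Q(1)] by simp
      have "cut_boundary_pairing G (snd pd) (snd v) = (\<integral>y. snd v y \<bullet> weak_grad (cut G) Q y + (snd (Div G v) y * Q y
          + (normal_flux G v 1 y * Q y - normal_flux G v 2 y * Q y)) \<partial>\<nu>)"
        by (simp add: cut_boundary_pairing_def Q_def case_prod_beta Div_def algebra_simps)
      then show ?thesis using i1 i2 i3[of 1] i3[of 2] by simp
    qed
    have "g_form G pd v = l (v, Div G v, normal_flux G v)"
      by (simp add: g_form_def l_def b cb)
    then show ?thesis using bdd_lin_canonical[OF l f] by simp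
  qed
  with l show ?thesis using that by blast
qed

lemma velocity_exists:
  assumes q: "q \<in> M_dual G" and l: "bdd_lin l"
  obtains u w where "(u, q, w) \<in> flux_fields G" "\<And>v z. (v, 0, z) \<in> flux_fields G \<Longrightarrow> total_form (u, q, w) (v, 0, z) = l (v, 0, z)"
proof -
  define K where "K = {\<tau> \<in> flux_fields G. fst (snd \<tau>) = q}"
  define Z where "Z = {\<tau> \<in> flux_fields G. fst (snd \<tau>) = 0}"
  have KF: "\<tau> \<in> flux_fields G" if "\<tau> \<in> K" for \<tau> using that by (simp add: K_def)
  have ZF: "\<tau> \<in> flux_fields G" if "\<tau> \<in> Z" for \<tau> using that by (simp add: Z_def)
  \<comment> \<open>On divergence free directions \<open>field_size\<close> alone, which the energy
    controls, bounds every functional in \<open>bdd_lin\<close>.\<close>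
  have Zdiv: "div_size \<tau> = 0" if "\<tau> \<in> Z" for \<tau>
    using that by (cases \<tau>) (auto simp: Z_def div_size_def cube_int_0)
  have lin: "bdd_lin (\<lambda>\<sigma>. total_form \<tau> \<sigma> - l \<sigma>)" if "\<tau> \<in> flux_fields G" for \<tau>
    by (intro bdd_lin_diff total_form_bdd_lin that l)
  obtain \<tau> where \<tau>: "\<tau> \<in> K" "\<And>\<sigma>. \<sigma> \<in> Z \<Longrightarrow> total_form \<tau> \<sigma> - l \<sigma> = 0"
  proof (rule uniformly_convex_critical_point[where K = K and Z = Z and N = "\<lambda>\<sigma>. convexity * field_size \<sigma>"
        and E = "\<lambda>\<tau>. total_energy \<tau> - l \<tau>" and A = "\<lambda>\<tau> \<sigma>. total_form \<tau> \<sigma> - l \<sigma>"])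
    show "K \<noteq> {}"
    proof -
      obtain C where "\<And>s. s \<in> M_dual G \<Longrightarrow> \<exists>v. (v, s, 0) \<in> flux_fields G \<and>
        (\<forall>i. cube_int (\<mu> i) (fst v i) \<le> C * cube_int (\<mu> i) (fst s i)) \<and> cube_int \<nu> (snd v) \<le> C * cube_int \<nu> (snd s)"
        using divergence_right_inverse by blast
      from this[OF q] obtain v where "(v, q, 0) \<in> K" by (auto simp: K_def)
      then show ?thesis by blast
    qed
    show "\<tau> + \<sigma> \<in> K" if "\<tau> \<in> K" "\<sigma> \<in> Z" for \<tau> \<sigma>
      using that field_plus by (auto simp: K_def Z_def)
    show "\<tau> - \<sigma> \<in> Z" if "\<tau> \<in> K" "\<sigma> \<in> K" for \<tau> \<sigma>
      using that field_minus by (auto simp: K_def Z_def)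
    show "c *\<^sub>R \<sigma> \<in> Z" if "\<sigma> \<in> Z" for \<sigma> c
      using that field_scale by (auto simp: Z_def)
    show "total_form \<tau> (c *\<^sub>R \<sigma>) - l (c *\<^sub>R \<sigma>) = c * (total_form \<tau> \<sigma> - l \<sigma>)" if "\<tau> \<in> K" "\<sigma> \<in> Z" for \<tau> \<sigma> c
      using lin[OF KF[OF that(1)]] ZF[OF that(2)] unfolding bdd_lin_def by blast
    show "total_energy \<tau> - l \<tau> + (total_form \<tau> \<sigma> - l \<sigma>) + convexity * field_size \<sigma> \<le> total_energy (\<tau> + \<sigma>) - l (\<tau> + \<sigma>)"
      if "\<tau> \<in> K" "\<sigma> \<in> Z" for \<tau> \<sigma>
    proof -
      have "l (\<tau> + \<sigma>) = l \<tau> + l \<sigma>" using l KF[OF that(1)] ZF[OF that(2)] unfolding bdd_lin_def by blast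
      then show ?thesis using total_energy_lower[OF KF[OF that(1)] ZF[OF that(2)]] by simp
    qed
    show "\<exists>C. \<forall>t. \<bar>t\<bar> \<le> 1 \<longrightarrow> total_energy (\<tau> + t *\<^sub>R \<sigma>) - l (\<tau> + t *\<^sub>R \<sigma>)
        \<le> total_energy \<tau> - l \<tau> + t * (total_form \<tau> \<sigma> - l \<sigma>) + C * t\<^sup>2" if "\<tau> \<in> K" "\<sigma> \<in> Z" for \<tau> \<sigma>
    proof -
      have "l (\<tau> + t *\<^sub>R \<sigma>) = l \<tau> + t * l \<sigma>" for t
        using l KF[OF that(1)] ZF[OF that(2)] field_scale[OF ZF[OF that(2)], of t] unfolding bdd_lin_def by metis
      then show ?thesis using total_energy_upper[OF KF[OF that(1)] ZF[OF that(2)]] by (simp add: algebra_simps)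
    qed
    show "\<exists>B C. \<forall>\<sigma>\<in>Z. \<bar>total_form \<tau> \<sigma> - l \<sigma>\<bar> \<le> B * (convexity * field_size \<sigma>) + C" if \<tau>: "\<tau> \<in> K" for \<tau>
    proof -
      obtain B C where "\<And>\<sigma>. \<sigma> \<in> flux_fields G \<Longrightarrow> \<bar>total_form \<tau> \<sigma> - l \<sigma>\<bar> \<le> B * (field_size \<sigma> + div_size \<sigma>) + C"
        using lin[OF KF[OF \<tau>]] unfolding bdd_lin_def by blast
      then have "\<bar>total_form \<tau> \<sigma> - l \<sigma>\<bar> \<le> (B / convexity) * (convexity * field_size \<sigma>) + C" if "\<sigma> \<in> Z" for \<sigma>
        using ZF[OF that] Zdiv[OF that] convexity(1) by fastforce
      then show ?thesis by blast
    qed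
    show "convexity * field_size (c *\<^sub>R \<sigma>) \<le> c\<^sup>2 * (convexity * field_size \<sigma>)" if "0 \<le> c" "c \<le> 1" for c \<sigma>
      using mult_left_mono[OF field_size_scale_le[OF that], of convexity \<sigma>] convexity(1) by (simp add: mult.left_commute)
    show "convexity * field_size (c *\<^sub>R \<sigma>) \<le> c ^ 3 * (convexity * field_size \<sigma>)" if "1 \<le> c" for c \<sigma>
      using mult_left_mono[OF size_scale(1)[OF that], of convexity \<sigma>] convexity(1) by (simp add: mult.left_commute)
    show "0 \<le> convexity * field_size \<sigma>" for \<sigma>
      using convexity(1) field_size_nonneg[of \<sigma>] by simp
    show "\<exists>\<tau>\<in>K. (\<lambda>k. convexity * field_size (X k - \<tau>)) \<longlonglongrightarrow> 0"
      if X: "\<And>k. X k \<in> K" and cauchy: "\<And>e. e > 0 \<Longrightarrow> \<exists>n. \<forall>k\<ge>n. \<forall>l\<ge>n. convexity * field_size (X k - X l) < e" for X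
    proof -
      define U W where "U k = fst (X k)" and "W k = snd (snd (X k))" for k
      have XF: "(U k, q, W k) \<in> flux_fields G" for k
        using X[of k] by (cases "X k") (auto simp: K_def U_def W_def)
      have Xe: "X k = (U k, q, W k)" for k
        using X[of k] by (cases "X k") (auto simp: K_def U_def W_def)
      note D = fieldsD[OF XF]
      have fs: "\<exists>n. \<forall>k\<ge>n. \<forall>l\<ge>n. field_size (X k - X l) < e" if "e > 0" for e
        using cauchy[of "convexity * e"] that convexity(1) by simp
      \<comment> \<open>All members of the sequence carry the same divergence \<open>q\<close>, so
        the componentwise estimates for differences involve \<open>field_size\<close> only.\<close>
      have dz: "div_size (X k - X l) = 0" for k l
        by (simp add: Xe div_size_def cube_int_0)
      note cs = component_sizes[OF field_minus[OF XF XF], folded Xe, unfolded dz, simplified]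
      have small: "\<exists>n. \<forall>k\<ge>n. \<forall>l\<ge>n. F k l < e"
        if "e > 0" "\<And>k l. F k l \<le> field_size (X k - X l)" for e and F :: "nat \<Rightarrow> nat \<Rightarrow> real"
        using fs[OF that(1)] that(2) by (meson le_less_trans)
      have "\<exists>f. f \<in> Lp 3 (\<mu> i) \<and> (\<lambda>k. cube_int (\<mu> i) (fst (U k) i - f)) \<longlonglongrightarrow> 0" for i
      proof (rule Lp_complete[where F = "\<lambda>k. fst (U k) i" and p = 3 and M = "\<mu> i"])
        show "\<exists>n. \<forall>k\<ge>n. \<forall>l\<ge>n. (\<integral>x. norm (fst (U k) i x - fst (U l) i x) powr 3 \<partial>\<mu> i) < e" if "e > 0" for e
          using cs(1)[where i = i] by (intro small[OF that]) (auto simp: cube_int_def powr_numeral Xe)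
      qed (use D(1) in \<open>auto simp: cube_int_def powr_numeral\<close>)
      then have "\<exists>ub. \<forall>i. ub i \<in> Lp 3 (\<mu> i) \<and> (\<lambda>k. cube_int (\<mu> i) (fst (U k) i - ub i)) \<longlonglongrightarrow> 0"
        by (intro choice allI)
      then obtain ub where ub: "\<And>i. ub i \<in> Lp 3 (\<mu> i)" "\<And>i. (\<lambda>k. cube_int (\<mu> i) (fst (U k) i - ub i)) \<longlonglongrightarrow> 0" by blast
      have "\<exists>f. f \<in> Lp 3 \<nu> \<and> (\<lambda>k. cube_int \<nu> (snd (U k) - f)) \<longlonglongrightarrow> 0"
      proof (rule Lp_complete[where F = "\<lambda>k. snd (U k)" and p = 3 and M = \<nu>])
        show "\<exists>n. \<forall>k\<ge>n. \<forall>l\<ge>n. (\<integral>x. norm (snd (U k) x - snd (U l) x) powr 3 \<partial>\<nu>) < e" if "e > 0" for e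
          using cs(2) by (intro small[OF that]) (auto simp: cube_int_def powr_numeral Xe)
      qed (use D(2) in \<open>auto simp: cube_int_def powr_numeral\<close>)
      then obtain uc where uc: "uc \<in> Lp 3 \<nu>" "(\<lambda>k. cube_int \<nu> (snd (U k) - uc)) \<longlonglongrightarrow> 0" by blast
      have "\<exists>f. f \<in> Lp 2 \<nu> \<and> (\<lambda>k. \<integral>y. (W k i y - f y)\<^sup>2 \<partial>\<nu>) \<longlonglongrightarrow> 0" for i
      proof (rule Lp_complete[where F = "\<lambda>k. W k i" and p = 2 and M = \<nu>])
        show "\<exists>n. \<forall>k\<ge>n. \<forall>l\<ge>n. (\<integral>x. norm (W k i x - W l i x) powr 2 \<partial>\<nu>) < e" if "e > 0" for e
          using cs(5)[where i = i] by (intro small[OF that]) (auto simp: powr_numeral Xe)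
      qed (use D(5) in \<open>auto simp: powr_numeral\<close>)
      then have "\<exists>w. \<forall>i. w i \<in> Lp 2 \<nu> \<and> (\<lambda>k. \<integral>y. (W k i y - w i y)\<^sup>2 \<partial>\<nu>) \<longlonglongrightarrow> 0"
        by (intro choice allI)
      then obtain w where w: "\<And>i. w i \<in> Lp 2 \<nu>" "\<And>i. (\<lambda>k. \<integral>y. (W k i y - w i y)\<^sup>2 \<partial>\<nu>) \<longlonglongrightarrow> 0" by blast
      have "((ub, uc), q, w) \<in> flux_fields G"
        by (rule fields_limit[where U = U and W = W]) (use XF ub uc w in auto)
      then have "((ub, uc), q, w) \<in> K" by (simp add: K_def)
      moreover have "(\<lambda>k. convexity * ((\<Sum>i\<in>UNIV. cube_int (\<mu> i) (fst (U k) i - ub i)) + cube_int \<nu> (snd (U k) - uc)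
          + (\<Sum>i\<in>UNIV. \<integral>y. (W k i y - w i y)\<^sup>2 \<partial>\<nu>))) \<longlonglongrightarrow> convexity * ((\<Sum>i\<in>(UNIV :: 2 set). 0) + 0 + (\<Sum>i\<in>(UNIV :: 2 set). 0))"
        by (intro tendsto_intros tendsto_sum ub(2) uc(2) w(2))
      then have "(\<lambda>k. convexity * field_size (X k - ((ub, uc), q, w))) \<longlonglongrightarrow> 0"
        by (simp add: Xe field_size_def flux.flux_square_def)
      ultimately show ?thesis by (intro bexI[of _ "((ub, uc), q, w)"]) auto
    qed
  qed blast
  obtain u w where e: "\<tau> = (u, q, w)" using \<tau>(1) by (cases \<tau>) (auto simp: K_def)
  show ?thesis
  proof (rule that)
    show "(u, q, w) \<in> flux_fields G" using KF[OF \<tau>(1)] e by simp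
    show "total_form (u, q, w) (v, 0, z) = l (v, 0, z)" if "(v, 0, z) \<in> flux_fields G" for v z
      using \<tau>(2)[of "(v, 0, z)"] that by (simp add: Z_def e)
  qed
qed

lemma pressure_exists:
  assumes l: "bdd_lin l" and zero: "\<And>v z. (v, 0, z) \<in> flux_fields G \<Longrightarrow> l (v, 0, z) = 0"
  obtains p where "p \<in> M_space G" "\<And>v s z. (v, s, z) \<in> flux_fields G \<Longrightarrow> l (v, s, z) = pairing G s p"
proof -
  obtain D where D: "0 \<le> D" "\<And>s. s \<in> M_dual G \<Longrightarrow> \<exists>v. (v, s, 0) \<in> flux_fields G \<and>
      (\<forall>i. cube_int (\<mu> i) (fst v i) \<le> D * cube_int (\<mu> i) (fst s i)) \<and> cube_int \<nu> (snd v) \<le> D * cube_int \<nu> (snd s)"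
    using divergence_right_inverse by blast
  then obtain R where R: "\<And>s. s \<in> M_dual G \<Longrightarrow> (R s, s, 0) \<in> flux_fields G"
    "\<And>s i. s \<in> M_dual G \<Longrightarrow> cube_int (\<mu> i) (fst (R s) i) \<le> D * cube_int (\<mu> i) (fst s i)"
    "\<And>s. s \<in> M_dual G \<Longrightarrow> cube_int \<nu> (snd (R s)) \<le> D * cube_int \<nu> (snd s)" by metis
  define F where "F s = l (R s, s, 0)" for s
  define S where "S s = (\<Sum>i\<in>UNIV. cube_int (\<mu> i) (fst s i)) + cube_int \<nu> (snd s)" for s :: "('n, 'm) pressure"
  have ladd: "l (\<tau> + \<sigma>) = l \<tau> + l \<sigma>" if "\<tau> \<in> flux_fields G" "\<sigma> \<in> flux_fields G" for \<tau> \<sigma>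
    using l that unfolding bdd_lin_def by blast
  have lscale: "l (c *\<^sub>R \<tau>) = c * l \<tau>" if "\<tau> \<in> flux_fields G" for \<tau> c
    using l that unfolding bdd_lin_def by blast
  \<comment> \<open>Two fields of equal divergence differ by a divergence free one, on which
    \<open>l\<close> vanishes. The value thus depends on \<open>s\<close> alone, and
    \<open>F\<close> is linear although \<open>R\<close> is an arbitrary, possibly nonlinear
    selection.\<close>
  have Fl: "l (v, s, z) = F s" if f: "(v, s, z) \<in> flux_fields G" for v s z
  proof -
    have s: "s \<in> M_dual G" using f by (simp add: flux_fields_def)
    have "(v, s, z) - (R s, s, 0) \<in> flux_fields G" by (rule field_minus[OF f R(1)[OF s]])
    then have d: "(v - R s, 0, z) \<in> flux_fields G" by simp
    have "(v, s, z) = (v - R s, 0, z) + (R s, s, 0)" by simp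
    then show ?thesis using ladd[OF d R(1)[OF s]] zero[OF d] by (simp add: F_def)
  qed
  have Fadd: "F (s + s') = F s + F s'" if "s \<in> M_dual G" "s' \<in> M_dual G" for s s'
    using Fl[of "R s + R s'" "s + s'" 0] fields_add[OF R(1) R(1), of s s'] ladd[OF R(1) R(1), of s s'] that
    by (simp add: F_def)
  have Fscale: "F (c *\<^sub>R s) = c * F s" if "s \<in> M_dual G" for c s
    using Fl[of "c *\<^sub>R R s" "c *\<^sub>R s" 0] fields_scale[OF R(1), of s c] lscale[OF R(1), of s c] that
    by (simp add: F_def)
  obtain B E where B: "0 \<le> B" "\<And>\<tau>. \<tau> \<in> flux_fields G \<Longrightarrow> \<bar>l \<tau>\<bar> \<le> B * (field_size \<tau> + div_size \<tau>) + E"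
    using l unfolding bdd_lin_def by blast
  \<comment> \<open>Boundedness of the right inverse turns a bound by the size of the field into a
    bound by the size of its divergence.\<close>
  have Fb: "\<bar>F s\<bar> \<le> (B * (D + 1)) * S s + E" if s: "s \<in> M_dual G" for s
  proof -
    have "(\<Sum>i\<in>UNIV. cube_int (\<mu> i) (fst (R s) i)) \<le> (\<Sum>i\<in>UNIV. D * cube_int (\<mu> i) (fst s i))"
      by (intro sum_mono R(2)[OF s])
    then have "field_size (R s, s, 0) \<le> D * S s"
      using R(3)[OF s] by (simp add: field_size_def S_def flux.flux_square_def distrib_left sum_distrib_left)
    moreover have "div_size (R s, s, 0) = S s" by (simp add: div_size_def S_def)
    ultimately have "B * (field_size (R s, s, 0) + div_size (R s, s, 0)) \<le> B * (D * S s + S s)"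
      using B(1) by (intro mult_left_mono) auto
    then show ?thesis using B(2)[OF R(1)[OF s]] by (simp add: F_def algebra_simps)
  qed
  \<comment> \<open>The Riesz representation treats scalar functions on one measure space, so
    \<open>F\<close> is split along the three components of a divergence.\<close>
  define inj where "inj i f = ((\<lambda>j. if j = i then f else 0), 0 :: real^'m \<Rightarrow> real)" for i :: 2 and f :: "real^'n \<Rightarrow> real"
  have injM: "inj i f \<in> M_dual G" if "f \<in> Lp 3 (\<mu> i)" for i f
    using that by (auto simp: inj_def M_dual_def Lp_0 zero_fun_def)
  have injS: "S (inj i f) = cube_int (\<mu> i) f" for i f
  proof -
    have "(\<Sum>j\<in>UNIV. cube_int (\<mu> j) (if j = i then f else 0)) = (\<Sum>j\<in>UNIV. if j = i then cube_int (\<mu> i) f else 0)"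
      by (intro sum.cong) (auto simp: cube_int_0)
    then show ?thesis by (simp add: S_def inj_def cube_int_0)
  qed
  have inj_add: "inj i (f + g) = inj i f + inj i g" for i f g by (auto simp: inj_def fun_eq_iff)
  have inj_scale: "inj i (c *\<^sub>R f) = c *\<^sub>R inj i f" for i f c by (auto simp: inj_def fun_eq_iff)
  have cM: "(0, f) \<in> M_dual G" if "f \<in> Lp 3 \<nu>" for f
    using that by (auto simp: M_dual_def Lp_0 zero_fun_def)
  have cS: "S (0, f) = cube_int \<nu> f" for f by (simp add: S_def cube_int_0)
  have "\<exists>p\<in>Lp (3/2) (\<mu> i). \<forall>f\<in>Lp 3 (\<mu> i). F (inj i f) = (\<integral>x. f x * p x \<partial>\<mu> i)" for i
  proof (rule Lp_3_Riesz[OF fin_part, of i "\<lambda>f. F (inj i f)"])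
    show "F (inj i (f + g)) = F (inj i f) + F (inj i g)" if "f \<in> Lp 3 (\<mu> i)" "g \<in> Lp 3 (\<mu> i)" for f g
      using Fadd[OF injM injM] that by (simp add: inj_add)
    show "F (inj i (c *\<^sub>R f)) = c * F (inj i f)" if "f \<in> Lp 3 (\<mu> i)" for f c
      using Fscale[OF injM] that by (simp add: inj_scale)
    show "\<bar>F (inj i f)\<bar> \<le> B * (D + 1) * cube_int (\<mu> i) f + E" if "f \<in> Lp 3 (\<mu> i)" for f
      using Fb[OF injM[OF that]] by (simp add: injS)
  qed blast
  then obtain pb where pb: "\<And>i. pb i \<in> Lp (3/2) (\<mu> i)" "\<And>i f. f \<in> Lp 3 (\<mu> i) \<Longrightarrow> F (inj i f) = (\<integral>x. f x * pb i x \<partial>\<mu> i)"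
    by metis
  obtain pc where pc: "pc \<in> Lp (3/2) \<nu>" "\<And>f. f \<in> Lp 3 \<nu> \<Longrightarrow> F (0, f) = (\<integral>x. f x * pc x \<partial>\<nu>)"
  proof (rule Lp_3_Riesz[OF fin_cut, of "\<lambda>f. F (0, f)"])
    show "F (0, f + g) = F (0, f) + F (0, g)" if "f \<in> Lp 3 \<nu>" "g \<in> Lp 3 \<nu>" for f g
      using Fadd[OF cM cM] that by simp
    show "F (0, c *\<^sub>R f) = c * F (0, f)" if "f \<in> Lp 3 \<nu>" for f c
      using Fscale[OF cM[OF that], of c] by simp
    show "\<bar>F (0, f)\<bar> \<le> B * (D + 1) * cube_int \<nu> f + E" if "f \<in> Lp 3 \<nu>" for f
      using Fb[OF cM[OF that]] by (simp add: cS)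
  qed blast
  have "F s = pairing G s (pb, pc)" if s: "s \<in> M_dual G" for s
  proof -
    have sL: "fst s i \<in> Lp 3 (\<mu> i)" "snd s \<in> Lp 3 \<nu>" for i using s by (auto simp: M_dual_def)
    have e: "s = inj 1 (fst s 1) + (inj 2 (fst s 2) + (0, snd s))"
    proof (rule prod_eqI)
      show "fst s = fst (inj 1 (fst s 1) + (inj 2 (fst s 2) + (0, snd s)))"
      proof
        fix j :: 2
        have "j = 1 \<or> j = 2" by (rule exhaust_2)
        then show "fst s j = fst (inj 1 (fst s 1) + (inj 2 (fst s 2) + (0, snd s))) j"
          by (auto simp: inj_def)
      qed
    qed (simp add: inj_def)
    have M2: "inj 2 (fst s 2) + (0, snd s) \<in> M_dual G"
      using injM[OF sL(1)[of 2]] cM[OF sL(2)] unfolding M_dual_def by (auto intro!: Lp_plus)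
    have "F s = F (inj 1 (fst s 1)) + (F (inj 2 (fst s 2)) + F (0, snd s))"
      using Fadd[OF injM[OF sL(1)[of 1]] M2] Fadd[OF injM[OF sL(1)[of 2]] cM[OF sL(2)]] e by simp
    then show ?thesis by (simp add: pb(2)[OF sL(1)] pc(2)[OF sL(2)] pairing_def sum_2)
  qed
  moreover have "(pb, pc) \<in> M_space G" using pb(1) pc(1) by (simp add: M_space_def)
  moreover have "s \<in> M_dual G" if "(v, s, z) \<in> flux_fields G" for v s z using that by (simp add: flux_fields_def)
  ultimately show ?thesis using Fl by (intro that[of "(pb, pc)"]) auto
qed

section \<open>Assembly of the solution and its uniqueness\<close>

lemma pairing_diff:
  assumes "s \<in> M_dual G" "s' \<in> M_dual G" "p \<in> M_space G"
  shows "pairing G (s - s') p = pairing G s p - pairing G s' p"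
proof -
  have p: "fst p i \<in> Lp (3/2) (\<mu> i)" "snd p \<in> Lp (3/2) \<nu>" for i using assms(3) by (auto simp: M_space_def)
  have "integrable (\<mu> i) (\<lambda>x. fst s i x * fst p i x)" "integrable \<nu> (\<lambda>x. snd s x * snd p x)" if "s \<in> M_dual G" for s i
    using that Lp_pairing_3(1)[OF _ p(1)] Lp_pairing_3(1)[OF _ p(2)] by (auto simp: M_dual_def)
  then show ?thesis using assms by (simp add: pairing_def left_diff_distrib sum_subtractf)
qed

lemma pairing_diff_right:
  assumes "s \<in> M_dual G" "p \<in> M_space G" "p' \<in> M_space G"
  shows "pairing G s (p - p') = pairing G s p - pairing G s p'"
proof -
  have s: "fst s i \<in> Lp 3 (\<mu> i)" "snd s \<in> Lp 3 \<nu>" for i using assms(1) by (auto simp: M_dual_def)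
  have "integrable (\<mu> i) (\<lambda>x. fst s i x * fst p i x)" "integrable \<nu> (\<lambda>x. snd s x * snd p x)" if "p \<in> M_space G" for p i
    using that Lp_pairing_3(1)[OF s(1)] Lp_pairing_3(1)[OF s(2)] by (auto simp: M_space_def)
  then show ?thesis using assms by (simp add: pairing_def right_diff_distrib sum_subtractf)
qed

lemma pressure_unique:
  assumes p: "p \<in> M_space G" and zero: "\<And>s. s \<in> M_dual G \<Longrightarrow> pairing G s p = 0"
  shows "AE x in \<mu> i. fst p i x = 0" "AE y in \<nu>. snd p y = 0"
proof -
  show "AE x in \<mu> i. fst p i x = 0"
  proof (rule Lp_3_half_zero)
    show "fst p i \<in> Lp (3/2) (\<mu> i)" using p by (simp add: M_space_def)
    fix f :: "real^'n \<Rightarrow> real" assume f: "f \<in> Lp 3 (\<mu> i)"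
    have "((\<lambda>j. if j = i then f else 0), 0) \<in> M_dual G"
      using f by (auto simp: M_dual_def Lp_0 zero_fun_def)
    from zero[OF this] have "(\<Sum>j\<in>UNIV. \<integral>x. (if j = i then f else 0) x * fst p j x \<partial>\<mu> j) = 0"
      by (simp add: pairing_def)
    also have "(\<Sum>j\<in>UNIV. \<integral>x. (if j = i then f else 0) x * fst p j x \<partial>\<mu> j) = (\<Sum>j\<in>UNIV. if j = i then \<integral>x. f x * fst p i x \<partial>\<mu> i else 0)"
      by (intro sum.cong) auto
    finally show "(\<integral>x. f x * fst p i x \<partial>\<mu> i) = 0" by simp
  qed
  show "AE y in \<nu>. snd p y = 0"
  proof (rule Lp_3_half_zero)
    show "snd p \<in> Lp (3/2) \<nu>" using p by (simp add: M_space_def)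
    fix f :: "real^'m \<Rightarrow> real" assume f: "f \<in> Lp 3 \<nu>"
    have "(0, f) \<in> M_dual G" using f by (auto simp: M_dual_def Lp_0 zero_fun_def)
    from zero[OF this] show "(\<integral>x. f x * snd p x \<partial>\<nu>) = 0" by (simp add: pairing_def)
  qed
qed

text \<open>The convexity inequalities at \<open>\<tau>\<close> towards \<open>\<sigma>\<close> and
  at \<open>\<sigma>\<close> towards \<open>\<tau>\<close> are added; the energies cancel and each
  inequality contributes one \<open>convexity * field_size (\<sigma> - \<tau>)\<close>.\<close>

lemma total_form_strongly_monotone:
  assumes "\<tau> \<in> flux_fields G" "\<sigma> \<in> flux_fields G"
  shows "2 * convexity * field_size (\<sigma> - \<tau>) \<le> total_form \<sigma> (\<sigma> - \<tau>) - total_form \<tau> (\<sigma> - \<tau>)"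
proof -
  define \<delta> where "\<delta> = \<sigma> - \<tau>"
  have d: "\<delta> \<in> flux_fields G" "(-1) *\<^sub>R \<delta> \<in> flux_fields G" unfolding \<delta>_def by (intro field_scale field_minus assms)+
  have "total_form \<sigma> ((-1) *\<^sub>R \<delta>) = (-1) * total_form \<sigma> \<delta>"
    using total_form_bdd_lin[OF assms(2)] d(1) unfolding bdd_lin_def by blast
  moreover have "field_size ((-1) *\<^sub>R \<delta>) = field_size \<delta>"
    by (cases \<delta>) (simp only: field_size_def split_beta scaleR_prod_def fst_conv snd_conv scaleR_fun_apply
        cube_int_scale flux.flux_square_scale prod.case, simp add: cube_int_def)
  ultimately show ?thesis
    using total_energy_lower[OF assms(1) d(1)] total_energy_lower[OF assms(2) d(2)]
    by (simp add: \<delta>_def)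
qed

lemma field_size_zero:
  assumes "(v, s, z) \<in> flux_fields G" "field_size (v, s, z) \<le> 0"
  shows "AE x in \<mu> i. fst v i x = 0" "AE y in \<nu>. snd v y = 0" "AE y in \<nu>. z i y = 0"
proof -
  note D = fieldsD[OF assms(1)]
  have "cube_int (\<mu> i) (fst v i) \<le> (\<Sum>i\<in>UNIV. cube_int (\<mu> i) (fst v i))"
    by (rule member_le_sum) (auto simp: cube_int_nonneg)
  moreover have "0 \<le> (\<Sum>i\<in>UNIV. cube_int (\<mu> i) (fst v i))" by (intro sum_nonneg cube_int_nonneg)
  moreover have "(\<integral>y. (z i y)\<^sup>2 \<partial>\<nu>) \<le> flux.flux_square z"
    unfolding flux.flux_square_def by (rule member_le_sum) (auto intro!: integral_nonneg_AE)
  moreover have "0 \<le> (\<integral>y. (z i y)\<^sup>2 \<partial>\<nu>)" by (auto intro!: integral_nonneg_AE)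
  ultimately have "cube_int (\<mu> i) (fst v i) = 0" "cube_int \<nu> (snd v) = 0" and z: "(\<integral>y. (z i y)\<^sup>2 \<partial>\<nu>) = 0"
    using assms(2) cube_int_nonneg[of "\<mu> i" "fst v i"] cube_int_nonneg[of \<nu> "snd v"] flux.flux_square_nonneg[of z]
    unfolding field_size_def prod.case by linarith+
  then show "AE x in \<mu> i. fst v i x = 0" "AE y in \<nu>. snd v y = 0"
    using cube_int_0_iff[OF D(1)] cube_int_0_iff[OF D(2)] by auto
  have "AE y in \<nu>. (z i y)\<^sup>2 = 0"
    using z D(5)[of i] unfolding Lp_2_square by (subst (asm) integral_nonneg_eq_0_iff_AE) auto
  then show "AE y in \<nu>. z i y = 0" by eventually_elim simp
qed

lemma solution_exists:
  assumes q: "q \<in> M_dual G" and pd: "admissible_boundary_data G pd"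
  shows "\<exists>u p. solves G C q pd u p"
proof -
  obtain l where l: "bdd_lin l" and g: "\<And>v r z. (v, r, z) \<in> flux_fields G \<Longrightarrow> g_form G pd v = l (v, r, z)"
    using boundary_functional[OF pd] by blast
  obtain u w where u: "(u, q, w) \<in> flux_fields G"
    and crit: "\<And>v z. (v, 0, z) \<in> flux_fields G \<Longrightarrow> total_form (u, q, w) (v, 0, z) = l (v, 0, z)"
    using velocity_exists[OF q l] by blast
  \<comment> \<open>The residual of the momentum equation vanishes on divergence free fields by
    \<open>crit\<close>; this is the compatibility condition for a pressure.\<close>
  have "bdd_lin (\<lambda>\<sigma>. total_form (u, q, w) \<sigma> - l \<sigma>)" by (intro bdd_lin_diff total_form_bdd_lin u l)
  then obtain p where p: "p \<in> M_space G"
    and eq: "\<And>v s z. (v, s, z) \<in> flux_fields G \<Longrightarrow> total_form (u, q, w) (v, s, z) - l (v, s, z) = pairing G s p"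
    using pressure_exists[of "\<lambda>\<sigma>. total_form (u, q, w) \<sigma> - l \<sigma>"] crit by auto
  note W = fields_W[OF u]
  have "a_form G C u v - b_form G v p = g_form G pd v" if v: "v \<in> W_space G" for v
  proof -
    note c = W_fields[OF v]
    \<comment> \<open>The form \<open>a_form\<close> refers to the chosen divergence and fluxes of
      \<open>u\<close>, the construction to the carried \<open>q\<close> and
      \<open>w\<close>.\<close>
    have "total_form (u, Div G u, normal_flux G u) (v, Div G v, normal_flux G v) = total_form (u, q, w) (v, Div G v, normal_flux G v)"
      using W(4) by (intro total_form_cong[OF W_fields[OF W(1)] u c]) auto
    then show ?thesis using eq[OF c] g[OF c] by (simp add: a_form_canonical b_form_def)
  qed
  moreover have "b_form G u r = f_form G q r" if "r \<in> M_space G" for r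
    using pairing_canonical[OF u that] by (simp add: b_form_def f_form_def)
  ultimately show ?thesis using W(1) p unfolding solves_def by blast
qed

lemma solution_unique:
  assumes "solves G C q pd u p" "solves G C q pd u' p'"
  shows "same_element G u' u" "same_element G p' p"
proof -
  have u: "u \<in> W_space G" "u' \<in> W_space G" and p: "p \<in> M_space G" "p' \<in> M_space G"
    and eq: "\<And>v. v \<in> W_space G \<Longrightarrow> a_form G C u v - b_form G v p = a_form G C u' v - b_form G v p'"
    and div: "\<And>r. r \<in> M_space G \<Longrightarrow> b_form G u r = b_form G u' r"
    using assms unfolding solves_def by auto
  define \<tau> where "\<tau> = (u, Div G u, normal_flux G u)"
  define \<sigma> where "\<sigma> = (u', Div G u', normal_flux G u')"
  have \<tau>: "\<tau> \<in> flux_fields G" and \<sigma>: "\<sigma> \<in> flux_fields G" unfolding \<tau>_def \<sigma>_def by (rule W_fields[OF u(1)] W_fields[OF u(2)])+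
  have D: "Div G u \<in> M_dual G" "Div G u' \<in> M_dual G" using \<tau> \<sigma> by (auto simp: \<tau>_def \<sigma>_def flux_fields_def)
  have d: "(u' - u, Div G u' - Div G u, normal_flux G u' - normal_flux G u) \<in> flux_fields G"
    using field_minus[OF \<sigma> \<tau>] by (simp add: \<tau>_def \<sigma>_def)
  have form: "a_form G C u v = total_form \<tau> (v, s, z)" "a_form G C u' v = total_form \<sigma> (v, s, z)" if "(v, s, z) \<in> flux_fields G" for v s z
    using bdd_lin_canonical[OF total_form_bdd_lin[OF \<tau>] that] bdd_lin_canonical[OF total_form_bdd_lin[OF \<sigma>] that]
    by (auto simp: a_form_canonical \<tau>_def \<sigma>_def)
  \<comment> \<open>The difference of two solutions is divergence free, so both pressure terms
    vanish when it is used as test field; strong monotonicity then forces its size to be 0.\<close>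
  have "b_form G (u' - u) r = 0" if r: "r \<in> M_space G" for r
    using pairing_canonical[OF d r] pairing_diff[OF D(2,1) r] div[OF r] by (simp add: b_form_def)
  then have "a_form G C u (u' - u) = a_form G C u' (u' - u)"
    using eq[OF fields_W(1)[OF d]] p by simp
  then have "2 * convexity * field_size (\<sigma> - \<tau>) \<le> 0"
    using total_form_strongly_monotone[OF \<tau> \<sigma>] form[OF d] by (simp add: \<tau>_def \<sigma>_def)
  then have "field_size (u' - u, Div G u' - Div G u, normal_flux G u' - normal_flux G u) \<le> 0"
    using convexity(1) by (simp add: \<tau>_def \<sigma>_def mult_le_0_iff)
  note z = field_size_zero[OF d this]
  have ae: "AE x in \<mu> i. fst u' i x = fst u i x" "AE y in \<nu>. snd u' y = snd u y"
    "AE y in \<nu>. normal_flux G u' i y = normal_flux G u i y" for i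
    using z(1)[of i] z(2) z(3)[of i] by (auto elim: eventually_mono)
  then show "same_element G u' u" by (simp add: same_element_def)
  have "pairing G s (p' - p) = 0" if s: "s \<in> M_dual G" for s
  proof -
    \<comment> \<open>Every \<open>s\<close> in \<open>M_dual\<close> is the divergence of some
      field. Tested with it, the equal values of \<open>a_form\<close> cancel and leave the pairing
      of \<open>s\<close> with \<open>p' - p\<close>.\<close>
    obtain v where v: "(v, s, 0) \<in> flux_fields G" using divergence_right_inverse s by metis
    have "a_form G C u' v = a_form G C u v"
      unfolding form[OF v] \<tau>_def \<sigma>_def
      using ae by (intro total_form_cong[OF \<sigma>[unfolded \<sigma>_def] \<tau>[unfolded \<tau>_def] v]) auto
    then have "b_form G v p' = b_form G v p" using eq[OF fields_W(1)[OF v]] by simp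
    then show ?thesis
      using pairing_canonical[OF v p(1)] pairing_canonical[OF v p(2)] pairing_diff_right[OF s p(2,1)]
      by (simp add: b_form_def)
  qed
  moreover have "p' - p \<in> M_space G" using p by (auto simp: M_space_def intro!: Lp_sub)
  ultimately have "AE x in \<mu> i. fst (p' - p) i x = 0" "AE y in \<nu>. snd (p' - p) y = 0" for i
    using pressure_unique by blast+
  then show "same_element G p' p" by (simp add: same_element_def)
qed

end

theorem theorem1:
  fixes G :: "('n::finite, 'm::finite) geometry"
    and C :: "('n, 'm) coefficients"
    and q pd :: "('n, 'm) pressure"
  assumes "fractured_domain G"
    and "admissible_coefficients G C"
    and "q \<in> M_dual G"
    and "admissible_boundary_data G pd"
  shows "\<exists>u p. solves G C q pd u p \<and>
           (\<forall>u' p'. solves G C q pd u' p' \<longrightarrow> same_element G u' u \<and> same_element G p' p)"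
proof -
  interpret fracture_model G C by unfold_locales (fact assms)+
  show ?thesis using solution_exists[OF assms(3,4)] solution_unique by meson
qed

end
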